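(* Let $\mathcal{H}_A,\mathcal{H}_B$ be finite-dimensional Hilbert spaces of dimensions $d_A,d_B$, let $U\in\mathsf{U}(\mathcal{H}_A\otimes\mathcal{H}_B)$, let $\mathcal{U}(\rho)=U\rho U^\dagger$, and let $U=\sum_{j=1}^m c_j V_j\otimes W_j$ with $c\in\mathbb{R}^m$, $V_j\in\mathsf{U}(\mathcal{H}_A)$, $W_j\in\mathsf{U}(\mathcal{H}_B)$. Set $\phi:=2\|c\|_1^2-\|c\|_2^2$. Then the double Hadamard test associated with this decomposition (described in the context) is a local space-like cut of $\mathcal{U}$ with two ancilla qubits ($d_{R_A}=d_{R_B}=2$) and 1-norm $\phi$; that is, $$\mathcal{U}=\sum_{i,j}c_ic_j\,(\mathrm{id}_{AB}\otimes\mathcal{T})\circ(\mathcal{V}^{(i,j,0)}\otimes\mathcal{W}^{(i,j,0)})-\sum_{i\neq j}c_ic_j\,(\mathrm{id}_{AB}\otimes\mathcal{T})\circ(\mathcal{V}^{(i,j,1)}\otimes\mathcal{W}^{(i,j,1)}),$$ a decomposition whose coefficient vector has 1-norm $\phi$. Moreover, if the decomposition $U=\sum_j c_jV_j\otimes W_j$ is an operator Schmidt decomposition, then $$\phi=\xi(U)=\gamma(\mathcal{U})=2\|c\|_1^2-1.$$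
   Context: Sign convention: replacing $V_j$ by $\mathrm{sign}(c_j)V_j$ and $c_j$ by $|c_j|$ (and dropping zero terms), we may regard all $c_j>0$; $\phi$ depends only on $|c|$. Double Hadamard test: for $(i,j,g)\in[m]^2\times\{0,1\}$, let $\mathcal{V}^{(i,j,g)}:\mathsf{L}(\mathcal{H}_A)\to\mathsf{L}(\mathcal{H}_A\otimes\mathbb{C}^2_{R_A})$ be the isometric channel that appends an ancilla qubit $R_A$ in $|0\rangle$, applies a Hadamard gate to $R_A$, then (if $g=1$) the phase gate $S=\mathrm{diag}(1,\mathrm{i})$ to $R_A$, then the controlled unitary $|0\rangle\langle0|_{R_A}\otimes V_i+|1\rangle\langle1|_{R_A}\otimes V_j$, then a Hadamard gate on $R_A$. Define $\mathcal{W}^{(i,j,g)}$ on $B$ with ancilla $R_B$ identically with $W_i,W_j$ in place of $V_i,V_j$. Let $\mathcal{T}:\mathsf{L}(\mathbb{C}^2_{R_A}\otimes\mathbb{C}^2_{R_B})\to\mathbb{C}$, $\mathcal{T}(Y)=\mathrm{Tr}((\sigma_z\otimes\sigma_z)Y)$. A space-like cut of a channel $\mathcal{N}_{AB\to AB}$ is a decomposition $\mathcal{N}=\sum_{i=1}^m a_i(\mathrm{id}_{AB}\otimes\mathcal{T}_i)\circ\mathcal{E}_i$ with $a\in\mathbb{R}^m$, channels $\mathcal{E}_i:\mathsf{L}(\mathcal{H}_{AB})\to\mathsf{L}(\mathcal{H}_{AR_ABR_B})$ implementable by LOCC between $A R_A$ and $B R_B$, and $\mathcal{T}_i(Y)=\mathrm{Tr}(O_iY)$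 with $O_i=O_i^{(A)}\otimes O_i^{(B)}$, $O_i^{(A)}\in\mathsf{L}(\mathcal{H}_{R_A})$, $O_i^{(B)}\in\mathsf{L}(\mathcal{H}_{R_B})$, $\|O_i\|\le1$. Its 1-norm is $\|a\|_1$; $\gamma(\mathcal{N})$ is the infimum of the 1-norm over all space-like cuts. It is local if each $\mathcal{E}_i=\mathcal{V}_i\otimes\mathcal{W}_i$ with $\mathcal{V}_i,\mathcal{W}_i$ isometric channels. The product extent $\xi(U)$ is the minimum of $2\|c\|_1^2-\|c\|_2^2$ over all decompositions $U=\sum_j c_jV_j\otimes W_j$ with $c$ real and $V_j,W_j$ unitary. An operator Schmidt decomposition of $X\in\mathsf{L}(\mathcal{H}_{AB})$ is $X=\sum_j\lambda_jA_j\otimes B_j$ with $\mathrm{Tr}(A_j^\dagger A_k)=d_A\delta_{jk}$, $\mathrm{Tr}(B_j^\dagger B_k)=d_B\delta_{jk}$, $\lambda_j>0$, $\sum_j\lambda_j^2=1$. *)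

theory Defs
  imports Complex_Main "Jordan_Normal_Form.Matrix"
begin

definition adj :: "complex mat \<Rightarrow> complex mat" where
  "adj A = mat (dim_col A) (dim_row A) (\<lambda>(i,j). cnj (A $$ (j,i)))"

text \<open>Kronecker (tensor) product; the index of a basis vector of the first factor is the
  more significant one, i.e. index (x,y) of H1 (x) H2 is x * dim H2 + y.\<close>
definition kron :: "complex mat \<Rightarrow> complex mat \<Rightarrow> complex mat" where
  "kron A B = mat (dim_row A * dim_row B) (dim_col A * dim_col B)
     (\<lambda>(i,j). A $$ (i div dim_row B, j div dim_col B) * B $$ (i mod dim_row B, j mod dim_col B))"

definition unitary_mat :: "nat \<Rightarrow> complex mat \<Rightarrow> bool" where
  "unitary_mat n U \<longleftrightarrow> U \<in> carrier_mat n n \<and> adj U * U = 1\<^sub>m n \<and> U * adj U = 1\<^sub>m n"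

definition isometry_mat :: "nat \<Rightarrow> nat \<Rightarrow> complex mat \<Rightarrow> bool" where
  "isometry_mat n' n K \<longleftrightarrow> K \<in> carrier_mat n' n \<and> adj K * K = 1\<^sub>m n"

definition trace_c :: "complex mat \<Rightarrow> complex" where
  "trace_c A = (\<Sum>i<dim_row A. A $$ (i,i))"

definition vnorm :: "complex vec \<Rightarrow> real" where
  "vnorm v = sqrt (\<Sum>i<dim_vec v. (cmod (v $ i))\<^sup>2)"

definition op_norm :: "complex mat \<Rightarrow> real" where
  "op_norm M = Sup {vnorm (M *\<^sub>v v) | v. v \<in> carrier_vec (dim_col M) \<and> vnorm v \<le> 1}"

definition msum :: "nat \<Rightarrow> nat \<Rightarrow> (nat \<Rightarrow> complex mat) \<Rightarrow> complex mat" where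
  "msum n k f = mat n n (\<lambda>(i,j). \<Sum>l<k. f l $$ (i,j))"

text \<open>A bipartite system is described by its pair of local dimensions (a,b); operators on it
  are (a*b) x (a*b) matrices in the ordering of kron.  Superoperators are HOL functions on
  matrices; two superoperators are identified when they agree on all operators of the input
  dimension.\<close>

definition kraus_apply :: "nat \<Rightarrow> complex mat list \<Rightarrow> complex mat \<Rightarrow> complex mat" where
  "kraus_apply n Ks \<rho> = msum n (length Ks) (\<lambda>l. Ks ! l * \<rho> * adj (Ks ! l))"

definition kraus_complete :: "nat \<Rightarrow> complex mat list \<Rightarrow> bool" where
  "kraus_complete n Ks \<longleftrightarrow> msum n (length Ks) (\<lambda>l. adj (Ks ! l) * Ks ! l) = 1\<^sub>m n"

text \<open>LOCC instruments (finite-round LOCC): local instruments of either party (given by a Kraus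
  family per outcome, jointly trace preserving, possibly changing the local dimension) and
  conditional composition (after each outcome k of the first instrument an LOCC instrument
  depending on k is applied; outcomes are the pairs).\<close>
inductive LOCC_instr :: "nat \<times> nat \<Rightarrow> nat \<times> nat \<Rightarrow> (complex mat \<Rightarrow> complex mat) list \<Rightarrow> bool" where
  localA: "(\<forall>Ks\<in>set Kss. \<forall>K\<in>set Ks. K \<in> carrier_mat a' a) \<Longrightarrow> kraus_complete a (concat Kss) \<Longrightarrow>
     LOCC_instr (a,b) (a',b)
       (map (\<lambda>Ks. kraus_apply (a'*b) (map (\<lambda>K. kron K (1\<^sub>m b)) Ks)) Kss)"
| localB: "(\<forall>Ks\<in>set Kss. \<forall>K\<in>set Ks. K \<in> carrier_mat b' b) \<Longrightarrow> kraus_complete b (concat Kss) \<Longrightarrow>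
     LOCC_instr (a,b) (a,b')
       (map (\<lambda>Ks. kraus_apply (a*b') (map (\<lambda>K. kron (1\<^sub>m a) K) Ks)) Kss)"
| comp: "LOCC_instr d1 d2 Es \<Longrightarrow> (\<forall>k<length Es. LOCC_instr d2 d3 (Fs k)) \<Longrightarrow>
     LOCC_instr d1 d3 (concat (map (\<lambda>k. map (\<lambda>F. F \<circ> (Es ! k)) (Fs k)) [0..<length Es]))"

definition LOCC_channel :: "nat \<times> nat \<Rightarrow> nat \<times> nat \<Rightarrow> (complex mat \<Rightarrow> complex mat) \<Rightarrow> bool" where
  "LOCC_channel d1 d2 E \<longleftrightarrow> (\<exists>Es. LOCC_instr d1 d2 Es \<and>
     (\<forall>\<rho>\<in>carrier_mat (fst d1 * snd d1) (fst d1 * snd d1).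
        E \<rho> = msum (fst d2 * snd d2) (length Es) (\<lambda>k. (Es ! k) \<rho>)))"

text \<open>(id_AB (x) T)(Y) for T(Z) = Tr((OA (x) OB) Z), where Y acts on
  (H_A (x) H_RA) (x) (H_B (x) H_RB) with dims a, rA, b, rB; the result acts on H_A (x) H_B.\<close>
definition obs_trace :: "nat \<Rightarrow> nat \<Rightarrow> complex mat \<Rightarrow> complex mat \<Rightarrow> complex mat \<Rightarrow> complex mat" where
  "obs_trace a b OA OB Y = (let rA = dim_row OA; rB = dim_row OB in
     mat (a*b) (a*b) (\<lambda>(i,j).
       let x = i div b; y = i mod b; x' = j div b; y' = j mod b in
       \<Sum>k<rA. \<Sum>k'<rA. \<Sum>l<rB. \<Sum>l'<rB.
         OA $$ (k,k') * OB $$ (l,l') *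
         Y $$ ((x*rA + k') * (b*rB) + (y*rB + l'), (x'*rA + k) * (b*rB) + (y'*rB + l))))"

type_synonym cut = "(real \<times> (complex mat \<Rightarrow> complex mat) \<times> complex mat \<times> complex mat) list"

definition cut_apply :: "nat \<Rightarrow> nat \<Rightarrow> cut \<Rightarrow> complex mat \<Rightarrow> complex mat" where
  "cut_apply a b C \<rho> = msum (a*b) (length C)
     (\<lambda>i. case C ! i of (c, E, OA, OB) \<Rightarrow> complex_of_real c \<cdot>\<^sub>m obs_trace a b OA OB (E \<rho>))"

definition cut_norm :: "cut \<Rightarrow> real" where
  "cut_norm C = (\<Sum>i<length C. \<bar>fst (C ! i)\<bar>)"

definition space_like_cut :: "nat \<Rightarrow> nat \<Rightarrow> (complex mat \<Rightarrow> complex mat) \<Rightarrow> nat \<Rightarrow> nat \<Rightarrow> cut \<Rightarrow> bool" where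
  "space_like_cut a b N rA rB C \<longleftrightarrow> 0 < rA \<and> 0 < rB \<and>
     (\<forall>(c, E, OA, OB)\<in>set C.
        LOCC_channel (a,b) (a*rA, b*rB) E \<and> OA \<in> carrier_mat rA rA \<and> OB \<in> carrier_mat rB rB \<and>
        op_norm (kron OA OB) \<le> 1) \<and>
     (\<forall>\<rho>\<in>carrier_mat (a*b) (a*b). N \<rho> = cut_apply a b C \<rho>)"

definition local_space_like_cut :: "nat \<Rightarrow> nat \<Rightarrow> (complex mat \<Rightarrow> complex mat) \<Rightarrow> nat \<Rightarrow> nat \<Rightarrow> cut \<Rightarrow> bool" where
  "local_space_like_cut a b N rA rB C \<longleftrightarrow> space_like_cut a b N rA rB C \<and>
     (\<forall>(c, E, OA, OB)\<in>set C. \<exists>KV KW. isometry_mat (a*rA) a KV \<and> isometry_mat (b*rB) b KW \<and>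
        (\<forall>\<rho>\<in>carrier_mat (a*b) (a*b). E \<rho> = kron KV KW * \<rho> * adj (kron KV KW)))"

definition gamma :: "nat \<Rightarrow> nat \<Rightarrow> (complex mat \<Rightarrow> complex mat) \<Rightarrow> real" where
  "gamma a b N = Inf {cut_norm C | C rA rB. space_like_cut a b N rA rB C}"

definition product_extent :: "nat \<Rightarrow> nat \<Rightarrow> complex mat \<Rightarrow> real" where
  "product_extent a b U = Inf {2 * (\<Sum>j<m. \<bar>c j\<bar>)\<^sup>2 - (\<Sum>j<m. (c j)\<^sup>2) | m c V W.
      (\<forall>j<m. unitary_mat a (V j) \<and> unitary_mat b (W j)) \<and>
      U = msum (a*b) m (\<lambda>j. complex_of_real (c j) \<cdot>\<^sub>m kron (V j) (W j))}"

definition op_schmidt :: "nat \<Rightarrow> nat \<Rightarrow> complex mat \<Rightarrow> nat \<Rightarrow> (nat \<Rightarrow> real) \<Rightarrow> (nat \<Rightarrow> complex mat) \<Rightarrow> (nat \<Rightarrow> complex mat) \<Rightarrow> bool" where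
  "op_schmidt a b X m lam A B \<longleftrightarrow>
     (\<forall>j<m. A j \<in> carrier_mat a a \<and> B j \<in> carrier_mat b b \<and> 0 < lam j) \<and>
     (\<forall>j<m. \<forall>k<m. trace_c (adj (A j) * A k) = (if j = k then of_nat a else 0) \<and>
                  trace_c (adj (B j) * B k) = (if j = k then of_nat b else 0)) \<and>
     (\<Sum>j<m. (lam j)\<^sup>2) = 1 \<and>
     X = msum (a*b) m (\<lambda>j. complex_of_real (lam j) \<cdot>\<^sub>m kron (A j) (B j))"

definition hadamard :: "complex mat" where
  "hadamard = mat 2 2 (\<lambda>(i,j). if i = 1 \<and> j = 1 then - 1 / complex_of_real (sqrt 2) else 1 / complex_of_real (sqrt 2))"

definition phase_S :: "complex mat" where
  "phase_S = mat 2 2 (\<lambda>(i,j). if i = 0 \<and> j = 0 then 1 else if i = 1 \<and> j = 1 then \<i> else 0)"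

definition sigma_z :: "complex mat" where
  "sigma_z = mat 2 2 (\<lambda>(i,j). if i = 0 \<and> j = 0 then 1 else if i = 1 \<and> j = 1 then - 1 else 0)"

definition ket0 :: "complex mat" where
  "ket0 = mat 2 1 (\<lambda>(i,j). if i = 0 then 1 else 0)"

definition proj :: "nat \<Rightarrow> complex mat" where
  "proj k = mat 2 2 (\<lambda>(i,j). if i = k \<and> j = k then 1 else 0)"

text \<open>Isometry H_d -> H_d (x) C^2_R of the Hadamard-test circuit for the pair (X,Y) and
  bit g: append |0>, Hadamard, S^g, controlled unitary |0><0| (x) X + |1><1| (x) Y,
  Hadamard (operators on the ancilla act as 1_d (x) .).\<close>
definition hadamard_iso :: "nat \<Rightarrow> complex mat \<Rightarrow> complex mat \<Rightarrow> nat \<Rightarrow> complex mat" where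
  "hadamard_iso d X Y g =
     kron (1\<^sub>m d) hadamard * (kron X (proj 0) + kron Y (proj 1)) *
     kron (1\<^sub>m d) (if g = 1 then phase_S else 1\<^sub>m 2) * kron (1\<^sub>m d) hadamard *
     kron (1\<^sub>m d) ket0"

definition dh_channel :: "nat \<Rightarrow> nat \<Rightarrow> (nat \<Rightarrow> complex mat) \<Rightarrow> (nat \<Rightarrow> complex mat) \<Rightarrow> nat \<Rightarrow> nat \<Rightarrow> nat \<Rightarrow> complex mat \<Rightarrow> complex mat" where
  "dh_channel a b V W i j g \<rho> =
     (let K = kron (hadamard_iso a (V i) (V j) g) (hadamard_iso b (W i) (W j) g) in K * \<rho> * adj K)"

definition double_hadamard_cut :: "nat \<Rightarrow> nat \<Rightarrow> nat \<Rightarrow> (nat \<Rightarrow> real) \<Rightarrow> (nat \<Rightarrow> complex mat) \<Rightarrow> (nat \<Rightarrow> complex mat) \<Rightarrow> cut" where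
  "double_hadamard_cut a b m c V W =
     [(c i * c j, dh_channel a b V W i j 0, sigma_z, sigma_z). (i,j) \<leftarrow> List.product [0..<m] [0..<m]] @
     [(- (c i * c j), dh_channel a b V W i j 1, sigma_z, sigma_z). (i,j) \<leftarrow> List.product [0..<m] [0..<m], i \<noteq> j]"

end

theory Submission
  imports Defs "HOL-Analysis.L2_Norm"
begin

text \<open>Upper bound: after the Hadamard test the two ancilla blocks of the isometry are
  \<open>(V\<^sub>i \<plusminus> \<i>\<^sup>g V\<^sub>j)/2\<close>, so measuring \<open>\<sigma>\<^sub>z \<otimes> \<sigma>\<^sub>z\<close> and subtracting the \<open>g = 1\<close>
  from the \<open>g = 0\<close> term leaves the symmetrised cross term \<open>(V\<^sub>i \<otimes> W\<^sub>i) \<rho> (V\<^sub>j \<otimes> W\<^sub>j)\<^sup>\<dagger>\<close>.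

  Lower bound: let \<open>\<Psi>\<close> be the unnormalised maximally entangled vector on the Schmidt basis
  \<open>V\<^sub>j \<otimes> W\<^sub>j\<close>. The functional given by \<open>2|\<Psi>\<rangle>\<langle>\<Psi>| - 1\<close> takes the value \<open>2 \<parallel>c\<parallel>\<^sub>1\<^sup>2 - 1\<close> on the normalised
  Choi matrix of \<open>U\<close>. An LOCC channel has product Kraus operators, so the functional is at most 1
  in modulus on each term of a cut. For observables that need not be Hermitian this follows from
  \<open>2|\<Psi>\<rangle>\<langle>\<Psi>| - 1 = |\<Psi>\<rangle>\<langle>\<Psi>| - (1 - |\<Psi>\<rangle>\<langle>\<Psi>|)\<close>, where the partial transpose of the bracket is \<open>1\<close>
  minus the swap, i.e. it is a sum over antisymmetrised vectors; each half is then bounded by contractivity of the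
  observable. Finally \<open>\<xi>(U) \<ge> \<gamma>\<close> because every product decomposition yields a cut.\<close>

section \<open>Sums, Kronecker products and Kraus maps\<close>

text \<open>For one product vector and no ancillas the bound is Cauchy-Schwarz: all Schmidt
  coefficients of \<Psi> between the parties are 1, so its overlap w with \<alpha> \<otimes> \<beta>
  satisfies |w|^2 \<le> |\<alpha>|^2 |\<beta>|^2. With ancillas each Kraus operator becomes a family
  of product vectors labelled by ancilla basis states, and a non-Hermitian observable mixes its
  members, so positivity gives no bound. Each half of the split witness is a sum of expectation
  values in vectors, where contractivity applies. The triangle inequality costs nothing: the halves
  are bounded by the sums of |w|^2 and of |\<alpha>|^2 |\<beta>|^2 - |w|^2, which add up to the full
  weight of the family. The partial transpose is harmless because it moves to the second observable,
  whose transpose has the same norm. Superoperators are plain functions on matrices, so the cut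
  equation is evaluated on matrix units only, where both sides are explicit. The dimension factor
  cancels: the Kraus weights of an LOCC channel total \<open>a * b\<close>, and so does the squared
  Frobenius norm of \<open>U\<close>.\<close>

lemma sum_list_concat: "sum_list (concat xss) = (\<Sum>xs\<leftarrow>xss. sum_list xs)"
  for xss :: "'a::monoid_add list list"
  by (induction xss) auto

lemma sum_lessThan_nth: "(\<Sum>l<length xs. f (xs ! l)) = (\<Sum>x\<leftarrow>xs. f x)"
  for f :: "'a \<Rightarrow> 'b::comm_monoid_add"
  by (simp add: sum_list_sum_nth atLeast0LessThan)

lemma sum_sum_list_swap: "(\<Sum>i\<in>S. \<Sum>x\<leftarrow>xs. f i x) = (\<Sum>x\<leftarrow>xs. \<Sum>i\<in>S. f i x)"
  for f :: "'a \<Rightarrow> 'b \<Rightarrow> 'c::comm_monoid_add"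
  by (induction xs) (auto simp: sum.distrib)

lemma sum_list_product: "(\<Sum>x\<leftarrow>List.product [0..<m] [0..<n]. f x) = (\<Sum>i<m. \<Sum>j<n. f (i, j))"
  for f :: "nat \<times> nat \<Rightarrow> 'a::comm_monoid_add"
proof -
  have "(\<Sum>x\<leftarrow>List.product xs ys. f x) = (\<Sum>i\<leftarrow>xs. \<Sum>j\<leftarrow>ys. f (i, j))" for xs ys
    by (induction xs) (auto simp: o_def)
  then show ?thesis
    by (simp add: interv_sum_list_conv_sum_set_nat atLeast0LessThan)
qed

lemma pair_index_less: "x * n + y < m * n" if "x < m" "y < n" for x y m n :: nat
proof -
  have "x * n + y < Suc x * n" using that by simp
  also have "\<dots> \<le> m * n" using that by (intro mult_right_mono) auto
  finally show ?thesis .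
qed

lemma div_mod_less:
  fixes p m n :: nat assumes "p < m * n" shows "p div n < m" "p mod n < n"
proof -
  have "0 < n" using assms by (cases n) auto
  then show "p mod n < n" by simp
  show "p div n < m" using assms by (rule less_mult_imp_div_less)
qed

text \<open>The composite index x * n + y is the one built into \<open>kron\<close>, so this is how
  sums over a tensor product basis are split.\<close>

lemma sum_pair_index:
  "(\<Sum>p<m * n. f (p div n) (p mod n)) = (\<Sum>x<m. \<Sum>y<n. f x y)" for m n :: nat
proof -
  have "(\<Sum>p<m * n. f (p div n) (p mod n)) = (\<Sum>(x, y)\<in>{..<m} \<times> {..<n}. f x y)"
  proof (rule sum.reindex_bij_witness[where i = "\<lambda>(x,y). x * n + y" and j = "\<lambda>p. (p div n, p mod n)"])
    fix p assume "p \<in> {..<m * n}"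
    then have "p < m * n" by simp
    from div_mod_less[OF this] show "(p div n, p mod n) \<in> {..<m} \<times> {..<n}" by simp
  next
    fix z assume "z \<in> {..<m} \<times> {..<n}"
    then obtain x y where z: "z = (x, y)" "x < m" "y < n" by auto
    from pair_index_less[OF z(2,3)] z(1) show "(case z of (x, y) \<Rightarrow> x * n + y) \<in> {..<m * n}" by simp
    from z show "((case z of (x, y) \<Rightarrow> x * n + y) div n, (case z of (x, y) \<Rightarrow> x * n + y) mod n) = z"
        by simp
  qed simp_all
  then show ?thesis by (simp add: sum.cartesian_product)
qed

lemma index_mult_mat_sum:
  assumes "i < dim_row A" "j < dim_col B" "dim_col A = n" "dim_row B = n"
  shows "(A * B) $$ (i, j) = (\<Sum>k<n. A $$ (i, k) * B $$ (k, j))"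
  using assms by (simp add: scalar_prod_def atLeast0LessThan)

section \<open>Adjoints and Kronecker products in coordinates\<close>

lemma adj_simps [simp]:
  "dim_row (adj A) = dim_col A" "dim_col (adj A) = dim_row A"
  "i < dim_col A \<Longrightarrow> j < dim_row A \<Longrightarrow> adj A $$ (i, j) = cnj (A $$ (j, i))"
  by (auto simp: adj_def)

lemma kron_simps [simp]:
  "dim_row (kron A B) = dim_row A * dim_row B" "dim_col (kron A B) = dim_col A * dim_col B"
  "i < dim_row A * dim_row B \<Longrightarrow> j < dim_col A * dim_col B \<Longrightarrow>
   kron A B $$ (i, j) = A $$ (i div dim_row B, j div dim_col B)
       * B $$ (i mod dim_row B, j mod dim_col B)"
  by (auto simp: kron_def)

lemma kron_carrier: 
  "A \<in> carrier_mat a b \<Longrightarrow> B \<in> carrier_mat c d \<Longrightarrow> kron A B \<in> carrier_mat (a * c) (b * d)"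
  by (rule carrier_matI) simp_all

lemma kron_mult:
  assumes "A \<in> carrier_mat a b" "B \<in> carrier_mat a' b'" "C \<in> carrier_mat b c" "D \<in> carrier_mat b' c'"
  shows "kron A B * kron C D = kron (A * C) (B * D)"
proof (rule eq_matI)
  fix i j assume "i < dim_row (kron (A * C) (B * D))" "j < dim_col (kron (A * C) (B * D))"
  then have ij: "i < a * a'" "j < c * c'" using assms by auto
  note l = div_mod_less[OF ij(1)] div_mod_less[OF ij(2)]
  have "(kron A B * kron C D) $$ (i, j) = (\<Sum>p<b * b'. kron A B $$ (i, p) * kron C D $$ (p, j))"
    using assms ij by (intro index_mult_mat_sum) auto
  also have "\<dots> = (\<Sum>p<b * b'. (A $$ (i div a', p div b') * B $$ (i mod a', p mod b')) *
      (C $$ (p div b', j div c') * D $$ (p mod b', j mod c')))"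
    using assms ij by (intro sum.cong) auto
  also have "\<dots> = (\<Sum>x<b. \<Sum>y<b'. (A $$ (i div a', x) * B $$ (i mod a', y)) *
      (C $$ (x, j div c') * D $$ (y, j mod c')))"
    by (rule sum_pair_index)
  also have "\<dots> = (\<Sum>x<b. A $$ (i div a', x) * C $$ (x, j div c')) * (\<Sum>y<b'. B $$ (i mod a', y)
      * D $$ (y, j mod c'))"
    by (simp add: sum_product mult_ac)
  also have "\<dots> = (A * C) $$ (i div a', j div c') * (B * D) $$ (i mod a', j mod c')"
    using assms l by (simp add: index_mult_mat_sum[where n = b] index_mult_mat_sum[where n
        = b'] del: index_mult_mat)
  also have "\<dots> = kron (A * C) (B * D) $$ (i, j)"
    using assms ij by auto
  finally show "(kron A B * kron C D) $$ (i, j) = kron (A * C) (B * D) $$ (i, j)" .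
qed (use assms in auto)

lemma sandwich_index:
  assumes "K \<in> carrier_mat n' n" "\<rho> \<in> carrier_mat n n" "i < n'" "j < n'"
  shows "(K * \<rho> * adj K) $$ (i, j) = (\<Sum>p<n. \<Sum>q<n. K $$ (i, p) * \<rho> $$ (p, q) * cnj (K $$ (j, q)))"
proof -
  have "(K * \<rho> * adj K) $$ (i, j) = (\<Sum>q<n. (K * \<rho>) $$ (i, q) * adj K $$ (q, j))"
    using assms by (intro index_mult_mat_sum) auto
  also have "\<dots> = (\<Sum>q<n. \<Sum>p<n. K $$ (i, p) * \<rho> $$ (p, q) * cnj (K $$ (j, q)))"
    using assms by (intro sum.cong) (auto simp: index_mult_mat_sum[where n
        = n] sum_distrib_right simp del: index_mult_mat)
  finally show ?thesis by (subst sum.swap)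
qed

section \<open>Kraus maps in coordinates\<close>

lemma msum_simps [simp]:
  "dim_row (msum n k f) = n" "dim_col (msum n k f) = n" "msum n k f \<in> carrier_mat n n"
  "i < n \<Longrightarrow> j < n \<Longrightarrow> msum n k f $$ (i, j) = (\<Sum>l<k. f l $$ (i, j))"
  by (auto simp: msum_def)

lemma kraus_apply_carrier [simp]: "kraus_apply n Ks \<rho> \<in> carrier_mat n n"
  by (simp add: kraus_apply_def)

lemma kraus_apply_index:
  assumes "set Ks \<subseteq> carrier_mat n' n" "\<rho> \<in> carrier_mat n n" "i < n'" "j < n'"
  shows "kraus_apply n' Ks \<rho> $$ (i, j) =
    (\<Sum>K\<leftarrow>Ks. \<Sum>p<n. \<Sum>q<n. K $$ (i, p) * \<rho> $$ (p, q) * cnj (K $$ (j, q)))"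
proof -
  have "kraus_apply n' Ks \<rho> $$ (i, j) = (\<Sum>K\<leftarrow>Ks. (K * \<rho> * adj K) $$ (i, j))"
    using assms(3,4) sum_lessThan_nth[of "\<lambda>K. (K * \<rho> * adj K) $$ (i, j)" Ks]
        by (simp add: kraus_apply_def)
  also have "\<dots> = (\<Sum>K\<leftarrow>Ks. \<Sum>p<n. \<Sum>q<n. K $$ (i, p) * \<rho> $$ (p, q) * cnj (K $$ (j, q)))"
    using assms by (intro arg_cong[where f = sum_list] map_cong refl sandwich_index) auto
  finally show ?thesis .
qed

lemma kraus_complete_iff:
  assumes "set Ks \<subseteq> carrier_mat n' n"
  shows "kraus_complete n Ks \<longleftrightarrow>
    (\<forall>i<n. \<forall>j<n. (\<Sum>K\<leftarrow>Ks. \<Sum>r<n'. cnj (K $$ (r, i)) * K $$ (r, j)) = (if i = j then 1 else 0))"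
proof -
  have "msum n (length Ks) (\<lambda>l. adj (Ks ! l) * Ks ! l) $$ (i, j) =
      (\<Sum>K\<leftarrow>Ks. \<Sum>r<n'. cnj (K $$ (r, i)) * K $$ (r, j))" if "i < n" "j < n" for i j
  proof -
    have "msum n (length Ks) (\<lambda>l. adj (Ks ! l) * Ks ! l) $$ (i, j) = (\<Sum>K\<leftarrow>Ks. (adj K * K) $$ (i, j))"
      using that sum_lessThan_nth[of "\<lambda>K. (adj K * K) $$ (i, j)" Ks] by simp
    also have "\<dots> = (\<Sum>K\<leftarrow>Ks. \<Sum>r<n'. cnj (K $$ (r, i)) * K $$ (r, j))"
    proof (intro arg_cong[where f = sum_list] map_cong refl)
      fix K assume "K \<in> set Ks"
      then have "K \<in> carrier_mat n' n" using assms by auto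
      then show "(adj K * K) $$ (i, j) = (\<Sum>r<n'. cnj (K $$ (r, i)) * K $$ (r, j))"
        using that by (subst index_mult_mat_sum[where n = n']) auto
    qed
    finally show ?thesis .
  qed
  note entry = this
  have "kraus_complete n Ks \<longleftrightarrow> (\<forall>i<n. \<forall>j<n.
      msum n (length Ks) (\<lambda>l. adj (Ks ! l) * Ks ! l) $$ (i, j) = (1\<^sub>m n :: complex mat) $$ (i, j))"
    unfolding kraus_complete_def mat_eq_iff msum_simps(1,2) index_one_mat(2,3) by simp
  also have "\<dots> \<longleftrightarrow> (\<forall>i<n. \<forall>j<n.
      (\<Sum>K\<leftarrow>Ks. \<Sum>r<n'. cnj (K $$ (r, i)) * K $$ (r, j)) = (if i = j then 1 else 0))"
    by (intro all_cong1 imp_cong refl) (simp only: entry index_one_mat)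
  finally show ?thesis .
qed

section \<open>The witness on product vectors\<close>

text \<open>An operator norm bound for the matrix with entries \<open>A k l\<close>. Index functions
  instead of matrices make a transpose, or the action on one tensor factor, a plain lambda
  term.\<close>

definition bounded_form :: "nat \<Rightarrow> real \<Rightarrow> (nat \<Rightarrow> nat \<Rightarrow> complex) \<Rightarrow> bool" where
  "bounded_form r s A \<longleftrightarrow> 0 \<le> s \<and>
     (\<forall>x. (\<Sum>k<r. (cmod (\<Sum>k'<r. A k k' * x k'))\<^sup>2) \<le> s\<^sup>2 * (\<Sum>k<r. (cmod (x k))\<^sup>2))"

text \<open>The trace of A \<otimes> B against the operator with entry \<open>f k k' l l'\<close> in
  row (k', l') and column (k, l); it is the ancilla part of \<open>obs_trace\<close>.\<close>

definition tensor_form ::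
    "nat \<Rightarrow> nat \<Rightarrow> (nat \<Rightarrow> nat \<Rightarrow> complex) \<Rightarrow> (nat \<Rightarrow> nat \<Rightarrow> complex) \<Rightarrow> (nat \<Rightarrow> nat \<Rightarrow> nat \<Rightarrow> nat \<Rightarrow> complex) \<Rightarrow>
        complex" where
  "tensor_form rA rB A B f = (\<Sum>k<rA. \<Sum>k'<rA. \<Sum>l<rB. \<Sum>l'<rB. A k k' * B l l' * f k k' l l')"

lemma tensor_form_add: "tensor_form rA rB A B (\<lambda>k k' l l'. f k k' l l' + g k k' l l')
    = tensor_form rA rB A B f + tensor_form rA rB A B g"
  by (simp add: tensor_form_def ring_distribs sum.distrib)

lemma tensor_form_diff: "tensor_form rA rB A B (\<lambda>k k' l l'. f k k' l l' - g k k' l l')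
    = tensor_form rA rB A B f - tensor_form rA rB A B g"
  by (simp add: tensor_form_def ring_distribs sum_subtractf)

lemma tensor_form_scale: "tensor_form rA rB A B (\<lambda>k k' l l'. c * f k k' l l') = c
    * tensor_form rA rB A B f"
  by (simp add: tensor_form_def sum_distrib_left mult_ac)

lemma tensor_form_sum: "tensor_form rA rB A B (\<lambda>k k' l l'. \<Sum>i\<in>I. f i k k' l l')
    = (\<Sum>i\<in>I. tensor_form rA rB A B (f i))"
proof (induction I rule: infinite_finite_induct)
  case (insert i I)
  then show ?case by (simp add: tensor_form_add)
qed (simp_all add: tensor_form_def)

text \<open>The trace pairing is invariant under transposing the second factor on both sides. This
  is how the partial transpose of the witness is absorbed by the observable.\<close>

lemma tensor_form_transpose:
  "tensor_form rA rB A (\<lambda>l l'. B l' l) f = tensor_form rA rB A B (\<lambda>k k' l l'. f k k' l' l)"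
  unfolding tensor_form_def by (intro sum.cong refl sum.swap)

lemma norm_sum_mult_square_le:
  "(cmod (\<Sum>i\<in>I. f i * g i))\<^sup>2 \<le> (\<Sum>i\<in>I. (cmod (f i))\<^sup>2) * (\<Sum>i\<in>I. (cmod (g i))\<^sup>2)"
proof -
  have "cmod (\<Sum>i\<in>I. f i * g i) \<le> (\<Sum>i\<in>I. cmod (f i) * cmod (g i))"
    by (rule order_trans[OF norm_sum]) (simp add: norm_mult)
  also have "\<dots> \<le> L2_set (\<lambda>i. cmod (f i)) I * L2_set (\<lambda>i. cmod (g i)) I"
    using L2_set_mult_ineq[of "\<lambda>i. cmod (f i)" "\<lambda>i. cmod (g i)" I] by simp
  finally have "(cmod (\<Sum>i\<in>I. f i * g i))\<^sup>2 \<le> (L2_set (\<lambda>i. cmod (f i)) I * L2_set (\<lambda>i. cmod (g i)) I)\<^sup>2"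
    by (rule power_mono) simp
  then show ?thesis by (simp add: L2_set_def power_mult_distrib sum_nonneg)
qed

text \<open>With z the conjugate of the transposed matrix applied to x, the number \<open>N\<close>
  = |z|^2 is also the bilinear pairing of x with A z. Cauchy-Schwarz gives N^2 \<le> X s^2 N, and
  one factor N cancels.\<close>

lemma bounded_form_transpose:
  assumes "bounded_form r s A"
  shows "bounded_form r s (\<lambda>k l. A l k)"
  unfolding bounded_form_def
proof (intro conjI allI)
  show "0 \<le> s" using assms by (simp add: bounded_form_def)
  fix x :: "nat \<Rightarrow> complex"
  define z where "z k = cnj (\<Sum>k'<r. A k' k * x k')" for k
  define N X where "N = (\<Sum>k<r. (cmod (z k))\<^sup>2)" and "X = (\<Sum>k<r. (cmod (x k))\<^sup>2)"
  have N0: "0 \<le> N" and X0: "0 \<le> X" by (simp_all add: N_def X_def sum_nonneg)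
  have "complex_of_real N = (\<Sum>k<r. z k * cnj (z k))"
    unfolding N_def of_real_sum by (intro sum.cong refl) (metis complex_norm_square of_real_power)
  also have "\<dots> = (\<Sum>k<r. \<Sum>k'<r. z k * (A k' k * x k'))"
    by (simp add: z_def sum_distrib_left)
  also have "\<dots> = (\<Sum>k'<r. x k' * (\<Sum>k<r. A k' k * z k))"
    by (subst sum.swap) (simp add: sum_distrib_left mult_ac)
  finally have "N\<^sup>2 = (cmod (\<Sum>k'<r. x k' * (\<Sum>k<r. A k' k * z k)))\<^sup>2"
    by (metis norm_of_real power2_abs)
  also have "\<dots> \<le> X * (\<Sum>k'<r. (cmod (\<Sum>k<r. A k' k * z k))\<^sup>2)"
    unfolding X_def by (rule norm_sum_mult_square_le)
  also have "\<dots> \<le> X * (s\<^sup>2 * N)"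
    using assms X0 by (intro mult_left_mono) (auto simp: bounded_form_def N_def)
  finally have "N * N \<le> (s\<^sup>2 * X) * N" by (simp add: power2_eq_square mult_ac)
  then have "N \<le> s\<^sup>2 * X"
    using N0 X0 by (cases "N = 0") auto
  then show "(\<Sum>k<r. (cmod (\<Sum>k'<r. A k' k * x k'))\<^sup>2) \<le> s\<^sup>2 * (\<Sum>k<r. (cmod (x k))\<^sup>2)"
    by (simp only: N_def X_def z_def complex_mod_cnj)
qed

text \<open>This is the expectation value of A \<otimes> B in the vector Y. \<open>Z\<close> applies
  B to the second index and \<open>T\<close> then applies A to the first, so together they scale
  norms by at most s * t. Only this product is controlled, because a cut bounds the norm of the
  tensor product of its observables. The pairing of Y with \<open>T\<close> is estimated by 2xy
  \<le> x^2 + y^2.\<close>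

lemma tensor_form_bound:
  assumes A: "bounded_form rA s A" and B: "bounded_form rB t B" and st: "s * t \<le> 1"
  shows "cmod (tensor_form rA rB A B (\<lambda>k k' l l'. cnj (Y k l) * Y k' l'))
      \<le> (\<Sum>k<rA. \<Sum>l<rB. (cmod (Y k l))\<^sup>2)"
proof -
  define Z where "Z k l = (\<Sum>l'<rB. B l l' * Y k l')" for k l
  define T where "T k l = (\<Sum>k'<rA. A k k' * Z k' l)" for k l
  define N where "N = (\<Sum>k<rA. \<Sum>l<rB. (cmod (Y k l))\<^sup>2)"
  have N0: "0 \<le> N" by (simp add: N_def sum_nonneg)
  have s0: "0 \<le> s" "0 \<le> t" using A B by (auto simp: bounded_form_def)
  have "(\<Sum>k<rA. \<Sum>l<rB. (cmod (T k l))\<^sup>2) = (\<Sum>l<rB. \<Sum>k<rA. (cmod (T k l))\<^sup>2)"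
    by (rule sum.swap)
  also have "\<dots> \<le> (\<Sum>l<rB. s\<^sup>2 * (\<Sum>k<rA. (cmod (Z k l))\<^sup>2))"
    unfolding T_def using A by (intro sum_mono) (auto simp: bounded_form_def)
  also have "\<dots> = s\<^sup>2 * (\<Sum>k<rA. \<Sum>l<rB. (cmod (Z k l))\<^sup>2)"
    unfolding sum_distrib_left[symmetric] by (subst sum.swap) (rule refl)
  also have "\<dots> \<le> s\<^sup>2 * (\<Sum>k<rA. t\<^sup>2 * (\<Sum>l<rB. (cmod (Y k l))\<^sup>2))"
    unfolding Z_def using B by (intro mult_left_mono sum_mono) (auto simp: bounded_form_def)
  also have "\<dots> = (s * t)\<^sup>2 * N"
    by (simp add: N_def sum_distrib_left power_mult_distrib mult_ac)
  also have "\<dots> \<le> 1 * N"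
    using st s0 N0 by (intro mult_right_mono power_le_one) auto
  finally have TN: "(\<Sum>k<rA. \<Sum>l<rB. (cmod (T k l))\<^sup>2) \<le> N" by simp
  have "tensor_form rA rB A B (\<lambda>k k' l l'. cnj (Y k l) * Y k' l') =
      (\<Sum>k<rA. \<Sum>k'<rA. \<Sum>l<rB. cnj (Y k l) * (A k k' * Z k' l))"
    by (simp add: tensor_form_def Z_def sum_distrib_left mult_ac)
  also have "\<dots> = (\<Sum>k<rA. \<Sum>l<rB. cnj (Y k l) * T k l)"
    by (rule sum.cong[OF refl], subst sum.swap) (simp add: T_def sum_distrib_left)
  also have "cmod \<dots> \<le> (\<Sum>k<rA. \<Sum>l<rB. cmod (cnj (Y k l) * T k l))"
    by (rule order_trans[OF norm_sum sum_mono[OF norm_sum]])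
  also have "\<dots> \<le> (\<Sum>k<rA. \<Sum>l<rB. ((cmod (Y k l))\<^sup>2 + (cmod (T k l))\<^sup>2) / 2)"
  proof (intro sum_mono)
    fix k l
    show "cmod (cnj (Y k l) * T k l) \<le> ((cmod (Y k l))\<^sup>2 + (cmod (T k l))\<^sup>2) / 2"
      using sum_squares_bound[of "cmod (Y k l)" "cmod (T k l)"] by (simp add: norm_mult)
  qed
  also have "\<dots> = (N + (\<Sum>k<rA. \<Sum>l<rB. (cmod (T k l))\<^sup>2)) / 2"
    by (simp add: N_def sum.distrib sum_divide_distrib[symmetric])
  also have "\<dots> \<le> N" using TN by simp
  finally show ?thesis by (simp add: N_def)
qed

text \<open>The Binet-Cauchy identity for the 2 by 2 minors of (p, cnj v) and (q, cnj u).
  \<open>G\<close> collects the straight products and \<open>W\<close> the crossed ones; exchanging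
  j and j' produces the factor 2. The conjugates on u and v make the crossed sums bilinear, as
  required for overlaps with a maximally entangled vector.\<close>

lemma antisym_gram:
  fixes p q u v :: "'j \<Rightarrow> complex"
  shows "(\<Sum>j\<in>J. \<Sum>j'\<in>J. cnj (p j * cnj (v j') - p j' * cnj (v j)) * (q j * cnj (u j') - q j'
      * cnj (u j))) =
    2 * ((\<Sum>j\<in>J. cnj (p j) * q j) * (\<Sum>j\<in>J. cnj (u j) * v j) - cnj (\<Sum>j\<in>J. p j * u j) * (\<Sum>j\<in>J. q j * v j))"
proof -
  define G where "G j j' = cnj (p j) * q j * (cnj (u j') * v j')" for j j'
  define W where "W j j' = cnj (p j * u j) * (q j' * v j')" for j j'
  have "(\<Sum>j\<in>J. \<Sum>j'\<in>J. cnj (p j * cnj (v j') - p j' * cnj (v j)) * (q j * cnj (u j') - q j'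
      * cnj (u j))) =
      (\<Sum>j\<in>J. \<Sum>j'\<in>J. G j j' + G j' j - W j j' - W j' j)"
    by (intro sum.cong refl) (simp add: G_def W_def algebra_simps)
  also have "\<dots> = (\<Sum>j\<in>J. \<Sum>j'\<in>J. G j j') + (\<Sum>j\<in>J. \<Sum>j'\<in>J. G j' j) - (\<Sum>j\<in>J. \<Sum>j'\<in>J. W j j')
      - (\<Sum>j\<in>J. \<Sum>j'\<in>J. W j' j)"
    by (simp add: sum.distrib sum_subtractf)
  also have "\<dots> = 2 * ((\<Sum>j\<in>J. \<Sum>j'\<in>J. G j j') - (\<Sum>j\<in>J. \<Sum>j'\<in>J. W j j'))"
    using sum.swap[of "\<lambda>j j'. G j' j" J J] sum.swap[of "\<lambda>j j'. W j' j" J J] by simp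
  also have "(\<Sum>j\<in>J. \<Sum>j'\<in>J. G j j') = (\<Sum>j\<in>J. cnj (p j) * q j) * (\<Sum>j\<in>J. cnj (u j) * v j)"
    by (simp add: G_def sum_product)
  also have "(\<Sum>j\<in>J. \<Sum>j'\<in>J. W j j') = cnj (\<Sum>j\<in>J. p j * u j) * (\<Sum>j\<in>J. q j * v j)"
    by (simp only: W_def sum_product cnj_sum)
  finally show ?thesis .
qed

text \<open>In these coordinates \<Psi> is the sum of e_j \<otimes> e_j, so \<open>w k l\<close> is
  its overlap with the product vector labelled (k, l). The first half of the split is an expectation
  value in \<open>w\<close>. The second is half a sum of expectation values in the
  \<open>y j j'\<close> for the observable with transposed second factor, the half compensating for
  ordered pairs.\<close>

lemma witness_product_bound:
  fixes \<alpha> \<beta> :: "'j \<Rightarrow> nat \<Rightarrow> complex" and J :: "'j set"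
  assumes A: "bounded_form rA s A" and B: "bounded_form rB t B" and st: "s * t \<le> 1"
  defines "w \<equiv> \<lambda>k l. \<Sum>j\<in>J. \<alpha> j k * \<beta> j l"
  shows "cmod (tensor_form rA rB A B (\<lambda>k k' l l'. 2 * (cnj (w k l) * w k' l') -
      (\<Sum>j\<in>J. cnj (\<alpha> j k) * \<alpha> j k') * (\<Sum>j\<in>J. cnj (\<beta> j l) * \<beta> j l')))
    \<le> (\<Sum>k<rA. \<Sum>j\<in>J. (cmod (\<alpha> j k))\<^sup>2) * (\<Sum>l<rB. \<Sum>j\<in>J. (cmod (\<beta> j l))\<^sup>2)"
proof -
  \<comment> \<open>Antisymmetrisation of \<alpha> with the conjugate of \<beta>; the conjugation is
    the effect of the partial transpose on the second party.\<close>
  define y where "y j j' k l = \<alpha> j k * cnj (\<beta> j' l) - \<alpha> j' k * cnj (\<beta> j l)" for j j' k l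
  define P where "P k k' = (\<Sum>j\<in>J. cnj (\<alpha> j k) * \<alpha> j k')" for k k'
  define Q where "Q l l' = (\<Sum>j\<in>J. cnj (\<beta> j l) * \<beta> j l')" for l l'
  let ?T = "tensor_form rA rB A B" and ?T' = "tensor_form rA rB A (\<lambda>l l'. B l' l)"
  have gram: "(\<Sum>j\<in>J. \<Sum>j'\<in>J. cnj (y j j' k l') * y j j' k' l) = 2 * (P k k' * Q l l' - cnj (w k l)
      * w k' l')" for k k' l l'
    unfolding y_def P_def Q_def w_def by (rule antisym_gram)
  have "(\<Sum>j\<in>J. \<Sum>j'\<in>J. ?T' (\<lambda>k k' l l'. cnj (y j j' k l) * y j j' k' l')) =
      ?T (\<lambda>k k' l l'. \<Sum>j\<in>J. \<Sum>j'\<in>J. cnj (y j j' k l') * y j j' k' l)"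
    by (simp only: tensor_form_transpose[of rA rB A B] tensor_form_sum)
  also have "\<dots> = 2 * (?T (\<lambda>k k' l l'. P k k' * Q l l') - ?T (\<lambda>k k' l l'. cnj (w k l) * w k' l'))"
    by (simp only: gram tensor_form_scale tensor_form_diff)
  finally have split: "?T (\<lambda>k k' l l'. 2 * (cnj (w k l) * w k' l') - P k k' * Q l l') =
      ?T (\<lambda>k k' l l'. cnj (w k l) * w k' l') - (\<Sum>j\<in>J. \<Sum>j'\<in>J. ?T' (\<lambda>k k' l l'. cnj (y j j' k l)
          * y j j' k' l')) / 2"
    by (simp add: tensor_form_scale tensor_form_diff field_simps)
  \<comment> \<open>The diagonal case is Lagrange's identity: the antisymmetrised vectors carry
    exactly twice the defect in the Cauchy-Schwarz inequality for \<open>w k l\<close>.\<close>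
  have norms: "(\<Sum>j\<in>J. \<Sum>j'\<in>J. (cmod (y j j' k l))\<^sup>2) =
      2 * ((\<Sum>j\<in>J. (cmod (\<alpha> j k))\<^sup>2) * (\<Sum>j\<in>J. (cmod (\<beta> j l))\<^sup>2) - (cmod (w k l))\<^sup>2)" for k l
  proof -
    have "complex_of_real (\<Sum>j\<in>J. \<Sum>j'\<in>J. (cmod (y j j' k l))\<^sup>2) =
      complex_of_real (2 * ((\<Sum>j\<in>J. (cmod (\<alpha> j k))\<^sup>2) * (\<Sum>j\<in>J. (cmod (\<beta> j l))\<^sup>2) - (cmod (w k l))\<^sup>2))"
      using gram[of k l k l] by (simp add: complex_norm_square P_def Q_def mult.commute del:
          of_real_power)
    then show ?thesis by (simp only: of_real_eq_iff)
  qed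
  have "cmod (?T (\<lambda>k k' l l'. 2 * (cnj (w k l) * w k' l') - P k k' * Q l l')) \<le>
      cmod (?T (\<lambda>k k' l l'. cnj (w k l) * w k' l')) +
      (\<Sum>j\<in>J. \<Sum>j'\<in>J. cmod (?T' (\<lambda>k k' l l'. cnj (y j j' k l) * y j j' k' l'))) / 2"
    unfolding split
    by (rule order_trans[OF norm_triangle_ineq4])
       (auto simp: norm_divide intro!: order_trans[OF norm_sum sum_mono[OF norm_sum]])
  also have "\<dots> \<le> (\<Sum>k<rA. \<Sum>l<rB. (cmod (w k l))\<^sup>2) + (\<Sum>j\<in>J. \<Sum>j'\<in>J. \<Sum>k<rA. \<Sum>l<rB. (cmod (y j j' k
      l))\<^sup>2) / 2"
    by (intro add_mono divide_right_mono sum_mono tensor_form_bound[OF A B st]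
        tensor_form_bound[OF A bounded_form_transpose[OF B] st]) simp
  also have "(\<Sum>j\<in>J. \<Sum>j'\<in>J. \<Sum>k<rA. \<Sum>l<rB. (cmod (y j j' k l))\<^sup>2)
      = (\<Sum>k<rA. \<Sum>l<rB. \<Sum>j\<in>J. \<Sum>j'\<in>J. (cmod (y j j' k l))\<^sup>2)"
    unfolding sum.cartesian_product
    by (rule sum.reindex_bij_witness[where i = "\<lambda>(k, l, j, j'). (j, j', k, l)" and j
        = "\<lambda>(j, j', k, l). (k, l, j, j')"]) auto
  also have "\<dots> = (\<Sum>k<rA. \<Sum>l<rB. 2 * ((\<Sum>j\<in>J. (cmod (\<alpha> j k))\<^sup>2) * (\<Sum>j\<in>J. (cmod (\<beta> j l))\<^sup>2)
      - (cmod (w k l))\<^sup>2))"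
    by (simp only: norms)
  also have "\<dots> = 2 * ((\<Sum>k<rA. \<Sum>j\<in>J. (cmod (\<alpha> j k))\<^sup>2) * (\<Sum>l<rB. \<Sum>j\<in>J. (cmod (\<beta> j l))\<^sup>2)
      - (\<Sum>k<rA. \<Sum>l<rB. (cmod (w k l))\<^sup>2))"
    unfolding sum_product by (simp only: sum_distrib_left[symmetric] sum_subtractf)
  finally show ?thesis by (simp add: P_def Q_def diff_divide_distrib)
qed

text \<open>Pythagoras for the projection onto the span of \<open>v\<close>, polarised. The residual
  of g is orthogonal to every \<open>v j\<close>, so pairing it with f or with the residual of f
  gives the same value.\<close>

lemma gram_orthonormal_split:
  fixes v :: "nat \<Rightarrow> 'i \<Rightarrow> complex" and I :: "'i set" and m :: nat
  assumes I: "finite I"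
    and on: "\<And>j k. j < m \<Longrightarrow> k < m \<Longrightarrow> (\<Sum>i\<in>I. cnj (v j i) * v k i) = (if j = k then 1 else 0)"
  defines "c \<equiv> \<lambda>j f. \<Sum>i\<in>I. cnj (v j i) * f i"
  defines "R \<equiv> \<lambda>f i. f i - (\<Sum>j<m. c j f * v j i)"
  shows "(\<Sum>i\<in>I. cnj (f i) * g i) = (\<Sum>j<m. cnj (c j f) * c j g) + (\<Sum>i\<in>I. cnj (R f i) * R g i)"
proof -
  have c: "c j h = (\<Sum>i\<in>I. cnj (v j i) * h i)" and R: "R h i = h i - (\<Sum>j<m. c j h * v j i)" for j h i
    by (simp_all add: c_def R_def)
  define S where "S = (\<Sum>j<m. cnj (c j f) * c j g)"
  have fP: "(\<Sum>i\<in>I. cnj (f i) * (\<Sum>j<m. c j g * v j i)) = S"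
  proof -
    have "(\<Sum>i\<in>I. cnj (f i) * (\<Sum>j<m. c j g * v j i)) = (\<Sum>j<m. \<Sum>i\<in>I. c j g * cnj (cnj (v j i) * f i))"
      by (subst sum.swap) (simp add: sum_distrib_left mult_ac)
    also have "\<dots> = S" by (simp add: S_def c[of _ f] sum_distrib_left mult_ac)
    finally show ?thesis .
  qed
  have vP: "(\<Sum>i\<in>I. cnj (v j i) * (\<Sum>k<m. c k g * v k i)) = c j g" if "j < m" for j
  proof -
    have "(\<Sum>i\<in>I. cnj (v j i) * (\<Sum>k<m. c k g * v k i)) = (\<Sum>k<m. c k g * (\<Sum>i\<in>I. cnj (v j i) * v k i))"
      unfolding sum_distrib_left by (subst sum.swap) (simp add: mult_ac)
    also have "\<dots> = (\<Sum>k<m. if j = k then c k g else 0)"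
      using on that by (intro sum.cong refl) auto
    also have "\<dots> = c j g" using that by simp
    finally show ?thesis .
  qed
  have vR: "(\<Sum>i\<in>I. cnj (v j i) * R g i) = 0" if "j < m" for j
    using vP[OF that] by (simp add: R right_diff_distrib sum_subtractf c)
  have "(\<Sum>i\<in>I. cnj (R f i) * R g i) = (\<Sum>i\<in>I. cnj (f i) * R g i) - (\<Sum>i\<in>I. \<Sum>j<m. cnj (c j f)
      * (cnj (v j i) * R g i))"
    by (simp add: R[of f] left_diff_distrib right_diff_distrib sum_subtractf sum_distrib_left
        sum_distrib_right mult_ac)
  also have "(\<Sum>i\<in>I. \<Sum>j<m. cnj (c j f) * (cnj (v j i) * R g i)) = (\<Sum>j<m. cnj (c j f)
      * (\<Sum>i\<in>I. cnj (v j i) * R g i))"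
    unfolding sum_distrib_left by (rule sum.swap)
  also have "\<dots> = 0" using vR by simp
  also have "(\<Sum>i\<in>I. cnj (f i) * R g i) = (\<Sum>i\<in>I. cnj (f i) * g i) - S"
    using fP by (simp add: R right_diff_distrib sum_subtractf)
  finally show ?thesis by (simp add: S_def)
qed

section \<open>Operator norms\<close>

lemma vnorm_nonneg [simp]: "0 \<le> vnorm v"
  by (simp add: vnorm_def sum_nonneg)

lemma vnorm_square: "(vnorm v)\<^sup>2 = (\<Sum>i<dim_vec v. (cmod (v $ i))\<^sup>2)"
  by (simp add: vnorm_def sum_nonneg)

lemma vnorm_smult: "vnorm (c \<cdot>\<^sub>v v) = cmod c * vnorm v"
  by (simp add: vnorm_def norm_mult power_mult_distrib sum_distrib_left[symmetric] real_sqrt_mult)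

lemma vnorm_zero [simp]: "vnorm (0\<^sub>v n) = 0"
  by (simp add: vnorm_def)

lemma mult_mat_vec_index:
  assumes "i < dim_row M" "dim_vec v = dim_col M"
  shows "(M *\<^sub>v v) $ i = (\<Sum>j<dim_col M. M $$ (i, j) * v $ j)"
  using assms by (auto simp: scalar_prod_def atLeast0LessThan intro!: sum.cong)

text \<open>The Frobenius norm serves as the constant. Its size is irrelevant: it bounds the set
  under the supremum in \<open>op_norm\<close>, and it settles the case of a vector of norm
  zero.\<close>

lemma vnorm_mult_mat_vec_bounded:
  "\<exists>C\<ge>0. \<forall>v\<in>carrier_vec (dim_col M). vnorm (M *\<^sub>v v) \<le> C * vnorm v"
proof (intro exI conjI ballI)
  let ?S = "\<Sum>i<dim_row M. \<Sum>j<dim_col M. (cmod (M $$ (i, j)))\<^sup>2"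
  show "0 \<le> sqrt ?S" by (simp add: sum_nonneg)
  fix v :: "complex vec" assume v: "v \<in> carrier_vec (dim_col M)"
  have "(vnorm (M *\<^sub>v v))\<^sup>2 = (\<Sum>i<dim_row M. (cmod (\<Sum>j<dim_col M. M $$ (i, j) * v $ j))\<^sup>2)"
    using v by (simp add: vnorm_square mult_mat_vec_index del: index_mult_mat_vec)
  also have "\<dots> \<le> (\<Sum>i<dim_row M. (\<Sum>j<dim_col M. (cmod (M $$ (i, j)))\<^sup>2) * (vnorm v)\<^sup>2)"
    using v unfolding vnorm_square by (auto intro!: sum_mono norm_sum_mult_square_le)
  also have "\<dots> = (sqrt ?S * vnorm v)\<^sup>2"
    by (simp add: power_mult_distrib sum_nonneg sum_distrib_right)
  finally show "vnorm (M *\<^sub>v v) \<le> sqrt ?S * vnorm v"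
    by (rule power2_le_imp_le) (simp add: sum_nonneg)
qed

lemma op_norm_least:
  assumes "\<And>v. v \<in> carrier_vec (dim_col M) \<Longrightarrow> vnorm v \<le> 1 \<Longrightarrow> vnorm (M *\<^sub>v v) \<le> C"
  shows "op_norm M \<le> C"
  unfolding op_norm_def
proof (rule cSup_least)
  show "{vnorm (M *\<^sub>v v) |v. v \<in> carrier_vec (dim_col M) \<and> vnorm v \<le> 1} \<noteq> {}"
    using zero_carrier_vec[of "dim_col M"] vnorm_zero[of "dim_col M"] by fastforce
qed (use assms in auto)

lemma vnorm_le_op_norm_unit:
  assumes "v \<in> carrier_vec (dim_col M)" "vnorm v \<le> 1"
  shows "vnorm (M *\<^sub>v v) \<le> op_norm M"
proof -
  obtain C where C: "0 \<le> C" "\<And>v. v \<in> carrier_vec (dim_col M) \<Longrightarrow> vnorm (M *\<^sub>v v) \<le> C * vnorm v"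
    using vnorm_mult_mat_vec_bounded by blast
  show ?thesis
    unfolding op_norm_def
  proof (rule cSup_upper)
    show "bdd_above {vnorm (M *\<^sub>v v) |v. v \<in> carrier_vec (dim_col M) \<and> vnorm v \<le> 1}"
    proof (rule bdd_aboveI)
      fix x assume "x \<in> {vnorm (M *\<^sub>v v) |v. v \<in> carrier_vec (dim_col M) \<and> vnorm v \<le> 1}"
      then obtain v where v: "x = vnorm (M *\<^sub>v v)" "v \<in> carrier_vec (dim_col M)" "vnorm v \<le> 1" by auto
      show "x \<le> C" using C(2)[OF v(2)] mult_left_mono[OF v(3) C(1)] v(1) by simp
    qed
  qed (use assms in auto)
qed

lemma op_norm_nonneg: "0 \<le> op_norm M"
  using vnorm_le_op_norm_unit[of "0\<^sub>v (dim_col M)" M] order_trans[OF vnorm_nonneg] by auto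

lemma vnorm_le_op_norm:
  assumes v: "v \<in> carrier_vec (dim_col M)"
  shows "vnorm (M *\<^sub>v v) \<le> op_norm M * vnorm v"
proof (cases "vnorm v = 0")
  case True
  obtain C where "vnorm (M *\<^sub>v v) \<le> C * vnorm v"
    using vnorm_mult_mat_vec_bounded v by blast
  then show ?thesis using True by simp
next
  case False
  then have pos: "0 < vnorm v" using vnorm_nonneg[of v] by linarith
  define u where "u = complex_of_real (1 / vnorm v) \<cdot>\<^sub>v v"
  have u: "u \<in> carrier_vec (dim_col M)" "vnorm u = 1" and "M *\<^sub>v u
      = complex_of_real (1 / vnorm v) \<cdot>\<^sub>v (M *\<^sub>v v)"
    using v pos by (auto simp: u_def vnorm_smult norm_divide intro!: mult_mat_vec)
  then have "vnorm (M *\<^sub>v u) = vnorm (M *\<^sub>v v) / vnorm v"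
    using pos by (simp add: vnorm_smult norm_divide)
  with vnorm_le_op_norm_unit[OF u(1)] u(2) pos show ?thesis by (simp add: divide_le_eq)
qed

lemma bounded_form_op_norm:
  assumes M: "M \<in> carrier_mat r r"
  shows "bounded_form r (op_norm M) (\<lambda>k l. M $$ (k, l))"
  unfolding bounded_form_def
proof (intro conjI allI)
  show "0 \<le> op_norm M" by (rule op_norm_nonneg)
  fix x :: "nat \<Rightarrow> complex"
  have v: "vec r x \<in> carrier_vec (dim_col M)" using M by auto
  have "(\<Sum>k<r. (cmod (\<Sum>k'<r. M $$ (k, k') * x k'))\<^sup>2) = (vnorm (M *\<^sub>v vec r x))\<^sup>2"
    using M by (simp add: vnorm_square mult_mat_vec_index del: index_mult_mat_vec)
  also have "\<dots> \<le> (op_norm M * vnorm (vec r x))\<^sup>2"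
    using vnorm_le_op_norm[OF v] by (rule power_mono) simp
  finally show "(\<Sum>k<r. (cmod (\<Sum>k'<r. M $$ (k, k') * x k'))\<^sup>2) \<le> (op_norm M)\<^sup>2 * (\<Sum>k<r. (cmod (x k))\<^sup>2)"
    by (simp add: power_mult_distrib vnorm_square)
qed

text \<open>A cut bounds the norm of the tensor product of its observables, whereas the witness
  estimate acts with each factor separately. Testing on product vectors converts one bound into the
  other.\<close>

lemma op_norm_kron_ge:
  "op_norm A * op_norm B \<le> op_norm (kron A B)"
proof -
  have prod: "vnorm (A *\<^sub>v x) * vnorm (B *\<^sub>v y) \<le> op_norm (kron A B)"
    if x: "x \<in> carrier_vec (dim_col A)" "vnorm x \<le> 1" and y: "y \<in> carrier_vec (dim_col B)" "vnorm y
        \<le> 1" for x y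
  proof -
    \<comment> \<open>The tensor product of two vectors in the index order of
      \<open>kron\<close>.\<close>
    define t where "t n u v = vec (n * dim_vec v) (\<lambda>i. u $ (i div dim_vec v) * v $ (i mod dim_vec v))"
      for n :: nat and u v :: "complex vec"
    have t_norm: "vnorm (t n u v) = vnorm u * vnorm v" if "dim_vec u = n" for n u v
    proof -
      have "(\<Sum>i<n * dim_vec v. (cmod (u $ (i div dim_vec v)))\<^sup>2 * (cmod (v $ (i mod dim_vec v)))\<^sup>2) =
          (\<Sum>i<n. \<Sum>j<dim_vec v. (cmod (u $ i))\<^sup>2 * (cmod (v $ j))\<^sup>2)"
        by (rule sum_pair_index)
      then show ?thesis using that
        by (simp add: vnorm_def t_def norm_mult power_mult_distrib sum_product[symmetric]
            real_sqrt_mult)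
    qed
    have "kron A B *\<^sub>v t (dim_col A) x y = t (dim_row A) (A *\<^sub>v x) (B *\<^sub>v y)"
    proof (rule eq_vecI)
      fix i assume "i < dim_vec (t (dim_row A) (A *\<^sub>v x) (B *\<^sub>v y))"
      then have i: "i < dim_row A * dim_row B" by (simp add: t_def)
      have dy: "dim_vec y = dim_col B" and dx: "dim_vec x = dim_col A" using x y by auto
      have "(kron A B *\<^sub>v t (dim_col A) x y) $ i = (\<Sum>j<dim_col A * dim_col B. kron A B $$ (i, j)
          * t (dim_col A) x y $ j)"
        using i by (subst mult_mat_vec_index) (auto simp: t_def dy)
      also have "\<dots> = (\<Sum>j<dim_col A * dim_col B.
          (A $$ (i div dim_row B, j div dim_col B) * B $$ (i mod dim_row B, j mod dim_col B))
              * (x $ (j div dim_col B) * y $ (j mod dim_col B)))"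
        using i by (intro sum.cong) (auto simp: t_def dy)
      also have "\<dots> = (\<Sum>j<dim_col A. \<Sum>k<dim_col B. (A $$ (i div dim_row B, j)
          * B $$ (i mod dim_row B, k)) * (x $ j * y $ k))"
        by (rule sum_pair_index)
      also have "\<dots> = (A *\<^sub>v x) $ (i div dim_row B) * (B *\<^sub>v y) $ (i mod dim_row B)"
        using div_mod_less[OF i] dx dy by (simp add: mult_mat_vec_index sum_product mult_ac del:
            index_mult_mat_vec)
      also have "\<dots> = t (dim_row A) (A *\<^sub>v x) (B *\<^sub>v y) $ i"
        using i by (simp add: t_def del: index_mult_mat_vec)
      finally show "(kron A B *\<^sub>v t (dim_col A) x y) $ i = t (dim_row A) (A *\<^sub>v x) (B *\<^sub>v y) $ i" .
    qed (simp add: t_def)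
    then have "vnorm (A *\<^sub>v x) * vnorm (B *\<^sub>v y) = vnorm (kron A B *\<^sub>v t (dim_col A) x y)"
      by (simp add: t_norm)
    also have "\<dots> \<le> op_norm (kron A B)"
    proof (rule vnorm_le_op_norm_unit)
      show "t (dim_col A) x y \<in> carrier_vec (dim_col (kron A B))" using y by (auto simp: t_def)
      show "vnorm (t (dim_col A) x y) \<le> 1"
        using x y by (simp add: t_norm mult_le_one)
    qed
    finally show ?thesis .
  qed
  \<comment> \<open>The supremum over the second vector is taken with the first fixed; the supremum
    over the first follows below. Each needs a division, hence the separate treatment of norm
    zero.\<close>
  have half: "vnorm (A *\<^sub>v x) * op_norm B \<le> op_norm (kron A B)"
    if x: "x \<in> carrier_vec (dim_col A)" "vnorm x \<le> 1" for x
  proof (cases "vnorm (A *\<^sub>v x) = 0")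
    case False
    then have pos: "0 < vnorm (A *\<^sub>v x)" using vnorm_nonneg[of "A *\<^sub>v x"] by linarith
    have "op_norm B \<le> op_norm (kron A B) / vnorm (A *\<^sub>v x)"
      using prod[OF x] pos by (intro op_norm_least) (simp add: le_divide_eq mult.commute)
    then show ?thesis using pos by (simp add: le_divide_eq mult.commute)
  qed (simp add: op_norm_nonneg)
  show ?thesis
  proof (cases "op_norm B = 0")
    case False
    then have pos: "0 < op_norm B" using op_norm_nonneg[of B] by linarith
    have "op_norm A \<le> op_norm (kron A B) / op_norm B"
      using half pos by (intro op_norm_least) (simp add: le_divide_eq)
    then show ?thesis using pos by (simp add: le_divide_eq)
  qed (simp add: op_norm_nonneg)
qed

section \<open>LOCC channels are separable\<close>

lemma sandwich_comp:
  assumes "K \<in> carrier_mat n' n" "L \<in> carrier_mat n'' n'" "\<rho> \<in> carrier_mat n n" "i < n''" "j < n''"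
  shows "(\<Sum>r<n'. \<Sum>s<n'. L $$ (i, r) * (\<Sum>p<n. \<Sum>q<n. K $$ (r, p) * \<rho> $$ (p, q) * cnj (K $$ (s, q)))
      * cnj (L $$ (j, s)))
    = (\<Sum>p<n. \<Sum>q<n. (L * K) $$ (i, p) * \<rho> $$ (p, q) * cnj ((L * K) $$ (j, q)))"
proof -
  have "(\<Sum>r<n'. \<Sum>s<n'. L $$ (i, r) * (\<Sum>p<n. \<Sum>q<n. K $$ (r, p) * \<rho> $$ (p, q) * cnj (K $$ (s, q)))
      * cnj (L $$ (j, s)))
      = (\<Sum>(r, s, p, q)\<in>{..<n'} \<times> {..<n'} \<times> {..<n} \<times> {..<n}. L $$ (i, r) * K $$ (r, p) * \<rho> $$ (p, q)
          * cnj (L $$ (j, s) * K $$ (s, q)))"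
    by (simp add: sum.cartesian_product[symmetric] sum_distrib_left sum_distrib_right mult_ac)
  also have "\<dots> = (\<Sum>(p, q, r, s)\<in>{..<n} \<times> {..<n} \<times> {..<n'} \<times> {..<n'}. L $$ (i, r) * K $$ (r, p)
      * \<rho> $$ (p, q) * cnj (L $$ (j, s) * K $$ (s, q)))"
    by (rule sum.reindex_bij_witness[where i = "\<lambda>(p, q, r, s). (r, s, p, q)" and j
        = "\<lambda>(r, s, p, q). (p, q, r, s)"]) auto
  also have "\<dots> = (\<Sum>p<n. \<Sum>q<n. (\<Sum>r<n'. L $$ (i, r) * K $$ (r, p)) * \<rho> $$ (p, q)
      * cnj (\<Sum>s<n'. L $$ (j, s) * K $$ (s, q)))"
    by (simp add: sum.cartesian_product[symmetric] sum_distrib_left sum_distrib_right mult_ac)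
  also have "\<dots> = (\<Sum>p<n. \<Sum>q<n. (L * K) $$ (i, p) * \<rho> $$ (p, q) * cnj ((L * K) $$ (j, q)))"
    using assms by (intro sum.cong refl) (simp add: index_mult_mat_sum[where n
        = n'] del: index_mult_mat)
  finally show ?thesis .
qed

lemma kraus_apply_comp:
  assumes Ks: "set Ks \<subseteq> carrier_mat n' n" and Ls: "set Ls \<subseteq> carrier_mat n'' n'" and \<rho>: "\<rho> \<in>
      carrier_mat n n"
  shows "kraus_apply n'' Ls (kraus_apply n' Ks \<rho>) = kraus_apply n'' (map (\<lambda>(L, K). L
      * K) (List.product Ls Ks)) \<rho>"
proof (rule eq_matI)
  let ?M = "map (\<lambda>(L, K). L * K) (List.product Ls Ks)"
  have M: "set ?M \<subseteq> carrier_mat n'' n"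
    using Ks Ls by (auto intro!: mult_carrier_mat[of _ n'' n'])
  fix i j assume "i < dim_row (kraus_apply n'' ?M \<rho>)" "j < dim_col (kraus_apply n'' ?M \<rho>)"
  then have ij: "i < n''" "j < n''" by (simp_all add: kraus_apply_def)
  have "kraus_apply n'' Ls (kraus_apply n' Ks \<rho>) $$ (i, j) =
      (\<Sum>L\<leftarrow>Ls. \<Sum>r<n'. \<Sum>s<n'. L $$ (i, r) * (\<Sum>K\<leftarrow>Ks. \<Sum>p<n. \<Sum>q<n. K $$ (r, p) * \<rho> $$ (p, q)
          * cnj (K $$ (s, q))) * cnj (L $$ (j, s)))"
    using kraus_apply_index[OF Ks \<rho>] ij by (subst kraus_apply_index[OF Ls]) simp_all
  also have "\<dots> = (\<Sum>L\<leftarrow>Ls. \<Sum>K\<leftarrow>Ks. \<Sum>p<n. \<Sum>q<n. (L * K) $$ (i, p) * \<rho> $$ (p, q) * cnj ((L * K) $$ (j, q)))"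
  proof (intro arg_cong[where f = sum_list] map_cong refl)
    fix L assume L: "L \<in> set Ls"
    have "(\<Sum>r<n'. \<Sum>s<n'. L $$ (i, r) * (\<Sum>K\<leftarrow>Ks. \<Sum>p<n. \<Sum>q<n. K $$ (r, p) * \<rho> $$ (p, q)
        * cnj (K $$ (s, q))) * cnj (L $$ (j, s)))
      = (\<Sum>K\<leftarrow>Ks. \<Sum>r<n'. \<Sum>s<n'. L $$ (i, r) * (\<Sum>p<n. \<Sum>q<n. K $$ (r, p) * \<rho> $$ (p, q)
          * cnj (K $$ (s, q))) * cnj (L $$ (j, s)))"
      by (simp add: sum_sum_list_swap[symmetric] sum_list_const_mult sum_list_mult_const)
    also have "\<dots> = (\<Sum>K\<leftarrow>Ks. \<Sum>p<n. \<Sum>q<n. (L * K) $$ (i, p) * \<rho> $$ (p, q) * cnj ((L * K) $$ (j, q)))"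
      using Ks Ls L ij \<rho> by (intro arg_cong[where f = sum_list] map_cong refl sandwich_comp) auto
    finally show "(\<Sum>r<n'. \<Sum>s<n'. L $$ (i, r) * (\<Sum>K\<leftarrow>Ks. \<Sum>p<n. \<Sum>q<n. K $$ (r, p) * \<rho> $$ (p, q)
        * cnj (K $$ (s, q))) * cnj (L $$ (j, s)))
      = (\<Sum>K\<leftarrow>Ks. \<Sum>p<n. \<Sum>q<n. (L * K) $$ (i, p) * \<rho> $$ (p, q) * cnj ((L * K) $$ (j, q)))" .
  qed
  also have "\<dots> = kraus_apply n'' ?M \<rho> $$ (i, j)"
  proof -
    have "(\<Sum>L\<leftarrow>Ls. \<Sum>K\<leftarrow>Ks. f (L, K)) = (\<Sum>x\<leftarrow>List.product Ls Ks. f x)" for f :: "_ \<Rightarrow> complex"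
      by (induction Ls) (simp_all add: o_def)
    from this[of "\<lambda>(L, K). \<Sum>p<n. \<Sum>q<n. (L * K) $$ (i, p) * \<rho> $$ (p, q) * cnj ((L
        * K) $$ (j, q))"] show ?thesis
      by (subst kraus_apply_index[OF M \<rho> ij]) (simp add: o_def split_def)
  qed
  finally show "kraus_apply n'' Ls (kraus_apply n' Ks \<rho>) $$ (i, j) = kraus_apply n'' ?M \<rho> $$ (i, j)" .
qed (simp_all add: kraus_apply_def)

text \<open>Pairs are kept instead of their Kronecker products because the final estimate uses the
  two factors of each Kraus operator individually.\<close>

definition product_ops :: "nat \<times> nat \<Rightarrow> nat \<times> nat \<Rightarrow> (complex mat \<times> complex mat) list \<Rightarrow> bool" where
  "product_ops d d' KLs \<longleftrightarrow> set KLs \<subseteq> carrier_mat (fst d') (fst d) \<times> carrier_mat (snd d') (snd d)"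

lemma product_ops_kron: "product_ops d d' KLs \<Longrightarrow> set (map (case_prod kron) KLs) \<subseteq> carrier_mat (fst d'
    * snd d') (fst d * snd d)"
  by (auto simp: product_ops_def intro!: kron_carrier)

text \<open>A separable completely positive map. No normalisation is imposed, since a single outcome
  of an instrument need not preserve the trace; the trace is tracked for all outcomes together in
  \<open>LOCC_instr_trace\<close>.\<close>

definition separable_map :: "nat \<times> nat \<Rightarrow> nat \<times> nat \<Rightarrow> (complex mat \<Rightarrow> complex mat) \<Rightarrow> bool" where
  "separable_map d d' E \<longleftrightarrow> (\<exists>KLs. product_ops d d' KLs \<and>
     (\<forall>\<rho>\<in>carrier_mat (fst d * snd d) (fst d * snd d). E \<rho> = kraus_apply (fst d'
         * snd d') (map (case_prod kron) KLs) \<rho>))"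

lemma separable_map_carrier:
  "separable_map d d' E \<Longrightarrow> \<rho> \<in> carrier_mat (fst d * snd d) (fst d * snd d)
      \<Longrightarrow> E \<rho> \<in> carrier_mat (fst d' * snd d') (fst d' * snd d')"
  by (auto simp: separable_map_def)

lemma separable_map_comp:
  assumes "separable_map d d' E" "separable_map d' d'' F"
  shows "separable_map d d'' (F \<circ> E)"
proof -
  from assms obtain KLs MNs where KL: "product_ops d d' KLs"
      "\<And>\<rho>. \<rho> \<in> carrier_mat (fst d * snd d) (fst d * snd d) \<Longrightarrow> E \<rho> = kraus_apply (fst d'
          * snd d') (map (case_prod kron) KLs) \<rho>"
    and MN: "product_ops d' d'' MNs"
      "\<And>\<rho>. \<rho> \<in> carrier_mat (fst d' * snd d') (fst d' * snd d') \<Longrightarrow> F \<rho> = kraus_apply (fst d''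
          * snd d'') (map (case_prod kron) MNs) \<rho>"
    unfolding separable_map_def by auto
  let ?P = "map (\<lambda>((M, N), (K, L)). (M * K, N * L)) (List.product MNs KLs)"
  have "product_ops d d'' ?P" using KL(1) MN(1)
    by (auto simp: product_ops_def intro!: mult_carrier_mat[of _ "fst d''" "fst d'"]
        mult_carrier_mat[of _ "snd d''" "snd d'"])
  moreover have "(F \<circ> E) \<rho> = kraus_apply (fst d'' * snd d'') (map (case_prod kron) ?P) \<rho>"
    if \<rho>: "\<rho> \<in> carrier_mat (fst d * snd d) (fst d * snd d)" for \<rho>
  proof -
    have eq: "map (\<lambda>(L, K). L * K) (List.product (map (case_prod kron) MNs) (map (case_prod kron)
        KLs)) = map (case_prod kron) ?P"
    proof -
      have product_map: "List.product (map f xs) (map g ys) = map (\<lambda>(x, y). (f x, g y))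
          (List.product xs ys)"
        for f g :: "complex mat \<times> complex mat \<Rightarrow> complex mat" and xs ys
        by (induction xs) (auto simp: o_def)
      show ?thesis
        unfolding product_map map_map o_def
      proof (rule map_cong[OF refl], goal_cases)
        case (1 x)
        then obtain M N K L where x: "x = ((M, N), (K, L))" "(M, N) \<in> set MNs" "(K, L) \<in> set KLs"
            by auto
        with KL(1) MN(1) have "M \<in> carrier_mat (fst d'') (fst d')" "N \<in> carrier_mat (snd d'') (snd d')"
          "K \<in> carrier_mat (fst d') (fst d)" "L \<in> carrier_mat (snd d') (snd d)"
          by (auto simp: product_ops_def)
        from kron_mult[OF this] x(1) show ?case by simp
      qed
    qed
    have "(F \<circ> E) \<rho> = kraus_apply (fst d'' * snd d'') (map (case_prod kron) MNs) (kraus_apply (fst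
        d' * snd d') (map (case_prod kron) KLs) \<rho>)"
      using \<rho> by (simp add: KL(2) MN(2))
    also have "\<dots> = kraus_apply (fst d'' * snd d'') (map (case_prod kron) ?P) \<rho>"
      by (subst kraus_apply_comp[OF product_ops_kron[OF KL(1)] product_ops_kron[OF MN(1)] \<rho>]) (simp
          only: eq)
    finally show ?thesis .
  qed
  ultimately show ?thesis unfolding separable_map_def by blast
qed

section \<open>Trace preservation of LOCC instruments\<close>

lemma trace_kraus_apply:
  assumes Ks: "set Ks \<subseteq> carrier_mat n' n" and \<rho>: "\<rho> \<in> carrier_mat n n"
  shows "trace_c (kraus_apply n' Ks \<rho>) = (\<Sum>p<n. \<Sum>q<n. \<rho> $$ (p, q) * (\<Sum>K\<leftarrow>Ks. \<Sum>r<n'. cnj (K $$ (r, q))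
      * K $$ (r, p)))"
proof -
  have "trace_c (kraus_apply n' Ks \<rho>) = (\<Sum>r<n'. \<Sum>K\<leftarrow>Ks. \<Sum>p<n. \<Sum>q<n. K $$ (r, p) * \<rho> $$ (p, q)
      * cnj (K $$ (r, q)))"
    using carrier_matD(1)[OF kraus_apply_carrier[of n' Ks \<rho>]] kraus_apply_index[OF Ks \<rho>]
        by (simp add: trace_c_def)
  also have "\<dots> = (\<Sum>K\<leftarrow>Ks. \<Sum>p<n. \<Sum>q<n. \<Sum>r<n'. K $$ (r, p) * \<rho> $$ (p, q) * cnj (K $$ (r, q)))"
    unfolding sum_sum_list_swap
    by (subst sum.swap, rule arg_cong[where f = sum_list], rule map_cong, rule refl, rule sum.cong,
        rule refl, rule sum.swap)
  also have "\<dots> = (\<Sum>p<n. \<Sum>q<n. \<Sum>K\<leftarrow>Ks. \<Sum>r<n'. K $$ (r, p) * \<rho> $$ (p, q) * cnj (K $$ (r, q)))"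
    unfolding sum_sum_list_swap ..
  finally show ?thesis
    by (simp add: sum_list_const_mult[symmetric] sum_distrib_left mult_ac)
qed

lemma trace_kraus_complete:
  assumes Ks: "set Ks \<subseteq> carrier_mat n' n" and c: "kraus_complete n Ks" and \<rho>: "\<rho> \<in> carrier_mat n n"
  shows "trace_c (kraus_apply n' Ks \<rho>) = trace_c \<rho>"
proof -
  have "trace_c (kraus_apply n' Ks \<rho>) = (\<Sum>p<n. \<Sum>q<n. \<rho> $$ (p, q) * (if q = p then 1 else 0))"
    using c unfolding trace_kraus_apply[OF Ks \<rho>] kraus_complete_iff[OF Ks]
    by (intro sum.cong refl arg_cong2[where f = "(*)"]) auto
  also have "\<dots> = (\<Sum>p<n. \<Sum>q<n. if q = p then \<rho> $$ (p, q) else 0)"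
    by (intro sum.cong refl) auto
  also have "\<dots> = trace_c \<rho>" using \<rho> by (simp add: trace_c_def)
  finally show ?thesis .
qed

lemma kraus_complete_kron_one_right:
  assumes Ks: "set Ks \<subseteq> carrier_mat n' n" and c: "kraus_complete n Ks"
  shows "kraus_complete (n * b) (map (\<lambda>K. kron K (1\<^sub>m b)) Ks)"
proof -
  have set: "set (map (\<lambda>K. kron K (1\<^sub>m b)) Ks) \<subseteq> carrier_mat (n' * b) (n * b)"
    using Ks by (auto intro!: kron_carrier)
  show ?thesis
    unfolding kraus_complete_iff[OF set]
  proof (intro allI impI)
    fix i j assume ij: "i < n * b" "j < n * b"
    note l = div_mod_less[OF ij(1)] div_mod_less[OF ij(2)]
    have "(\<Sum>K\<leftarrow>map (\<lambda>K. kron K (1\<^sub>m b)) Ks. \<Sum>r<n' * b. cnj (K $$ (r, i)) * K $$ (r, j)) =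
      (\<Sum>K\<leftarrow>Ks. (\<Sum>r<n'. cnj (K $$ (r, i div b)) * K $$ (r, j div b)) * (if i mod b
          = j mod b then 1 else 0))"
      unfolding map_map o_def
    proof (intro arg_cong[where f = sum_list] map_cong refl)
      fix K assume "K \<in> set Ks"
      then have K: "K \<in> carrier_mat n' n" using Ks by auto
      have "(\<Sum>r<n' * b. cnj (kron K (1\<^sub>m b) $$ (r, i)) * kron K (1\<^sub>m b) $$ (r, j)) =
        (\<Sum>r<n' * b. cnj (K $$ (r div b, i div b) * (if r mod b = i mod b then 1 else 0)) *
            (K $$ (r div b, j div b) * (if r mod b = j mod b then 1 else 0)))"
      proof (intro sum.cong refl)
        fix r assume "r \<in> {..<n' * b}"
        then have r: "r < n' * b" by simp
        show "cnj (kron K (1\<^sub>m b) $$ (r, i)) * kron K (1\<^sub>m b) $$ (r, j)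
            = cnj (K $$ (r div b, i div b) * (if r mod b = i mod b then 1 else 0)) *
            (K $$ (r div b, j div b) * (if r mod b = j mod b then 1 else 0))"
          using K ij r l div_mod_less[OF r] by simp
      qed
      also have "\<dots> = (\<Sum>x<n'. \<Sum>y<b. cnj (K $$ (x, i div b) * (if y = i mod b then 1 else 0)) *
            (K $$ (x, j div b) * (if y = j mod b then 1 else 0)))"
        by (rule sum_pair_index)
      also have "\<dots> = (\<Sum>x<n'. \<Sum>y<b. if y = i mod b then cnj (K $$ (x, i div b)) * K $$ (x, j div b)
          * (if i mod b = j mod b then 1 else 0) else 0)"
        by (intro sum.cong refl) auto
      also have "\<dots> = (\<Sum>r<n'. cnj (K $$ (r, i div b)) * K $$ (r, j div b)) * (if i mod b
          = j mod b then 1 else 0)"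
        using l by (simp add: sum_distrib_right)
      finally show "(\<Sum>r<n' * b. cnj (kron K (1\<^sub>m b) $$ (r, i)) * kron K (1\<^sub>m b) $$ (r, j)) =
        (\<Sum>r<n'. cnj (K $$ (r, i div b)) * K $$ (r, j div b)) * (if i mod b = j mod b then 1 else 0)" .
    qed
    also have "\<dots> = (if i div b = j div b then 1 else 0) * (if i mod b = j mod b then 1 else 0)"
      unfolding sum_list_mult_const using c l unfolding kraus_complete_iff[OF Ks]
          by (intro arg_cong2[where f = "(*)"] refl) blast
    also have "\<dots> = (if i = j then 1 else 0)"
      by (auto; metis div_mult_mod_eq)
    finally show "(\<Sum>K\<leftarrow>map (\<lambda>K. kron K (1\<^sub>m b)) Ks. \<Sum>r<n' * b. cnj (K $$ (r, i)) * K $$ (r, j))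
        = (if i = j then 1 else 0)" .
  qed
qed

lemma kraus_complete_kron_one_left:
  assumes Ks: "set Ks \<subseteq> carrier_mat n' n" and c: "kraus_complete n Ks"
  shows "kraus_complete (a * n) (map (kron (1\<^sub>m a)) Ks)"
proof -
  have set: "set (map (kron (1\<^sub>m a)) Ks) \<subseteq> carrier_mat (a * n') (a * n)"
    using Ks by (auto intro!: kron_carrier)
  show ?thesis
    unfolding kraus_complete_iff[OF set]
  proof (intro allI impI)
    fix i j assume ij: "i < a * n" "j < a * n"
    note l = div_mod_less[OF ij(1)] div_mod_less[OF ij(2)]
    have "(\<Sum>K\<leftarrow>map (kron (1\<^sub>m a)) Ks. \<Sum>r<a * n'. cnj (K $$ (r, i)) * K $$ (r, j)) =
      (\<Sum>K\<leftarrow>Ks. (if i div n = j div n then 1 else 0) * (\<Sum>r<n'. cnj (K $$ (r, i mod n))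
          * K $$ (r, j mod n)))"
      unfolding map_map o_def
    proof (intro arg_cong[where f = sum_list] map_cong refl)
      fix K assume "K \<in> set Ks"
      then have K: "K \<in> carrier_mat n' n" using Ks by auto
      have "(\<Sum>r<a * n'. cnj (kron (1\<^sub>m a) K $$ (r, i)) * kron (1\<^sub>m a) K $$ (r, j)) =
        (\<Sum>r<a * n'. cnj ((if r div n' = i div n then 1 else 0) * K $$ (r mod n', i mod n)) *
            ((if r div n' = j div n then 1 else 0) * K $$ (r mod n', j mod n)))"
      proof (intro sum.cong refl)
        fix r assume "r \<in> {..<a * n'}"
        then have r: "r < a * n'" by simp
        show "cnj (kron (1\<^sub>m a) K $$ (r, i)) * kron (1\<^sub>m a) K $$ (r, j) = cnj ((if r div n'
            = i div n then 1 else 0) * K $$ (r mod n', i mod n)) *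
            ((if r div n' = j div n then 1 else 0) * K $$ (r mod n', j mod n))"
          using K ij r l div_mod_less[OF r] by simp
      qed
      also have "\<dots> = (\<Sum>x<a. \<Sum>y<n'. cnj ((if x = i div n then 1 else 0) * K $$ (y, i mod n)) *
            ((if x = j div n then 1 else 0) * K $$ (y, j mod n)))"
        by (rule sum_pair_index)
      also have "\<dots> = (\<Sum>x<a. if x = i div n then (if i div n = j div n then 1 else 0)
          * (\<Sum>y<n'. cnj (K $$ (y, i mod n)) * K $$ (y, j mod n)) else 0)"
        by (intro sum.cong refl) (auto simp: sum_distrib_left)
      also have "\<dots> = (if i div n = j div n then 1 else 0) * (\<Sum>r<n'. cnj (K $$ (r, i mod n))
          * K $$ (r, j mod n))"
        using l by simp
      finally show "(\<Sum>r<a * n'. cnj (kron (1\<^sub>m a) K $$ (r, i)) * kron (1\<^sub>m a) K $$ (r, j)) =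
        (if i div n = j div n then 1 else 0) * (\<Sum>r<n'. cnj (K $$ (r, i mod n)) * K $$ (r, j mod n))" .
    qed
    also have "\<dots> = (if i div n = j div n then 1 else 0) * (if i mod n = j mod n then 1 else 0)"
      unfolding sum_list_const_mult using c l unfolding kraus_complete_iff[OF Ks]
          by (intro arg_cong2[where f = "(*)"] refl) blast
    also have "\<dots> = (if i = j then 1 else 0)"
      by (auto; metis div_mult_mod_eq)
    finally show "(\<Sum>K\<leftarrow>map (kron (1\<^sub>m a)) Ks. \<Sum>r<a * n'. cnj (K $$ (r, i)) * K $$ (r, j)) = (if i
        = j then 1 else 0)" .
  qed
qed

text \<open>A local instrument is complete only after its outcomes are concatenated. Linearity of
  the trace passes from the sum over outcomes to that joint family.\<close>

lemma sum_list_trace_kraus_concat: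
  assumes "set (concat Kss) \<subseteq> carrier_mat n' n" and \<rho>: "\<rho> \<in> carrier_mat n n"
  shows "(\<Sum>Ks\<leftarrow>Kss. trace_c (kraus_apply n' Ks \<rho>)) = trace_c (kraus_apply n' (concat Kss) \<rho>)"
  using assms(1)
proof (induction Kss)
  case Nil
  then show ?case by (simp add: trace_c_def kraus_apply_def)
next
  case (Cons Ks Kss)
  then have K: "set Ks \<subseteq> carrier_mat n' n" "set (concat Kss) \<subseteq> carrier_mat n' n" "set (Ks @ concat
      Kss) \<subseteq> carrier_mat n' n" by auto
  show ?case
    using Cons.IH[OF K(2)]
    by (simp add: trace_kraus_apply[OF K(1) \<rho>] trace_kraus_apply[OF K(2) \<rho>] trace_kraus_apply[OF
        K(3) \<rho>] ring_distribs sum.distrib)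
qed

lemma LOCC_instr_separable:
  "LOCC_instr d d' Es \<Longrightarrow> \<forall>E\<in>set Es. separable_map d d' E"
proof (induction rule: LOCC_instr.induct)
  case (localA Kss a' a b)
  show ?case
  proof
    fix E assume "E \<in> set (map (\<lambda>Ks. kraus_apply (a'*b) (map (\<lambda>K. kron K (1\<^sub>m b)) Ks)) Kss)"
    then obtain Ks where Ks: "Ks \<in> set Kss" "E = kraus_apply (a'*b) (map (\<lambda>K. kron K (1\<^sub>m b)) Ks)"
        by auto
    then show "separable_map (a, b) (a', b) E"
      unfolding separable_map_def using localA
      by (intro exI[of _ "map (\<lambda>K. (K, 1\<^sub>m b)) Ks"]) (auto simp: product_ops_def o_def)
  qed
next
  case (localB Kss b' b a)
  show ?case
  proof
    fix E assume "E \<in> set (map (\<lambda>Ks. kraus_apply (a*b') (map (\<lambda>K. kron (1\<^sub>m a) K) Ks)) Kss)"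
    then obtain Ks where Ks: "Ks \<in> set Kss" "E = kraus_apply (a*b') (map (\<lambda>K. kron (1\<^sub>m a) K) Ks)"
        by auto
    then show "separable_map (a, b) (a, b') E"
      unfolding separable_map_def using localB
      by (intro exI[of _ "map (\<lambda>K. (1\<^sub>m a, K)) Ks"]) (auto simp: product_ops_def o_def)
  qed
next
  case (comp d1 d2 Es d3 Fs)
  then show ?case by (auto intro!: separable_map_comp)
qed

lemma LOCC_instr_trace:
  "LOCC_instr d d' Es \<Longrightarrow> \<rho> \<in> carrier_mat (fst d * snd d) (fst d * snd d) \<Longrightarrow> (\<Sum>E\<leftarrow>Es. trace_c (E \<rho>))
      = trace_c \<rho>"
proof (induction arbitrary: \<rho> rule: LOCC_instr.induct)
  case (localA Kss a' a b)
  have Kss: "set (concat Kss) \<subseteq> carrier_mat a' a" using localA(1) by auto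
  let ?Lss = "map (map (\<lambda>K. kron K (1\<^sub>m b))) Kss"
  have eq: "concat ?Lss = map (\<lambda>K. kron K (1\<^sub>m b)) (concat Kss)" by (simp add: map_concat)
  have Lss: "set (concat ?Lss) \<subseteq> carrier_mat (a' * b) (a * b)"
    using Kss unfolding eq by (auto intro!: kron_carrier)
  have \<rho>: "\<rho> \<in> carrier_mat (a * b) (a * b)" using localA.prems by simp
  have "(\<Sum>Ks\<leftarrow>?Lss. trace_c (kraus_apply (a' * b) Ks \<rho>)) = trace_c \<rho>"
    using sum_list_trace_kraus_concat[OF Lss \<rho>]
      trace_kraus_complete[OF Lss _ \<rho>] kraus_complete_kron_one_right[OF Kss localA(2)]
          by (simp only: eq)
  then show ?case by (simp add: o_def)
next
  case (localB Kss b' b a)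
  have Kss: "set (concat Kss) \<subseteq> carrier_mat b' b" using localB(1) by auto
  let ?Lss = "map (map (kron (1\<^sub>m a))) Kss"
  have eq: "concat ?Lss = map (kron (1\<^sub>m a)) (concat Kss)" by (simp add: map_concat)
  have Lss: "set (concat ?Lss) \<subseteq> carrier_mat (a * b') (a * b)"
    using Kss unfolding eq by (auto intro!: kron_carrier)
  have \<rho>: "\<rho> \<in> carrier_mat (a * b) (a * b)" using localB.prems by simp
  have "(\<Sum>Ks\<leftarrow>?Lss. trace_c (kraus_apply (a * b') Ks \<rho>)) = trace_c \<rho>"
    using sum_list_trace_kraus_concat[OF Lss \<rho>]
      trace_kraus_complete[OF Lss _ \<rho>] kraus_complete_kron_one_left[OF Kss localB(2)] by (simp only: eq)
  then show ?case by (simp add: o_def)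
next
  case (comp d1 d2 Es d3 Fs)
  have "(\<Sum>G\<leftarrow>concat (map (\<lambda>k. map (\<lambda>F. F \<circ> Es ! k) (Fs k)) [0..<length Es]). trace_c (G \<rho>)) =
      (\<Sum>k\<leftarrow>[0..<length Es]. \<Sum>F\<leftarrow>Fs k. trace_c (F ((Es ! k) \<rho>)))"
    by (simp add: map_concat sum_list_concat o_def)
  also have "\<dots> = (\<Sum>k\<leftarrow>[0..<length Es]. trace_c ((Es ! k) \<rho>))"
  proof (intro arg_cong[where f = sum_list] map_cong refl)
    fix k assume "k \<in> set [0..<length Es]"
    then have k: "k < length Es" by simp
    \<comment> \<open>The induction hypothesis for the second round asks for an intermediate
      operator of the right dimensions; separability of the first-round outcome supplies it.\<close>
    then have "separable_map d1 d2 (Es ! k)"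
      using LOCC_instr_separable[OF comp(1)] by auto
    from separable_map_carrier[OF this comp.prems] comp.IH(2) k
    show "(\<Sum>F\<leftarrow>Fs k. trace_c (F ((Es ! k) \<rho>))) = trace_c ((Es ! k) \<rho>)" by blast
  qed
  also have "\<dots> = (\<Sum>E\<leftarrow>Es. trace_c (E \<rho>))"
    by (simp add: interv_sum_list_conv_sum_set_nat sum_lessThan_nth[symmetric] atLeast0LessThan)
  finally show ?case using comp.IH(1)[OF comp.prems] by simp
qed

text \<open>The weight identity comes from the trace of \<open>E\<close> applied to the identity: it
  equals \<open>a * b\<close> by trace preservation, and it is also the sum of the squared Frobenius
  norms of the Kraus operators, which factorise over the parties.\<close>

lemma LOCC_channel_separable:
  assumes "LOCC_channel (a, b) (a', b') E"
  obtains KLs where "product_ops (a, b) (a', b') KLs"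
    and "\<And>\<rho>. \<rho> \<in> carrier_mat (a * b) (a * b) \<Longrightarrow> E \<rho> = kraus_apply (a' * b') (map (case_prod kron) KLs) \<rho>"
    and "(\<Sum>(K, L)\<leftarrow>KLs. (\<Sum>r<a'. \<Sum>p<a. (cmod (K $$ (r, p)))\<^sup>2)
        * (\<Sum>r<b'. \<Sum>p<b. (cmod (L $$ (r, p)))\<^sup>2)) = real (a * b)"
proof -
  from assms obtain Es where Es: "LOCC_instr (a, b) (a', b') Es"
    and E: "\<And>\<rho>. \<rho> \<in> carrier_mat (a * b) (a * b) \<Longrightarrow> E \<rho> = msum (a' * b') (length Es) (\<lambda>k. (Es ! k) \<rho>)"
    unfolding LOCC_channel_def by auto
  have "\<forall>F\<in>set Es. \<exists>KLs. product_ops (a, b) (a', b') KLs \<and>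
      (\<forall>\<rho>\<in>carrier_mat (a * b) (a * b). F \<rho> = kraus_apply (a' * b') (map (case_prod kron) KLs) \<rho>)"
    using LOCC_instr_separable[OF Es] by (simp add: separable_map_def)
  then obtain G where G: "\<And>F. F \<in> set Es \<Longrightarrow> product_ops (a, b) (a', b') (G F)"
    "\<And>F \<rho>. F \<in> set Es \<Longrightarrow> \<rho> \<in> carrier_mat (a * b) (a * b) \<Longrightarrow> F \<rho> = kraus_apply (a'
        * b') (map (case_prod kron) (G F)) \<rho>"
    by metis
  define KLs where "KLs = concat (map G Es)"
  have ops: "product_ops (a, b) (a', b') KLs"
    using G(1) by (fastforce simp: KLs_def product_ops_def)
  note sets = product_ops_kron[OF ops, unfolded fst_conv snd_conv]
  have eq: "map (case_prod kron) KLs = concat (map (\<lambda>F. map (case_prod kron) (G F)) Es)"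
    by (simp add: KLs_def map_concat o_def)
  have Kraus: "E \<rho> = kraus_apply (a' * b') (map (case_prod kron) KLs) \<rho>" if \<rho>: "\<rho> \<in> carrier_mat (a
      * b) (a * b)" for \<rho>
  proof (rule eq_matI)
    fix i j assume "i < dim_row (kraus_apply (a' * b') (map (case_prod kron) KLs) \<rho>)" "j < dim_col
        (kraus_apply (a' * b') (map (case_prod kron) KLs) \<rho>)"
    then have ij: "i < a' * b'" "j < a' * b'" by (simp_all add: kraus_apply_def)
    let ?f = "\<lambda>K. \<Sum>p<a * b. \<Sum>q<a * b. K $$ (i, p) * \<rho> $$ (p, q) * cnj (K $$ (j, q))"
    have "E \<rho> $$ (i, j) = (\<Sum>F\<leftarrow>Es. F \<rho> $$ (i, j))"
      using ij sum_lessThan_nth[of "\<lambda>F. F \<rho> $$ (i, j)" Es] by (simp add: E[OF \<rho>])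
    also have "\<dots> = (\<Sum>F\<leftarrow>Es. sum_list (map ?f (map (case_prod kron) (G F))))"
      using G(2) \<rho> kraus_apply_index[OF product_ops_kron[OF G(1)] _ _ _] ij
      by (intro arg_cong[where f = sum_list] map_cong refl) auto
    also have "\<dots> = sum_list (map ?f (map (case_prod kron) KLs))"
      by (simp add: eq map_concat sum_list_concat o_def)
    also have "\<dots> = kraus_apply (a' * b') (map (case_prod kron) KLs) \<rho> $$ (i, j)"
      by (rule kraus_apply_index[OF sets \<rho> ij, symmetric])
    finally show "E \<rho> $$ (i, j) = kraus_apply (a' * b') (map (case_prod kron) KLs) \<rho> $$ (i, j)" .
  qed (simp_all add: E[OF \<rho>] kraus_apply_def)
  have one: "1\<^sub>m (a * b) \<in> carrier_mat (a * b) (a * b)" by simp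
  have "complex_of_real (real (a * b)) = trace_c (1\<^sub>m (a * b))" by (simp add: trace_c_def)
  also have "\<dots> = (\<Sum>F\<leftarrow>Es. trace_c (F (1\<^sub>m (a * b))))"
    using LOCC_instr_trace[OF Es] one by simp
  also have "\<dots> = (\<Sum>Ks\<leftarrow>map (\<lambda>F. map (case_prod kron) (G F)) Es. trace_c (kraus_apply (a'
      * b') Ks (1\<^sub>m (a * b))))"
    unfolding map_map o_def using G(2) one by (intro arg_cong[where f = sum_list] map_cong refl) auto
  also have "\<dots> = trace_c (kraus_apply (a' * b') (map (case_prod kron) KLs) (1\<^sub>m (a * b)))"
    using sum_list_trace_kraus_concat[OF _ one] sets unfolding eq by blast
  also have "\<dots> = (\<Sum>p<a * b. \<Sum>q<a * b. if q = p then \<Sum>K\<leftarrow>map (case_prod kron) KLs. \<Sum>r<a'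
      * b'. cnj (K $$ (r, p)) * K $$ (r, p) else 0)"
    unfolding trace_kraus_apply[OF sets one] by (intro sum.cong refl) auto
  also have "\<dots> = (\<Sum>p<a * b. \<Sum>K\<leftarrow>map (case_prod kron) KLs. \<Sum>r<a' * b'. cnj (K $$ (r, p)) * K $$ (r, p))"
    by simp
  also have "\<dots> = (\<Sum>K\<leftarrow>map (case_prod kron) KLs. \<Sum>p<a * b. \<Sum>r<a' * b'. cnj (K $$ (r, p)) * K $$ (r, p))"
    by (rule sum_sum_list_swap)
  also have "\<dots> = (\<Sum>(K, L)\<leftarrow>KLs. complex_of_real ((\<Sum>r<a'. \<Sum>p<a. (cmod (K $$ (r, p)))\<^sup>2)
      * (\<Sum>r<b'. \<Sum>p<b. (cmod (L $$ (r, p)))\<^sup>2)))"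
    unfolding map_map o_def
  proof (intro arg_cong[where f = sum_list] map_cong refl)
    fix x assume x: "x \<in> set KLs"
    obtain K L where KL: "x = (K, L)" by (cases x)
    with x ops have K: "K \<in> carrier_mat a' a" and L: "L \<in> carrier_mat b' b"
        by (auto simp: product_ops_def)
    let ?k = "\<lambda>r p. complex_of_real ((cmod (K $$ (r, p)))\<^sup>2)" and ?l
        = "\<lambda>r p. complex_of_real ((cmod (L $$ (r, p)))\<^sup>2)"
    have "(\<Sum>p<a * b. \<Sum>r<a' * b'. cnj (kron K L $$ (r, p)) * kron K L $$ (r, p)) =
        (\<Sum>p<a * b. \<Sum>r<a' * b'. ?k (r div b') (p div b) * ?l (r mod b') (p mod b))"
      using K L by (intro sum.cong refl) (simp add: complex_norm_square mult_ac del: of_real_power)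
    also have "\<dots> = (\<Sum>p<a * b. \<Sum>r<a'. \<Sum>s<b'. ?k r (p div b) * ?l s (p mod b))"
      by (intro sum.cong refl sum_pair_index)
    also have "\<dots> = (\<Sum>p<a. \<Sum>q<b. \<Sum>r<a'. \<Sum>s<b'. ?k r p * ?l s q)"
      by (rule sum_pair_index)
    also have "\<dots> = (\<Sum>p<a. \<Sum>r<a'. ?k r p) * (\<Sum>q<b. \<Sum>s<b'. ?l s q)"
      by (simp add: sum_product)
    also have "\<dots> = complex_of_real ((\<Sum>r<a'. \<Sum>p<a. (cmod (K $$ (r, p)))\<^sup>2)
        * (\<Sum>r<b'. \<Sum>p<b. (cmod (L $$ (r, p)))\<^sup>2))"
      by (subst sum.swap, subst (2) sum.swap) simp
    finally show "(\<Sum>p<a * b. \<Sum>r<a' * b'. cnj (case_prod kron x $$ (r, p))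
        * case_prod kron x $$ (r, p)) =
      (case x of (K, L) \<Rightarrow> complex_of_real ((\<Sum>r<a'. \<Sum>p<a. (cmod (K $$ (r, p)))\<^sup>2)
          * (\<Sum>r<b'. \<Sum>p<b. (cmod (L $$ (r, p)))\<^sup>2)))"
      by (simp add: KL)
  qed
  also have "\<dots> = complex_of_real (\<Sum>(K, L)\<leftarrow>KLs. (\<Sum>r<a'. \<Sum>p<a. (cmod (K $$ (r, p)))\<^sup>2)
      * (\<Sum>r<b'. \<Sum>p<b. (cmod (L $$ (r, p)))\<^sup>2))"
    by (induction KLs) auto
  finally have "(\<Sum>(K, L)\<leftarrow>KLs. (\<Sum>r<a'. \<Sum>p<a. (cmod (K $$ (r, p)))\<^sup>2)
      * (\<Sum>r<b'. \<Sum>p<b. (cmod (L $$ (r, p)))\<^sup>2)) = real (a * b)"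
    by (simp only: of_real_eq_iff)
  from that[OF ops Kraus this] show ?thesis .
qed

text \<open>Two rounds with a single outcome each: the first party applies K, then the second
  applies L.\<close>

lemma LOCC_channel_local:
  assumes K: "isometry_mat a' a K" and L: "isometry_mat b' b L"
    and E: "\<And>\<rho>. \<rho> \<in> carrier_mat (a * b) (a * b) \<Longrightarrow> E \<rho> = kron K L * \<rho> * adj (kron K L)"
  shows "LOCC_channel (a, b) (a', b') E"
proof -
  have c: "K \<in> carrier_mat a' a" "L \<in> carrier_mat b' b"
    using K L by (auto simp: isometry_mat_def)
  have one: "kraus_complete n [M] \<longleftrightarrow> adj M * M = 1\<^sub>m n" if "M \<in> carrier_mat n' n"
      for n n' and M :: "complex mat"
  proof -
    have "msum n 1 (\<lambda>l. adj ([M] ! l) * [M] ! l) = adj M * M"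
      using that by (intro eq_matI) auto
    then show ?thesis by (simp add: kraus_complete_def)
  qed
  have A: "LOCC_instr (a, b) (a', b) [kraus_apply (a' * b) [kron K (1\<^sub>m b)]]"
    using LOCC_instr.localA[of "[[K]]" a' a b] K c one[OF c(1)] by (simp add: isometry_mat_def)
  have B: "LOCC_instr (a', b) (a', b') [kraus_apply (a' * b') [kron (1\<^sub>m a') L]]"
    using LOCC_instr.localB[of "[[L]]" b' b a'] L c one[OF c(2)] by (simp add: isometry_mat_def)
  have "LOCC_instr (a, b) (a', b') [kraus_apply (a' * b') [kron (1\<^sub>m a') L] \<circ> kraus_apply (a'
      * b) [kron K (1\<^sub>m b)]]"
    using LOCC_instr.comp[OF A, of "(a', b')" "\<lambda>_. [kraus_apply (a' * b') [kron (1\<^sub>m a') L]]"] B by simp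
  moreover have "E \<rho> = msum (a' * b') 1 (\<lambda>k. kraus_apply (a'
      * b') [kron (1\<^sub>m a') L] (kraus_apply (a' * b) [kron K (1\<^sub>m b)] \<rho>))"
    if \<rho>: "\<rho> \<in> carrier_mat (a * b) (a * b)" for \<rho>
  proof -
    have "kron (1\<^sub>m a') L * kron K (1\<^sub>m b) = kron K L"
      using kron_mult[OF one_carrier_mat c(2) c(1) one_carrier_mat] c by simp
    then have "kraus_apply (a' * b') [kron (1\<^sub>m a') L] (kraus_apply (a' * b) [kron K (1\<^sub>m b)] \<rho>)
        = kraus_apply (a' * b') [kron K L] \<rho>"
      using kraus_apply_comp[of "[kron K (1\<^sub>m b)]" "a' * b" "a * b" "[kron (1\<^sub>m a') L]" "a' * b'" \<rho>] c \<rho>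
      by (simp add: kron_carrier)
    moreover have "kraus_apply (a' * b') [kron K L] \<rho> = kron K L * \<rho> * adj (kron K L)"
      using c \<rho> by (intro eq_matI) (auto simp: kraus_apply_def)
    moreover have "msum (a' * b') 1 (\<lambda>k. kraus_apply (a' * b') [kron K L] \<rho>) = kraus_apply (a'
        * b') [kron K L] \<rho>"
      by (intro eq_matI) (auto simp: kraus_apply_def)
    ultimately show ?thesis using E[OF \<rho>] by simp
  qed
  ultimately show ?thesis
    unfolding LOCC_channel_def by (intro exI[of _ "[_]"]) auto
qed

section \<open>The witness on Choi matrices\<close>

lemma tensor_form_sum_list: "tensor_form rA rB A B (\<lambda>k k' l l'. \<Sum>x\<leftarrow>xs. f x k k' l l')
    = (\<Sum>x\<leftarrow>xs. tensor_form rA rB A B (f x))"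
  by (induction xs) (simp_all add: tensor_form_add, simp add: tensor_form_def)

lemma tensor_form_cong:
  assumes "\<And>k k' l l'. k < rA \<Longrightarrow> k' < rA \<Longrightarrow> l < rB \<Longrightarrow> l' < rB \<Longrightarrow> f k k' l l' = g k k' l l'"
  shows "tensor_form rA rB A B f = tensor_form rA rB A B g"
  unfolding tensor_form_def using assms by (intro sum.cong refl) simp

text \<open>Extending the orthonormal families \<^term>\<open>v\<close> and \<^term>\<open>u\<close> to bases is avoided by adjoining the
  coordinates of the residual vectors; the two blocks of residual coordinates are disjoint, so they do
  not contribute to the overlap \<^term>\<open>w\<close>.\<close>
lemma witness_orthonormal_bound:
  fixes v :: "nat \<Rightarrow> 'i \<Rightarrow> complex" and u :: "nat \<Rightarrow> 'h \<Rightarrow> complex" and IA :: "'i set" and IB :: "'h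
      set" and m :: nat
    and \<kappa> :: "nat \<Rightarrow> 'i \<Rightarrow> complex" and \<mu> :: "nat \<Rightarrow> 'h \<Rightarrow> complex"
  assumes A: "bounded_form rA s A" and B: "bounded_form rB t B" and st: "s * t \<le> 1"
    and I: "finite IA" "finite IB"
    and v: "\<And>j k. j < m \<Longrightarrow> k < m \<Longrightarrow> (\<Sum>i\<in>IA. cnj (v j i) * v k i) = (if j = k then 1 else 0)"
    and u: "\<And>j k. j < m \<Longrightarrow> k < m \<Longrightarrow> (\<Sum>i\<in>IB. cnj (u j i) * u k i) = (if j = k then 1 else 0)"
  defines "w \<equiv> \<lambda>k l. \<Sum>j<m. (\<Sum>i\<in>IA. cnj (v j i) * \<kappa> k i) * (\<Sum>i\<in>IB. cnj (u j i) * \<mu> l i)"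
  shows "cmod (tensor_form rA rB A B (\<lambda>k k' l l'. 2 * (cnj (w k l) * w k' l') -
      (\<Sum>i\<in>IA. cnj (\<kappa> k i) * \<kappa> k' i) * (\<Sum>i\<in>IB. cnj (\<mu> l i) * \<mu> l' i)))
    \<le> (\<Sum>k<rA. \<Sum>i\<in>IA. (cmod (\<kappa> k i))\<^sup>2) * (\<Sum>l<rB. \<Sum>i\<in>IB. (cmod (\<mu> l i))\<^sup>2)"
proof -
  define ca where "ca j k = (\<Sum>i\<in>IA. cnj (v j i) * \<kappa> k i)" for j k
  define cb where "cb j l = (\<Sum>i\<in>IB. cnj (u j i) * \<mu> l i)" for j l
  define J where "J = {..<m} <+> (IA <+> IB)"
  define \<alpha> :: "nat + ('i + 'h) \<Rightarrow> nat \<Rightarrow> complex" where "\<alpha> = (\<lambda>z k. case z of Inl j \<Rightarrow> ca j k | Inr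
      (Inl i) \<Rightarrow> \<kappa> k i - (\<Sum>j<m. ca j k * v j i) | Inr (Inr i) \<Rightarrow> 0)"
  define \<beta> :: "nat + ('i + 'h) \<Rightarrow> nat \<Rightarrow> complex" where "\<beta> = (\<lambda>z l. case z of Inl j \<Rightarrow> cb j l | Inr
      (Inl i) \<Rightarrow> 0 | Inr (Inr i) \<Rightarrow> \<mu> l i - (\<Sum>j<m. cb j l * u j i))"
  have sumJ: "(\<Sum>z\<in>J. f z) = (\<Sum>j<m. f (Inl j)) + ((\<Sum>i\<in>IA. f (Inr (Inl i))) + (\<Sum>i\<in>IB. f (Inr (Inr i))))"
    for f :: "nat + ('i + 'h) \<Rightarrow> complex"
    using I by (simp add: J_def sum.Plus o_def)
  have gramA: "(\<Sum>z\<in>J. cnj (\<alpha> z k) * \<alpha> z k') = (\<Sum>i\<in>IA. cnj (\<kappa> k i) * \<kappa> k' i)" for k k'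
    using gram_orthonormal_split[OF I(1) v, of m "\<kappa> k" "\<kappa> k'"] by (simp add: sumJ \<alpha>_def ca_def)
  have gramB: "(\<Sum>z\<in>J. cnj (\<beta> z l) * \<beta> z l') = (\<Sum>i\<in>IB. cnj (\<mu> l i) * \<mu> l' i)" for l l'
    using gram_orthonormal_split[OF I(2) u, of m "\<mu> l" "\<mu> l'"] by (simp add: sumJ \<beta>_def cb_def)
  have w: "(\<Sum>z\<in>J. \<alpha> z k * \<beta> z l) = w k l" for k l
    by (simp add: sumJ \<alpha>_def \<beta>_def w_def ca_def cb_def)
  have "complex_of_real (\<Sum>z\<in>J. (cmod (\<alpha> z k))\<^sup>2) = complex_of_real (\<Sum>i\<in>IA. (cmod (\<kappa> k i))\<^sup>2)" for k
    using gramA[of k k] by (simp add: complex_norm_square mult.commute del: of_real_power)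
  then have normA: "(\<Sum>z\<in>J. (cmod (\<alpha> z k))\<^sup>2) = (\<Sum>i\<in>IA. (cmod (\<kappa> k i))\<^sup>2)" for k
    by (simp only: of_real_eq_iff)
  have "complex_of_real (\<Sum>z\<in>J. (cmod (\<beta> z l))\<^sup>2) = complex_of_real (\<Sum>i\<in>IB. (cmod (\<mu> l i))\<^sup>2)" for l
    using gramB[of l l] by (simp add: complex_norm_square mult.commute del: of_real_power)
  then have normB: "(\<Sum>z\<in>J. (cmod (\<beta> z l))\<^sup>2) = (\<Sum>i\<in>IB. (cmod (\<mu> l i))\<^sup>2)" for l
    by (simp only: of_real_eq_iff)
  \<comment> \<open>The estimate sees its families only through their Gram matrices and their
    overlap, and these agree with those of the given vectors.\<close>
  show ?thesis
    using witness_product_bound[OF A B st, of \<alpha> \<beta> J] unfolding gramA gramB w normA normB .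
qed

text \<open>The matrix unit |p><q|. The values of a superoperator on these are the blocks of its
  Choi matrix.\<close>

definition unit_mat :: "nat \<Rightarrow> nat \<Rightarrow> nat \<Rightarrow> complex mat" where
  "unit_mat n p q = mat n n (\<lambda>(i, j). if i = p \<and> j = q then 1 else 0)"

lemma unit_mat_carrier [simp]: "unit_mat n p q \<in> carrier_mat n n"
  by (simp add: unit_mat_def)

lemma sum_unit_mat:
  assumes "p < n" "q < n"
  shows "(\<Sum>p'<n. \<Sum>q'<n. f p' * unit_mat n p q $$ (p', q') * g q') = f p * (g q :: complex)"
proof -
  have "(\<Sum>p'<n. \<Sum>q'<n. f p' * unit_mat n p q $$ (p', q') * g q') = (\<Sum>p'<n. \<Sum>q'<n. if q'
      = q then (if p' = p then f p' * g q' else 0) else 0)"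
    by (intro sum.cong refl) (auto simp: unit_mat_def)
  also have "\<dots> = f p * g q" using assms by simp
  finally show ?thesis .
qed

section \<open>Ancilla traces of Kraus maps with product Kraus operators\<close>

lemma obs_trace_index:
  assumes "OA \<in> carrier_mat rA rA" "OB \<in> carrier_mat rB rB" "i < a * b" "j < a * b"
  shows "obs_trace a b OA OB Y $$ (i, j) = tensor_form rA rB (\<lambda>k k'. OA $$ (k, k')) (\<lambda>l l'. OB $$
      (l, l'))
    (\<lambda>k k' l l'. Y $$ ((i div b * rA + k') * (b * rB) + (i mod b * rB + l'), (j div b * rA + k) * (b
        * rB) + (j mod b * rB + l)))"
  using assms by (simp add: obs_trace_def tensor_form_def Let_def)

lemma kron_index_pair:
  assumes "K \<in> carrier_mat a' a" "L \<in> carrier_mat b' b" "r < a'" "s < b'" "p < a * b"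
  shows "kron K L $$ (r * b' + s, p) = K $$ (r, p div b) * L $$ (s, p mod b)"
  using assms pair_index_less[of r a' s b'] by simp

lemma obs_trace_kraus_index:
  assumes O: "OA \<in> carrier_mat rA rA" "OB \<in> carrier_mat rB rB"
    and ops: "product_ops (a, b) (a * rA, b * rB) KLs" and \<rho>: "\<rho> \<in> carrier_mat (a * b) (a * b)"
    and ij: "i < a * b" "j < a * b"
  shows "obs_trace a b OA OB (kraus_apply ((a * rA) * (b * rB)) (map (case_prod kron) KLs) \<rho>) $$ (i,
      j) =
    (\<Sum>(K, L)\<leftarrow>KLs. tensor_form rA rB (\<lambda>k k'. OA $$ (k, k')) (\<lambda>l l'. OB $$ (l, l')) (\<lambda>k k' l l'.
      \<Sum>p<a * b. \<Sum>q<a * b. (K $$ (i div b * rA + k', p div b) * L $$ (i mod b * rB + l', p mod b))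
          * \<rho> $$ (p, q) *
        cnj (K $$ (j div b * rA + k, q div b) * L $$ (j mod b * rB + l, q mod b))))"
proof -
  note l = div_mod_less[OF ij(1)] div_mod_less[OF ij(2)]
  have sets: "set (map (case_prod kron) KLs) \<subseteq> carrier_mat ((a * rA) * (b * rB)) (a * b)"
    using product_ops_kron[OF ops] by simp
  have "obs_trace a b OA OB (kraus_apply ((a * rA) * (b * rB)) (map (case_prod kron) KLs) \<rho>) $$ (i, j) =
    tensor_form rA rB (\<lambda>k k'. OA $$ (k, k')) (\<lambda>l l'. OB $$ (l, l')) (\<lambda>k k' l l'. \<Sum>(K, L)\<leftarrow>KLs.
      \<Sum>p<a * b. \<Sum>q<a * b. (K $$ (i div b * rA + k', p div b) * L $$ (i mod b * rB + l', p mod b))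
          * \<rho> $$ (p, q) *
        cnj (K $$ (j div b * rA + k, q div b) * L $$ (j mod b * rB + l, q mod b)))"
    unfolding obs_trace_index[OF O ij]
  proof (rule tensor_form_cong)
    fix k k' l1 l' assume k: "k < rA" "k' < rA" "l1 < rB" "l' < rB"
    note r = pair_index_less[OF l(1) k(2)] pair_index_less[OF l(2) k(4)] pair_index_less[OF l(3)
        k(1)] pair_index_less[OF l(4) k(3)]
    show "kraus_apply ((a * rA) * (b * rB)) (map (case_prod kron) KLs) \<rho> $$
        ((i div b * rA + k') * (b * rB) + (i mod b * rB + l'), (j div b * rA + k) * (b * rB)
            + (j mod b * rB + l1)) =
      (\<Sum>(K, L)\<leftarrow>KLs.
      \<Sum>p<a * b. \<Sum>q<a * b. (K $$ (i div b * rA + k', p div b) * L $$ (i mod b * rB + l', p mod b))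
          * \<rho> $$ (p, q) *
        cnj (K $$ (j div b * rA + k, q div b) * L $$ (j mod b * rB + l1, q mod b)))"
      unfolding kraus_apply_index[OF sets \<rho> pair_index_less[OF r(1,2)] pair_index_less[OF r(3,4)]]
          map_map o_def
    proof (intro arg_cong[where f = sum_list] map_cong refl)
      fix x assume x: "x \<in> set KLs"
      obtain K L where KL: "x = (K, L)" by (cases x)
      with x ops have c: "K \<in> carrier_mat (a * rA) a" "L \<in> carrier_mat (b * rB) b"
          by (auto simp: product_ops_def)
      show "(\<Sum>p<a * b. \<Sum>q<a * b. case_prod kron x $$ ((i div b * rA + k') * (b * rB) + (i mod b * rB
          + l'), p) * \<rho> $$ (p, q) *
          cnj (case_prod kron x $$ ((j div b * rA + k) * (b * rB) + (j mod b * rB + l1), q))) =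
        (case x of (K, L) \<Rightarrow> \<Sum>p<a * b. \<Sum>q<a * b. (K $$ (i div b * rA + k', p div b) * L $$ (i mod b
            * rB + l', p mod b)) * \<rho> $$ (p, q) *
        cnj (K $$ (j div b * rA + k, q div b) * L $$ (j mod b * rB + l1, q mod b)))"
        unfolding KL prod.case
        by (intro sum.cong refl) (simp only: lessThan_iff kron_index_pair[OF c r(1,2)]
            kron_index_pair[OF c r(3,4)])
    qed
  qed
  then show ?thesis by (simp add: tensor_form_sum_list split_def)
qed

text \<open>The value of the witness \<open>2|\<Psi>\<rangle>\<langle>\<Psi>| - 1\<close> on the Choi matrix with entries \<^term>\<open>f p q i j\<close>.\<close>
definition choi_witness :: "nat \<Rightarrow> (nat \<Rightarrow> nat \<Rightarrow> complex) \<Rightarrow> (nat \<Rightarrow> nat \<Rightarrow> nat \<Rightarrow> nat \<Rightarrow> complex) \<Rightarrow>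
    complex" where
  "choi_witness n \<Psi> f = (\<Sum>(p, q, i, j)\<in>{..<n} \<times> {..<n} \<times> {..<n} \<times> {..<n}.
     (2 * (cnj (\<Psi> i p) * \<Psi> j q) - (if p = q \<and> i = j then 1 else 0)) * f p q i j)"

lemma choi_witness_cong:
  assumes "\<And>p q i j. p < n \<Longrightarrow> q < n \<Longrightarrow> i < n \<Longrightarrow> j < n \<Longrightarrow> f p q i j = g p q i j"
  shows "choi_witness n \<Psi> f = choi_witness n \<Psi> g"
  unfolding choi_witness_def using assms by (intro sum.cong refl) auto

lemma choi_witness_scale: "choi_witness n \<Psi> (\<lambda>p q i j. c * f p q i j) = c * choi_witness n \<Psi> f"
  by (simp add: choi_witness_def sum_distrib_left split_def mult_ac)

lemma choi_witness_sum: "choi_witness n \<Psi> (\<lambda>p q i j. \<Sum>t\<in>T. f t p q i j)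
    = (\<Sum>t\<in>T. choi_witness n \<Psi> (f t))"
  unfolding choi_witness_def by (subst sum.swap) (simp add: sum_distrib_left split_def)

lemma choi_witness_sum_list: "choi_witness n \<Psi> (\<lambda>p q i j. \<Sum>t\<leftarrow>ts. f t p q i j)
    = (\<Sum>t\<leftarrow>ts. choi_witness n \<Psi> (f t))"
  unfolding choi_witness_def by (simp add: sum_sum_list_swap[symmetric] sum_list_const_mult split_def)

lemma choi_witness_tensor_form:
  "choi_witness n \<Psi> (\<lambda>p q i j. tensor_form rA rB A B (f p q i j)) =
   tensor_form rA rB A B (\<lambda>k k' l l'. choi_witness n \<Psi> (\<lambda>p q i j. f p q i j k k' l l'))"
  unfolding choi_witness_def split_def tensor_form_sum tensor_form_scale ..

text \<open>\<open>U\<close> and each Kraus pair contribute Choi matrices of this form. For a Kraus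
  pair X and Y may differ, as they carry the ancilla labels of the two sides of the
  observable.\<close>

lemma choi_witness_rank_one:
  "choi_witness n \<Psi> (\<lambda>p q i j. X i p * cnj (Y j q)) =
   2 * ((\<Sum>i<n. \<Sum>p<n. cnj (\<Psi> i p) * X i p) * cnj (\<Sum>i<n. \<Sum>p<n. cnj (\<Psi> i p) * Y i p))
       - (\<Sum>i<n. \<Sum>p<n. X i p * cnj (Y i p))"
proof -
  have "choi_witness n \<Psi> (\<lambda>p q i j. X i p * cnj (Y j q)) =
    (\<Sum>(i, p, j, q)\<in>{..<n} \<times> {..<n} \<times> {..<n} \<times> {..<n}. (2 * (cnj (\<Psi> i p) * \<Psi> j q) - (if p = q \<and> i
        = j then 1 else 0)) * (X i p * cnj (Y j q)))"
    unfolding choi_witness_def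
    by (rule sum.reindex_bij_witness[where i = "\<lambda>(i, p, j, q). (p, q, i, j)" and j
        = "\<lambda>(p, q, i, j). (i, p, j, q)"]) auto
  also have "\<dots> = (\<Sum>i<n. \<Sum>p<n. \<Sum>j<n. \<Sum>q<n. 2 * ((cnj (\<Psi> i p) * X i p) * cnj (cnj (\<Psi> j q) * Y j q)) -
      (if q = p then (if j = i then X i p * cnj (Y j q) else 0) else 0))"
    unfolding sum.cartesian_product by (intro sum.cong refl) (auto simp: algebra_simps)
  also have "\<dots> = 2 * (\<Sum>i<n. \<Sum>p<n. \<Sum>j<n. \<Sum>q<n. (cnj (\<Psi> i p) * X i p) * cnj (cnj (\<Psi> j q) * Y j q))
      - (\<Sum>i<n. \<Sum>p<n. X i p * cnj (Y i p))"
    by (simp add: sum_subtractf sum_distrib_left)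
  also have "(\<Sum>i<n. \<Sum>p<n. \<Sum>j<n. \<Sum>q<n. (cnj (\<Psi> i p) * X i p) * cnj (cnj (\<Psi> j q) * Y j q)) =
      (\<Sum>i<n. \<Sum>p<n. cnj (\<Psi> i p) * X i p) * cnj (\<Sum>i<n. \<Sum>p<n. cnj (\<Psi> i p) * Y i p)"
    by (simp only: cnj_sum sum_distrib_left[symmetric] sum_distrib_right[symmetric])
  finally show ?thesis .
qed

text \<open>Output and input indices are regrouped by party: (x, x') belongs to the first and (y,
  y') to the second. Across this cut of the Choi space K \<otimes> L is a product vector.\<close>

lemma sum_pair_index2:
  "(\<Sum>i<a * b. \<Sum>p<a * b. f (i div b) (i mod b) (p div b) (p mod b))
      = (\<Sum>(x, x')\<in>{..<a} \<times> {..<a}. \<Sum>(y, y')\<in>{..<b} \<times> {..<b}. f x y x' y')"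
  for a b :: nat
proof -
  have "(\<Sum>i<a * b. \<Sum>p<a * b. f (i div b) (i mod b) (p div b) (p mod b)) = (\<Sum>i<a
      * b. \<Sum>x'<a. \<Sum>y'<b. f (i div b) (i mod b) x' y')"
    by (intro sum.cong refl sum_pair_index)
  also have "\<dots> = (\<Sum>x<a. \<Sum>y<b. \<Sum>x'<a. \<Sum>y'<b. f x y x' y')"
    by (rule sum_pair_index)
  also have "\<dots> = (\<Sum>x<a. \<Sum>x'<a. \<Sum>y<b. \<Sum>y'<b. f x y x' y')"
    by (intro sum.cong refl sum.swap)
  finally show ?thesis by (simp add: sum.cartesian_product[symmetric])
qed

lemma sum_product_pair_index2:
  "(\<Sum>i<a * b. \<Sum>p<a * b. f (i div b) (p div b) * g (i mod b) (p mod b)) =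
   (\<Sum>(x, x')\<in>{..<a} \<times> {..<a}. f x x') * (\<Sum>(y, y')\<in>{..<b} \<times> {..<b}. g y y')"
  for a b :: nat and f g :: "nat \<Rightarrow> nat \<Rightarrow> complex"
  using sum_pair_index2[of "\<lambda>x y x' y'. f x x' * g y y'" b a] by (simp add: sum_product split_def)

section \<open>Lower bound on the norm of a cut\<close>

lemma sum_rotate: "(\<Sum>i\<in>A. \<Sum>p\<in>B. \<Sum>j\<in>J. f i p j) = (\<Sum>j\<in>J. \<Sum>i\<in>A. \<Sum>p\<in>B. f i p j)"
  by (subst sum.swap[of _ J B]) (rule sum.swap)

text \<open>Entry (i, p) of the sum of all V_j \<otimes> W_j, that is, of the Schmidt decomposition
  with every coefficient replaced by 1, read as a vector in the output index i and the input index
  p.\<close>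

definition schmidt_sum :: "nat \<Rightarrow> nat \<Rightarrow> (nat \<Rightarrow> complex mat) \<Rightarrow> (nat \<Rightarrow> complex mat) \<Rightarrow> nat \<Rightarrow> nat \<Rightarrow>
    complex" where
  "schmidt_sum b m V W i p = (\<Sum>j<m. V j $$ (i div b, p div b) * W j $$ (i mod b, p mod b))"

definition orthogonal_ops :: "nat \<Rightarrow> nat \<Rightarrow> (nat \<Rightarrow> complex mat) \<Rightarrow> bool" where
  "orthogonal_ops a m V \<longleftrightarrow> (\<forall>j<m. \<forall>k<m.
     (\<Sum>(x, x')\<in>{..<a} \<times> {..<a}. cnj (V j $$ (x, x')) * V k $$ (x, x')) = (if j
         = k then of_nat a else 0))"

lemma orthogonal_opsI:
  assumes "\<And>j. j < m \<Longrightarrow> V j \<in> carrier_mat a a"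
    and "\<And>j k. j < m \<Longrightarrow> k < m \<Longrightarrow> trace_c (adj (V j) * V k) = (if j = k then of_nat a else 0)"
  shows "orthogonal_ops a m V"
  unfolding orthogonal_ops_def
proof (intro allI impI)
  fix j k assume jk: "j < m" "k < m"
  have "trace_c (adj (V j) * V k) = (\<Sum>x'<a. \<Sum>x<a. cnj (V j $$ (x, x')) * V k $$ (x, x'))"
    using assms(1)[OF jk(1)] assms(1)[OF jk(2)]
    by (simp add: trace_c_def index_mult_mat_sum[where n = a] del: index_mult_mat(1))
  also have "\<dots> = (\<Sum>(x, x')\<in>{..<a} \<times> {..<a}. cnj (V j $$ (x, x')) * V k $$ (x, x'))"
    by (subst sum.swap) (simp add: sum.cartesian_product)
  finally show "(\<Sum>(x, x')\<in>{..<a} \<times> {..<a}. cnj (V j $$ (x, x')) * V k $$ (x, x')) = (if j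
      = k then of_nat a else 0)"
    using assms(2)[OF jk] by simp
qed

lemma schmidt_sum_overlap:
  "(\<Sum>i<a * b. \<Sum>p<a * b. cnj (schmidt_sum b m V W i p) * (f (i div b) (p div b)
      * g (i mod b) (p mod b))) =
    (\<Sum>j<m. (\<Sum>(x, x')\<in>{..<a} \<times> {..<a}. cnj (V j $$ (x, x')) * f x x') *
      (\<Sum>(y, y')\<in>{..<b} \<times> {..<b}. cnj (W j $$ (y, y')) * g y y'))"
proof -
  have "(\<Sum>i<a * b. \<Sum>p<a * b. cnj (schmidt_sum b m V W i p) * (f (i div b) (p div b)
      * g (i mod b) (p mod b))) =
    (\<Sum>i<a * b. \<Sum>p<a * b. \<Sum>j<m. (cnj (V j $$ (i div b, p div b)) * f (i div b) (p div b)) *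
       (cnj (W j $$ (i mod b, p mod b)) * g (i mod b) (p mod b)))"
    by (simp add: schmidt_sum_def sum_distrib_left sum_distrib_right mult_ac)
  also have "\<dots> = (\<Sum>j<m. \<Sum>i<a * b. \<Sum>p<a * b. (cnj (V j $$ (i div b, p div b)) * f (i div b) (p div b)) *
       (cnj (W j $$ (i mod b, p mod b)) * g (i mod b) (p mod b)))"
    by (rule sum_rotate)
  also have "\<dots> = (\<Sum>j<m. (\<Sum>(x, x')\<in>{..<a} \<times> {..<a}. cnj (V j $$ (x, x')) * f x x') *
      (\<Sum>(y, y')\<in>{..<b} \<times> {..<b}. cnj (W j $$ (y, y')) * g y y'))"
    by (intro sum.cong refl sum_product_pair_index2)
  finally show ?thesis .
qed

text \<open>The vector \<open>\<Psi> = \<Sum>\<^sub>j |V\<^sub>j\<rangle>\<rangle>|W\<^sub>j\<rangle>\<rangle>\<close>, normalised so that its Schmidt coefficients are 1.\<close>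
definition schmidt_vector :: "nat \<Rightarrow> nat \<Rightarrow> nat \<Rightarrow> (nat \<Rightarrow> complex mat) \<Rightarrow> (nat \<Rightarrow> complex mat) \<Rightarrow> nat \<Rightarrow>
    nat \<Rightarrow> complex" where
  "schmidt_vector a b m V W i p = schmidt_sum b m V W i p / complex_of_real (sqrt (real (a * b)))"

lemma choi_witness_schmidt:
  assumes "0 < a" "0 < b" 
  shows "choi_witness (a * b) (schmidt_vector a b m V W) (\<lambda>p q i j. X i p * cnj (Y j q)) =
    2 / of_nat (a * b) * ((\<Sum>i<a * b. \<Sum>p<a * b. cnj (schmidt_sum b m V W i p) * X i p) *
      cnj (\<Sum>i<a * b. \<Sum>p<a * b. cnj (schmidt_sum b m V W i p) * Y i p)) - (\<Sum>i<a * b. \<Sum>p<a * b. X i p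
          * cnj (Y i p))"
proof -
  let ?s = "complex_of_real (sqrt (real (a * b)))"
  have s: "?s * ?s = of_nat (a * b)"
    by (metis of_real_mult of_real_of_nat_eq of_nat_0_le_iff real_sqrt_mult_self abs_of_nonneg)
  have scaled: "(\<Sum>i<a * b. \<Sum>p<a * b. cnj (schmidt_vector a b m V W i p) * Z i p) =
      (\<Sum>i<a * b. \<Sum>p<a * b. cnj (schmidt_sum b m V W i p) * Z i p) / ?s" for Z
    by (simp add: schmidt_vector_def sum_divide_distrib)
  show ?thesis
    unfolding choi_witness_rank_one scaled s[symmetric] by simp
qed

text \<open>After regrouping by party this is \<open>witness_orthonormal_bound\<close> with the
  normalised Schmidt operators as orthonormal families. Normalising them extracts sqrt a * sqrt b
  from the overlap, which cancels the denominator of \<open>schmidt_vector\<close>.\<close>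

lemma choi_witness_product_kraus_bound:
  assumes a: "0 < a" and b: "0 < b"
    and O: "OA \<in> carrier_mat rA rA" "OB \<in> carrier_mat rB rB" "op_norm (kron OA OB) \<le> 1"
    and V: "orthogonal_ops a m V" and W: "orthogonal_ops b m W"
  shows "cmod (tensor_form rA rB (\<lambda>k k'. OA $$ (k, k')) (\<lambda>l l'. OB $$ (l, l')) (\<lambda>k k' l l'.
      choi_witness (a * b) (schmidt_vector a b m V W) (\<lambda>p q i j.
        (K $$ (i div b * rA + k', p div b) * L $$ (i mod b * rB + l', p mod b)) *
        cnj (K $$ (j div b * rA + k, q div b) * L $$ (j mod b * rB + l, q mod b)))))
    \<le> (\<Sum>r<a * rA. \<Sum>p<a. (cmod (K $$ (r, p)))\<^sup>2) * (\<Sum>r<b * rB. \<Sum>p<b. (cmod (L $$ (r, p)))\<^sup>2)"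
proof -
  let ?IA = "{..<a} \<times> {..<a}" and ?IB = "{..<b} \<times> {..<b}"
  \<comment> \<open>For a fixed ancilla label k the rows x * rA + k of \<open>K\<close> form an a by
    a operator. These blocks are the vectors of the family on the first party; \<open>\<mu>\<close>
    does the same for the second.\<close>
  define \<kappa> where "\<kappa> k = (\<lambda>(x, x'). K $$ (x * rA + k, x'))" for k
  define \<mu> where "\<mu> l = (\<lambda>(y, y'). L $$ (y * rB + l, y'))" for l
  define v where "v j = (\<lambda>z. V j $$ z / complex_of_real (sqrt (real a)))" for j
  define u where "u j = (\<lambda>z. W j $$ z / complex_of_real (sqrt (real b)))" for j
  have sqrt_mult: "complex_of_real (sqrt (real n)) * complex_of_real (sqrt (real n)) = of_nat n" for n
    by (metis of_real_mult of_real_of_nat_eq of_nat_0_le_iff real_sqrt_mult_self abs_of_nonneg)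
  have v_on: "(\<Sum>i\<in>?IA. cnj (v j i) * v k i) = (if j = k then 1 else 0)" if "j < m" "k < m" for j k
  proof -
    have "(\<Sum>i\<in>?IA. cnj (v j i) * v k i) = (\<Sum>(x, x')\<in>?IA. cnj (V j $$ (x, x'))
        * V k $$ (x, x')) / of_nat a"
      by (simp add: v_def sum_divide_distrib split_def sqrt_mult)
    then show ?thesis using V that a by (simp add: orthogonal_ops_def)
  qed
  have u_on: "(\<Sum>i\<in>?IB. cnj (u j i) * u k i) = (if j = k then 1 else 0)" if "j < m" "k < m" for j k
  proof -
    have "(\<Sum>i\<in>?IB. cnj (u j i) * u k i) = (\<Sum>(x, x')\<in>?IB. cnj (W j $$ (x, x'))
        * W k $$ (x, x')) / of_nat b"
      by (simp add: u_def sum_divide_distrib split_def sqrt_mult)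
    then show ?thesis using W that b by (simp add: orthogonal_ops_def)
  qed
  define w where "w k l = (\<Sum>j<m. (\<Sum>i\<in>?IA. cnj (v j i) * \<kappa> k i) * (\<Sum>i\<in>?IB. cnj (u j i) * \<mu> l i))" for k l
  have overlap: "(\<Sum>i<a * b. \<Sum>p<a * b. cnj (schmidt_sum b m V W i p) * (K $$ (i div b * rA
      + k, p div b) * L $$ (i mod b * rB + l, p mod b))) =
      complex_of_real (sqrt (real a)) * complex_of_real (sqrt (real b)) * w k l" for k l
  proof -
    let ?fV = "\<lambda>j. \<Sum>(x, x')\<in>?IA. cnj (V j $$ (x, x')) * K $$ (x * rA + k, x')"
    let ?fW = "\<lambda>j. \<Sum>(y, y')\<in>?IB. cnj (W j $$ (y, y')) * L $$ (y * rB + l, y')"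
    have "(\<Sum>i\<in>?IA. cnj (v j i) * \<kappa> k i) = ?fV j / complex_of_real (sqrt (real a))"
      "(\<Sum>i\<in>?IB. cnj (u j i) * \<mu> l i) = ?fW j / complex_of_real (sqrt (real b))" for j
      by (simp_all add: v_def u_def \<kappa>_def \<mu>_def split_def sum_divide_distrib)
    then have factor: "?fV j * ?fW j = complex_of_real (sqrt (real a))
        * complex_of_real (sqrt (real b)) *
        ((\<Sum>i\<in>?IA. cnj (v j i) * \<kappa> k i) * (\<Sum>i\<in>?IB. cnj (u j i) * \<mu> l i))" for j
      using a b by simp
    show ?thesis
      unfolding schmidt_sum_overlap[where f = "\<lambda>x x'. K $$ (x * rA + k, x')" and g = "\<lambda>y y'. L $$ (y
          * rB + l, y')"]
        factor w_def by (rule sum_distrib_left[symmetric])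
  qed
  have inner: "(\<Sum>i<a * b. \<Sum>p<a * b. (K $$ (i div b * rA + k', p div b) * L $$ (i mod b * rB
      + l', p mod b)) *
      cnj (K $$ (i div b * rA + k, p div b) * L $$ (i mod b * rB + l, p mod b))) =
      (\<Sum>i\<in>?IA. cnj (\<kappa> k i) * \<kappa> k' i) * (\<Sum>i\<in>?IB. cnj (\<mu> l i) * \<mu> l' i)" for k k' l l'
    using sum_product_pair_index2[of "\<lambda>x x'. cnj (K $$ (x * rA + k, x')) * K $$ (x * rA + k', x')" b
      "\<lambda>y y'. cnj (L $$ (y * rB + l, y')) * L $$ (y * rB + l', y')" a]
    by (simp add: \<kappa>_def \<mu>_def split_def mult_ac)
  have witness_eq: "choi_witness (a * b) (schmidt_vector a b m V W) (\<lambda>p q i j.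
        (K $$ (i div b * rA + k', p div b) * L $$ (i mod b * rB + l', p mod b)) *
        cnj (K $$ (j div b * rA + k, q div b) * L $$ (j mod b * rB + l, q mod b))) =
      2 * (cnj (w k l) * w k' l') - (\<Sum>i\<in>?IA. cnj (\<kappa> k i) * \<kappa> k' i) * (\<Sum>i\<in>?IB. cnj (\<mu> l i) * \<mu> l' i)"
          for k k' l l'
  proof -
    have "(complex_of_real (sqrt (real a)) * complex_of_real (sqrt (real b)) * w k' l') *
        cnj (complex_of_real (sqrt (real a)) * complex_of_real (sqrt (real b)) * w k l) =
      (complex_of_real (sqrt (real a)) * complex_of_real (sqrt (real a)))
          * (complex_of_real (sqrt (real b)) * complex_of_real (sqrt (real b))) * (cnj (w k l)
          * w k' l')"
      by (simp add: mult_ac)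
    then have scaled: "(complex_of_real (sqrt (real a)) * complex_of_real (sqrt (real b)) * w k' l') *
        cnj (complex_of_real (sqrt (real a)) * complex_of_real (sqrt (real b)) * w k l) = of_nat (a
            * b) * (cnj (w k l) * w k' l')"
      unfolding sqrt_mult by simp
    show ?thesis
      using a b unfolding choi_witness_schmidt[OF a b] overlap inner scaled by simp
  qed
  \<comment> \<open>The blocks partition the rows, so their squared norms add up to the squared
    Frobenius norm of the whole Kraus factor.\<close>
  have norm: "(\<Sum>k<r. \<Sum>i\<in>{..<n} \<times> {..<n}. (cmod (case i of (x, x') \<Rightarrow> M $$ (x * r + k, x')))\<^sup>2)
      = (\<Sum>s<n * r. \<Sum>p<n. (cmod (M $$ (s, p)))\<^sup>2)"
    for r n and M :: "complex mat"
  proof -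
    have "(\<Sum>s<n * r. \<Sum>p<n. (cmod (M $$ (s, p)))\<^sup>2) = (\<Sum>s<n * r. \<Sum>p<n. (cmod (M $$ (s div r * r
        + s mod r, p)))\<^sup>2)"
      by simp
    also have "\<dots> = (\<Sum>x<n. \<Sum>k<r. \<Sum>p<n. (cmod (M $$ (x * r + k, p)))\<^sup>2)"
      by (rule sum_pair_index)
    also have "\<dots> = (\<Sum>k<r. \<Sum>x<n. \<Sum>p<n. (cmod (M $$ (x * r + k, p)))\<^sup>2)"
      by (rule sum.swap)
    finally show ?thesis by (simp add: sum.cartesian_product split_def)
  qed
  show ?thesis
    using witness_orthonormal_bound[where IA = ?IA and IB = ?IB and m = m and v = v and u = u and \<kappa>
        = \<kappa> and \<mu> = \<mu>,
      OF bounded_form_op_norm[OF O(1)] bounded_form_op_norm[OF O(2)]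
      order_trans[OF op_norm_kron_ge O(3)]] v_on u_on
    unfolding witness_eq w_def[symmetric] by (simp add: \<kappa>_def \<mu>_def norm)
qed

text \<open>The Kraus expansion turns the Choi matrix into a sum over product Kraus pairs. Each is
  bounded by its weight, and the weights of an LOCC channel total \<open>a * b\<close>.\<close>

lemma choi_witness_cut_term_bound:
  assumes a: "0 < a" and b: "0 < b"
    and O: "OA \<in> carrier_mat rA rA" "OB \<in> carrier_mat rB rB" "op_norm (kron OA OB) \<le> 1"
    and V: "orthogonal_ops a m V" and W: "orthogonal_ops b m W"
    and E: "LOCC_channel (a, b) (a * rA, b * rB) E"
  shows "cmod (choi_witness (a * b) (schmidt_vector a b m V W)
      (\<lambda>p q i j. obs_trace a b OA OB (E (unit_mat (a * b) p q)) $$ (i, j))) \<le> real (a * b)"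
proof -
  obtain KLs where ops: "product_ops (a, b) (a * rA, b * rB) KLs"
    and Kraus: "\<And>\<rho>. \<rho> \<in> carrier_mat (a * b) (a * b) \<Longrightarrow> E \<rho> = kraus_apply ((a * rA) * (b
        * rB)) (map (case_prod kron) KLs) \<rho>"
    and norm: "(\<Sum>(K, L)\<leftarrow>KLs. (\<Sum>r<a * rA. \<Sum>p<a. (cmod (K $$ (r, p)))\<^sup>2) * (\<Sum>r<b
        * rB. \<Sum>p<b. (cmod (L $$ (r, p)))\<^sup>2)) = real (a * b)"
    using LOCC_channel_separable[OF E] by blast
  let ?T = "tensor_form rA rB (\<lambda>k k'. OA $$ (k, k')) (\<lambda>l l'. OB $$ (l, l'))"
  let ?w = "choi_witness (a * b) (schmidt_vector a b m V W)"
  let ?f = "\<lambda>K L k k' l l' p q i j. (K $$ (i div b * rA + k', p div b) * L $$ (i mod b * rB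
      + l', p mod b)) *
        cnj (K $$ (j div b * rA + k, q div b) * L $$ (j mod b * rB + l, q mod b) :: complex)"
  have "?w (\<lambda>p q i j. obs_trace a b OA OB (E (unit_mat (a * b) p q)) $$ (i, j)) =
    ?w (\<lambda>p q i j. \<Sum>(K, L)\<leftarrow>KLs. ?T (\<lambda>k k' l l'. ?f K L k k' l l' p q i j))"
  proof (rule choi_witness_cong)
    fix p q i j assume pq: "p < a * b" "q < a * b" and ij: "i < a * b" "j < a * b"
    show "obs_trace a b OA OB (E (unit_mat (a * b) p q)) $$ (i, j)
        = (\<Sum>(K, L)\<leftarrow>KLs. ?T (\<lambda>k k' l l'. ?f K L k k' l l' p q i j))"
      unfolding Kraus[OF unit_mat_carrier] obs_trace_kraus_index[OF O(1,2) ops unit_mat_carrier ij]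
          sum_unit_mat[OF pq] ..
  qed
  also have "\<dots> = (\<Sum>(K, L)\<leftarrow>KLs. ?T (\<lambda>k k' l l'. ?w (?f K L k k' l l')))"
    unfolding split_def choi_witness_sum_list choi_witness_tensor_form ..
  finally have expand: "?w (\<lambda>p q i j. obs_trace a b OA OB (E (unit_mat (a * b) p q)) $$ (i, j)) =
    (\<Sum>(K, L)\<leftarrow>KLs. ?T (\<lambda>k k' l l'. ?w (?f K L k k' l l')))" .
  have "cmod (\<Sum>(K, L)\<leftarrow>KLs. ?T (\<lambda>k k' l l'. ?w (?f K L k k' l l')))
      \<le> (\<Sum>(K, L)\<leftarrow>KLs. cmod (?T (\<lambda>k k' l l'. ?w (?f K L k k' l l'))))"
  proof -
    have "cmod (\<Sum>x\<leftarrow>xs. h x) \<le> (\<Sum>x\<leftarrow>xs. cmod (h x))" for h :: "complex mat \<times> complex mat \<Rightarrow> complex" and xs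
      by (induction xs) (auto intro: order_trans[OF norm_triangle_ineq])
    then show ?thesis unfolding split_def .
  qed
  also have "\<dots> \<le> (\<Sum>(K, L)\<leftarrow>KLs. (\<Sum>r<a * rA. \<Sum>p<a. (cmod (K $$ (r, p)))\<^sup>2) * (\<Sum>r<b
      * rB. \<Sum>p<b. (cmod (L $$ (r, p)))\<^sup>2))"
    unfolding split_def
    by (rule sum_list_mono) (rule choi_witness_product_kraus_bound[OF a b O V W, where K
        = "fst x" and L = "snd x" for x])
  finally show ?thesis by (simp only: norm expand)
qed

text \<open>Both sides of the cut equation are put into the witness. On \<open>U\<close>,
  orthogonality removes the mixed terms, so the overlap with \<open>schmidt_sum\<close> is a * b *
  S; unitarity makes the squared Frobenius norm a * b. The value is therefore a * b * (2 S^2 - 1),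
  to be compared with at most a * b times the norm of the cut.\<close>

lemma cut_norm_ge_schmidt:
  assumes a: "0 < a" and b: "0 < b" and U: "unitary_mat (a * b) U"
    and sd: "op_schmidt a b U m c V W" and cut: "space_like_cut a b (\<lambda>\<rho>. U * \<rho> * adj U) rA rB C"
  shows "2 * (\<Sum>j<m. \<bar>c j\<bar>)\<^sup>2 - 1 \<le> cut_norm C"
proof -
  let ?w = "choi_witness (a * b) (schmidt_vector a b m V W)"
  define S where "S = (\<Sum>j<m. \<bar>c j\<bar>)"
  have U_carrier: "U \<in> carrier_mat (a * b) (a * b)" and UU: "adj U * U = 1\<^sub>m (a * b)"
    using U by (auto simp: unitary_mat_def)
  have carr: "\<And>j. j < m \<Longrightarrow> V j \<in> carrier_mat a a" "\<And>j. j < m \<Longrightarrow> W j \<in> carrier_mat b b"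
    and pos: "\<And>j. j < m \<Longrightarrow> 0 < c j"
    and Ueq: "U = msum (a * b) m (\<lambda>j. complex_of_real (c j) \<cdot>\<^sub>m kron (V j) (W j))"
    using sd by (auto simp: op_schmidt_def)
  have S: "S = (\<Sum>j<m. c j)"
    unfolding S_def using pos by (intro sum.cong refl abs_of_pos) simp
  have V: "orthogonal_ops a m V" and W: "orthogonal_ops b m W"
    using sd by (auto simp: op_schmidt_def intro!: orthogonal_opsI)
  have U_index: "U $$ (i, p) = (\<Sum>k<m. (of_real (c k) * V k $$ (i div b, p div b))
      * W k $$ (i mod b, p mod b))"
    if "i < a * b" "p < a * b" for i p
  proof -
    have "U $$ (i, p) = (\<Sum>k<m. (complex_of_real (c k) \<cdot>\<^sub>m kron (V k) (W k)) $$ (i, p))"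
      unfolding Ueq using that by simp
    also have "\<dots> = (\<Sum>k<m. (of_real (c k) * V k $$ (i div b, p div b)) * W k $$ (i mod b, p mod b))"
    proof (intro sum.cong refl)
      fix k assume "k \<in> {..<m}"
      then have "V k \<in> carrier_mat a a" "W k \<in> carrier_mat b b" using carr by auto
      then show "(complex_of_real (c k) \<cdot>\<^sub>m kron (V k) (W k)) $$ (i, p) = (of_real (c k)
          * V k $$ (i div b, p div b)) * W k $$ (i mod b, p mod b)"
        using that by simp
    qed
    finally show ?thesis .
  qed
  have "(\<Sum>i<a * b. \<Sum>p<a * b. cnj (schmidt_sum b m V W i p) * U $$ (i, p)) =
      (\<Sum>i<a * b. \<Sum>p<a * b. \<Sum>k<m. cnj (schmidt_sum b m V W i p) * ((of_real (c k)
          * V k $$ (i div b, p div b)) * W k $$ (i mod b, p mod b)))"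
    by (intro sum.cong refl) (simp add: U_index sum_distrib_left)
  also have "\<dots> = (\<Sum>k<m. \<Sum>i<a * b. \<Sum>p<a * b. cnj (schmidt_sum b m V W i p) * ((of_real (c k)
      * V k $$ (i div b, p div b)) * W k $$ (i mod b, p mod b)))"
    by (rule sum_rotate)
  also have "\<dots> = (\<Sum>k<m. \<Sum>j<m. (\<Sum>(x, x')\<in>{..<a} \<times> {..<a}. cnj (V j $$ (x, x')) * (of_real (c k)
      * V k $$ (x, x'))) *
      (\<Sum>(y, y')\<in>{..<b} \<times> {..<b}. cnj (W j $$ (y, y')) * W k $$ (y, y')))"
    by (intro sum.cong refl schmidt_sum_overlap)
  also have "\<dots> = (\<Sum>k<m. \<Sum>j<m. if j = k then of_real (c k) * of_nat (a * b) else 0)"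
  proof (intro sum.cong refl)
    fix k j assume "k \<in> {..<m}" "j \<in> {..<m}"
    then have jk: "j < m" "k < m" by auto
    have "(\<Sum>(x, x')\<in>{..<a} \<times> {..<a}. cnj (V j $$ (x, x')) * (of_real (c k) * V k $$ (x, x'))) =
        of_real (c k) * (\<Sum>(x, x')\<in>{..<a} \<times> {..<a}. cnj (V j $$ (x, x')) * V k $$ (x, x'))"
      by (simp add: sum_distrib_left split_def mult_ac)
    then show "(\<Sum>(x, x')\<in>{..<a} \<times> {..<a}. cnj (V j $$ (x, x')) * (of_real (c k) * V k $$ (x, x'))) *
      (\<Sum>(y, y')\<in>{..<b} \<times> {..<b}. cnj (W j $$ (y, y')) * W k $$ (y, y')) = (if j
          = k then of_real (c k) * of_nat (a * b) else 0)"
      using V W jk by (simp add: orthogonal_ops_def)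
  qed
  also have "\<dots> = of_nat (a * b) * of_real S"
    by (simp add: S sum_distrib_left mult_ac)
  finally have overlap: "(\<Sum>i<a * b. \<Sum>p<a * b. cnj (schmidt_sum b m V W i p) * U $$ (i, p))
      = of_nat (a * b) * of_real S" .
  have "(\<Sum>i<a * b. \<Sum>p<a * b. U $$ (i, p) * cnj (U $$ (i, p))) = trace_c (adj U * U)"
    using U_carrier by (subst sum.swap) (simp add: trace_c_def index_mult_mat_sum[where n = "a
        * b"] mult_ac del: index_mult_mat(1))
  also have "\<dots> = of_nat (a * b)" by (simp add: UU trace_c_def)
  finally have frob: "(\<Sum>i<a * b. \<Sum>p<a * b. U $$ (i, p) * cnj (U $$ (i, p))) = of_nat (a * b)" .
  have "?w (\<lambda>p q i j. U $$ (i, p) * cnj (U $$ (j, q))) = of_nat (a * b) * of_real (2 * S\<^sup>2 - 1)"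
    unfolding choi_witness_schmidt[OF a b] overlap frob using a b
    by (simp add: power2_eq_square algebra_simps)
  then have "real (a * b) * (2 * S\<^sup>2 - 1) \<le> cmod (?w (\<lambda>p q i j. U $$ (i, p) * cnj (U $$ (j, q))))"
    by (simp add: norm_mult del: of_nat_mult of_real_diff of_real_mult) (intro mult_left_mono; simp)
  \<comment> \<open>The cut equation enters here, applied to every matrix unit; the conjugation by
    \<open>U\<close> of |p><q| has entries U_ip times the conjugate of U_jq.\<close>
  also have "?w (\<lambda>p q i j. U $$ (i, p) * cnj (U $$ (j, q))) =
      ?w (\<lambda>p q i j. \<Sum>t<length C. case C ! t of (x, E, OA, OB) \<Rightarrow> of_real x
          * obs_trace a b OA OB (E (unit_mat (a * b) p q)) $$ (i, j))"
  proof (rule choi_witness_cong)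
    fix p q i j assume pq: "p < a * b" "q < a * b" and ij: "i < a * b" "j < a * b"
    have "U $$ (i, p) * cnj (U $$ (j, q)) = (U * unit_mat (a * b) p q * adj U) $$ (i, j)"
      unfolding sandwich_index[OF U_carrier unit_mat_carrier ij] sum_unit_mat[OF pq] ..
    also have "\<dots> = cut_apply a b C (unit_mat (a * b) p q) $$ (i, j)"
      using cut by (simp add: space_like_cut_def)
    also have "\<dots> = (\<Sum>t<length C. case C ! t of (x, E, OA, OB) \<Rightarrow> of_real x
        * obs_trace a b OA OB (E (unit_mat (a * b) p q)) $$ (i, j))"
      unfolding cut_apply_def using ij by (auto simp: obs_trace_def Let_def split: prod.splits
          intro!: sum.cong)
    finally show "U $$ (i, p) * cnj (U $$ (j, q)) = \<dots>" .
  qed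
  also have "\<dots> = (\<Sum>t<length C. case C ! t of (x, E, OA, OB) \<Rightarrow> of_real x
      * ?w (\<lambda>p q i j. obs_trace a b OA OB (E (unit_mat (a * b) p q)) $$ (i, j)))"
    by (simp only: choi_witness_sum split_def choi_witness_scale)
  also have "cmod \<dots> \<le> (\<Sum>t<length C. \<bar>fst (C ! t)\<bar> * real (a * b))"
  proof (rule order_trans[OF norm_sum sum_mono])
    fix t assume t: "t \<in> {..<length C}"
    obtain x E OA OB where Ct: "C ! t = (x, E, OA, OB)" by (cases "C ! t") auto
    have "(x, E, OA, OB) \<in> set C" using t nth_mem[of t C] by (simp add: Ct)
    then have "LOCC_channel (a, b) (a * rA, b * rB) E" "OA \<in> carrier_mat rA rA" "OB \<in> carrier_mat rB
        rB" "op_norm (kron OA OB) \<le> 1"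
      using cut by (auto simp: space_like_cut_def)
    from choi_witness_cut_term_bound[OF a b this(2-4) V W this(1)]
    show "cmod (case C ! t of (x, E, OA, OB) \<Rightarrow> of_real x * ?w (\<lambda>p q i j. obs_trace a b OA OB (E
        (unit_mat (a * b) p q)) $$ (i, j))) \<le> \<bar>fst (C ! t)\<bar> * real (a * b)"
      by (simp add: Ct norm_mult mult_left_mono del: of_nat_mult)
  qed
  also have "\<dots> = real (a * b) * cut_norm C" by (simp add: cut_norm_def sum_distrib_left mult_ac)
  finally show ?thesis using a b by (simp add: S_def)
qed

section \<open>The Hadamard test circuit\<close>

lemma lessThan_2: "{..<2::nat} = {0, 1}"
  by auto

lemma sqrt2_mult: "complex_of_real (sqrt 2) * complex_of_real (sqrt 2) = 2"
  by (metis of_real_mult of_real_numeral real_sqrt_mult_self abs_numeral)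

text \<open>The relative phase that S^g gives to the ancilla state |1>.\<close>

definition phase :: "nat \<Rightarrow> complex" where
  "phase g = (if g = 1 then \<i> else 1)"

lemma phase_unit: "phase g * cnj (phase g) = 1"
  by (simp add: phase_def)

lemma gate_carrier:
  "hadamard \<in> carrier_mat 2 2" "phase_S \<in> carrier_mat 2 2" "proj k \<in> carrier_mat 2 2" "ket0 \<in>
      carrier_mat 2 1" "sigma_z \<in> carrier_mat 2 2"
  by (auto simp: hadamard_def phase_S_def proj_def ket0_def sigma_z_def)

text \<open>The projector lets only the ancilla state l through. What remains is entry (k, l) of the
  last Hadamard gate, the diagonal entry of S^g, and the amplitude 1 / sqrt 2 left by the first
  Hadamard gate.\<close>

lemma hadamard_branch:
  assumes "k < 2" "l < 2"
  shows "(hadamard * proj l * (if g = 1 then phase_S else 1\<^sub>m 2) * hadamard * ket0) $$ (k, 0) =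
    (if l = 0 then 1 else phase g * (-1) ^ k) / 2"
proof -
  let ?S = "if g = 1 then phase_S else 1\<^sub>m 2"
  have S: "?S \<in> carrier_mat 2 2" by (simp add: gate_carrier)
  have S_index: "?S $$ (i, j) = (if i = j then (if i = 0 then 1 else phase g) else 0)"
      if "i < 2" "j < 2" for i j
    using that by (auto simp: phase_S_def phase_def less_2_cases_iff)
  have HP: "(hadamard * proj l) $$ (i, j) = (if j = l then hadamard $$ (i, l) else 0)"
      if "i < 2" "j < 2" for i j
  proof -
    have "(hadamard * proj l) $$ (i, j) = (\<Sum>r<2. hadamard $$ (i, r) * proj l $$ (r, j))"
      using that by (intro index_mult_mat_sum) (auto simp: hadamard_def proj_def)
    also have "\<dots> = (\<Sum>r<2. if r = l then (if j = l then hadamard $$ (i, l) else 0) else 0)"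
      using that by (intro sum.cong refl) (auto simp: proj_def)
    finally show ?thesis using assms by simp
  qed
  have HPS: "(hadamard * proj l * ?S) $$ (i, j) = (if j = l then hadamard $$ (i, l) * (if l
      = 0 then 1 else phase g) else 0)" if "i < 2" "j < 2" for i j
  proof -
    have "(hadamard * proj l * ?S) $$ (i, j) = (\<Sum>r<2. (hadamard * proj l) $$ (i, r) * ?S $$ (r, j))"
      using that S by (intro index_mult_mat_sum) (auto simp: hadamard_def proj_def)
    also have "\<dots> = (\<Sum>r<2. if r = l then (if j = l then hadamard $$ (i, l) * (if l
        = 0 then 1 else phase g) else 0) else 0)"
      using that by (intro sum.cong refl) (simp only: HP S_index lessThan_iff, auto)
    finally show ?thesis using assms by simp
  qed
  have Hk: "(hadamard * ket0) $$ (r, 0) = 1 / complex_of_real (sqrt 2)" if "r < 2" for r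
    using that by (subst index_mult_mat_sum[where n = 2]) (auto simp: hadamard_def ket0_def lessThan_2)
  have "hadamard * proj l * ?S * hadamard * ket0 = hadamard * proj l * ?S * (hadamard * ket0)"
    using S by (intro assoc_mult_mat[of _ 2 2 _ 2 _ 1]) (auto simp: hadamard_def proj_def ket0_def)
  also have "\<dots> $$ (k, 0) = (\<Sum>r<2. (hadamard * proj l * ?S) $$ (k, r) * (hadamard * ket0) $$ (r, 0))"
    using assms S by (intro index_mult_mat_sum) (auto simp: hadamard_def ket0_def)
  also have "\<dots> = (\<Sum>r<2. if r = l then hadamard $$ (k, l) * (if l
      = 0 then 1 else phase g) / complex_of_real (sqrt 2) else 0)"
    using assms by (intro sum.cong refl) (simp only: HPS Hk lessThan_iff, auto)
  also have "\<dots> = hadamard $$ (k, l) * (if l = 0 then 1 else phase g) / complex_of_real (sqrt 2)"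
    using assms by simp
  also have "\<dots> = (if l = 0 then 1 else phase g * (-1) ^ k) / 2"
  proof -
    have "hadamard $$ (k, l) = (if l = 0 then 1 else (-1) ^ k) / complex_of_real (sqrt 2)"
      using assms by (auto simp: hadamard_def less_2_cases_iff)
    then show ?thesis by (simp add: sqrt2_mult)
  qed
  finally show ?thesis .
qed

text \<open>Every gate except the controlled one acts on the ancilla alone. The mixed product rule
  pushes these gates into the ancilla factors of the two branches, leaving X and Y
  untouched.\<close>

lemma hadamard_iso_eq:
  assumes X: "X \<in> carrier_mat d d" and Y: "Y \<in> carrier_mat d d"
  shows "hadamard_iso d X Y g =
    kron X (hadamard * proj 0 * (if g = 1 then phase_S else 1\<^sub>m 2) * hadamard * ket0) +
    kron Y (hadamard * proj 1 * (if g = 1 then phase_S else 1\<^sub>m 2) * hadamard * ket0)"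
proof -
  let ?S = "if g = 1 then phase_S else 1\<^sub>m 2"
  have S: "?S \<in> carrier_mat 2 2" by (simp add: gate_carrier)
  note one = one_carrier_mat[of d]
  have step: "(kron X P + kron Y Q) * kron (1\<^sub>m d) G = kron X (P * G) + kron Y (Q * G)"
    if "P \<in> carrier_mat 2 2" "Q \<in> carrier_mat 2 2" "G \<in> carrier_mat 2 n" for P Q G n
    using that X Y kron_carrier[OF X that(1)] kron_carrier[OF Y that(2)] kron_carrier[OF one that(3)]
      kron_mult[OF X that(1) one that(3)] kron_mult[OF Y that(2) one that(3)]
    by (simp add: add_mult_distrib_mat)
  have start: "kron (1\<^sub>m d) hadamard * (kron X (proj 0) + kron Y (proj 1)) = kron X (hadamard
      * proj 0) + kron Y (hadamard * proj 1)"
    unfolding mult_add_distrib_mat[OF kron_carrier[OF one gate_carrier(1)] kron_carrier[OF X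
        gate_carrier(3)] kron_carrier[OF Y gate_carrier(3)]]
      kron_mult[OF one gate_carrier(1) X gate_carrier(3)] kron_mult[OF one gate_carrier(1) Y
          gate_carrier(3)]
    using X Y by simp
  have c: "hadamard * proj l \<in> carrier_mat 2 2" "hadamard * proj l * ?S \<in> carrier_mat 2 2" "hadamard
      * proj l * ?S * hadamard \<in> carrier_mat 2 2" for l
    using S gate_carrier by (auto intro!: mult_carrier_mat)
  show ?thesis
    unfolding hadamard_iso_def start step[OF c(1) c(1) S] step[OF c(2) c(2) gate_carrier(1)] step[OF
        c(3) c(3) gate_carrier(4)] ..
qed

lemma hadamard_iso_index:
  assumes X: "X \<in> carrier_mat d d" and Y: "Y \<in> carrier_mat d d" and "x < d" "k < 2" "p < d"
  shows "hadamard_iso d X Y g $$ (x * 2 + k, p) = (X $$ (x, p) + phase g * (-1) ^ k * Y $$ (x, p)) / 2"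
proof -
  let ?M = "\<lambda>l. hadamard * proj l * (if g = 1 then phase_S else 1\<^sub>m 2) * hadamard * ket0"
  have M: "dim_row (?M l) = 2" "dim_col (?M l) = 1" for l
    by (simp_all add: hadamard_def ket0_def)
  have r: "x * 2 + k < d * 2" using assms by (intro pair_index_less)
  have kr: "kron Z (?M l) $$ (x * 2 + k, p) = Z $$ (x, p) * ?M l $$ (k, 0)" if "Z \<in> carrier_mat d d"
      for Z l
    using kron_simps(3)[of "x * 2 + k" Z "?M l" p] M[of l] r assms(3-5) that by simp
  have "hadamard_iso d X Y g $$ (x * 2 + k, p) = kron X (?M 0) $$ (x * 2 + k, p)
      + kron Y (?M 1) $$ (x * 2 + k, p)"
    unfolding hadamard_iso_eq[OF X Y] using r assms(5) X Y M[of 0] M[of 1] by (intro index_add_mat) auto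
  also have "\<dots> = X $$ (x, p) * ?M 0 $$ (k, 0) + Y $$ (x, p) * ?M 1 $$ (k, 0)"
    using kr[OF X] kr[OF Y] by simp
  also have "\<dots> = (X $$ (x, p) + phase g * (-1) ^ k * Y $$ (x, p)) / 2"
    by (subst (1 2) hadamard_branch) (use assms in \<open>auto simp: field_simps\<close>)
  finally show ?thesis .
qed

text \<open>In the Gram sum the cross terms between X and Y carry the sign (-1)^k and cancel over
  the ancilla index, leaving the average of the Gram matrices of two unitaries.\<close>

lemma hadamard_iso_isometry:
  assumes X: "unitary_mat d X" and Y: "unitary_mat d Y"
  shows "isometry_mat (d * 2) d (hadamard_iso d X Y g)"
proof -
  have c: "X \<in> carrier_mat d d" "Y \<in> carrier_mat d d" and e: "adj X * X = 1\<^sub>m d" "adj Y * Y = 1\<^sub>m d"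
    using X Y by (auto simp: unitary_mat_def)
  let ?K = "hadamard_iso d X Y g"
  have K: "?K \<in> carrier_mat (d * 2) d"
    using c by (intro carrier_matI) (simp_all add: hadamard_iso_def hadamard_def ket0_def)
  have "adj ?K * ?K = 1\<^sub>m d"
  proof (rule eq_matI)
    fix p q assume "p < dim_row (1\<^sub>m d)" "q < dim_col (1\<^sub>m d)"
    then have pq: "p < d" "q < d" by auto
    have gram: "(\<Sum>x<d. cnj (Z $$ (x, p)) * Z $$ (x, q)) = (if p = q then 1 else 0)"
      if "Z \<in> carrier_mat d d" "adj Z * Z = 1\<^sub>m d" for Z
    proof -
      have "(adj Z * Z) $$ (p, q) = (\<Sum>x<d. cnj (Z $$ (x, p)) * Z $$ (x, q))"
        using that(1) pq by (subst index_mult_mat_sum[where n = d]) auto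
      then show ?thesis using that(2) pq by simp
    qed
    have "(adj ?K * ?K) $$ (p, q) = (\<Sum>r<d * 2. cnj (?K $$ (r, p)) * ?K $$ (r, q))"
      using K pq by (subst index_mult_mat_sum[where n = "d * 2"]) auto
    also have "\<dots> = (\<Sum>r<d * 2. cnj (?K $$ (r div 2 * 2 + r mod 2, p)) * ?K $$ (r div 2 * 2
        + r mod 2, q))"
      by simp
    also have "\<dots> = (\<Sum>x<d. \<Sum>k<2. cnj (?K $$ (x * 2 + k, p)) * ?K $$ (x * 2 + k, q))"
      by (rule sum_pair_index)
    also have "\<dots> = (\<Sum>x<d. (cnj (X $$ (x, p)) * X $$ (x, q) + cnj (Y $$ (x, p)) * Y $$ (x, q)) / 2)"
    proof (intro sum.cong refl)
      fix x assume "x \<in> {..<d}"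
      then have x: "x < d" by simp
      have "(\<Sum>k<2. cnj (?K $$ (x * 2 + k, p)) * ?K $$ (x * 2 + k, q)) =
          (\<Sum>k<2. cnj ((X $$ (x, p) + phase g * (-1) ^ k * Y $$ (x, p)) / 2) * ((X $$ (x, q)
              + phase g * (-1) ^ k * Y $$ (x, q)) / 2))"
        using x pq by (intro sum.cong refl) (simp only: hadamard_iso_index[OF c] lessThan_iff)
      also have "\<dots> = (cnj (X $$ (x, p)) * X $$ (x, q) + (phase g * cnj (phase g))
          * (cnj (Y $$ (x, p)) * Y $$ (x, q))) / 2"
        by (simp add: lessThan_2 field_simps)
      finally show "(\<Sum>k<2. cnj (?K $$ (x * 2 + k, p)) * ?K $$ (x * 2 + k, q)) =
          (cnj (X $$ (x, p)) * X $$ (x, q) + cnj (Y $$ (x, p)) * Y $$ (x, q)) / 2"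
        by (simp add: phase_unit)
    qed
    also have "\<dots> = 1\<^sub>m d $$ (p, q)"
      using pq by (simp add: sum_divide_distrib[symmetric] sum.distrib gram[OF c(1) e(1)] gram[OF
          c(2) e(2)])
    finally show "(adj ?K * ?K) $$ (p, q) = 1\<^sub>m d $$ (p, q)" .
  qed (use K in auto)
  with K show ?thesis by (simp add: isometry_mat_def)
qed

lemma tensor_form_sigma_z:
  "tensor_form 2 2 (\<lambda>k k'. sigma_z $$ (k, k')) (\<lambda>l l'. sigma_z $$ (l, l')) f =
   f 0 0 0 0 - f 0 0 1 1 - f 1 1 0 0 + f 1 1 1 1"
  by (simp add: tensor_form_def lessThan_2 sigma_z_def)

lemma op_norm_sigma_z: "op_norm (kron sigma_z sigma_z) \<le> 1"
proof (rule op_norm_least)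
  let ?Z = "kron sigma_z sigma_z"
  have dims: "dim_row ?Z = 4" "dim_col ?Z = 4" by (simp_all add: sigma_z_def)
  fix v :: "complex vec" assume v: "v \<in> carrier_vec (dim_col ?Z)" "vnorm v \<le> 1"
  \<comment> \<open>\<sigma>_z \<otimes> \<sigma>_z is diagonal with entries 1, -1, -1, 1, so it
    preserves the modulus of every component.\<close>
  have Z: "?Z $$ (i, j) = (if i = j then (if i = 0 \<or> i = 3 then 1 else - 1) else 0)"
      if "i < 4" "j < 4" for i j
  proof -
    have "i \<in> {0, 1, 2, 3}" "j \<in> {0, 1, 2, 3}" using that by auto
    then show ?thesis by (auto simp: sigma_z_def kron_def)
  qed
  have "cmod ((?Z *\<^sub>v v) $ i) = cmod (v $ i)" if i: "i < 4" for i
  proof -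
    have "(?Z *\<^sub>v v) $ i = (\<Sum>j<4. ?Z $$ (i, j) * v $ j)"
      using mult_mat_vec_index[of i ?Z v] i v(1) dims by auto
    also have "\<dots> = (\<Sum>j<4. if j = i then (if i = 0 \<or> i = 3 then 1 else - 1) * v $ i else 0)"
      using i by (intro sum.cong refl) (simp add: Z)
    finally show ?thesis using i by simp
  qed
  then have "vnorm (?Z *\<^sub>v v) = vnorm v"
    using v(1) dims by (simp add: vnorm_def)
  with v(2) show "vnorm (?Z *\<^sub>v v) \<le> 1" by simp
qed

section \<open>The double Hadamard cut\<close>

text \<open>For \<open>A = v\<^sub>s \<cdot> v\<^sub>t\<^sup>*\<close>, \<open>B = v\<^sub>t \<cdot> v\<^sub>s\<^sup>*\<close> and likewise \<open>C\<close>, \<open>D\<close> on the second factor, the test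
    with \<open>g = 0\<close>
  yields \<open>(A + B)(C + D)/4\<close> and the one with \<open>g = 1\<close> yields \<open>-(A - B)(C
      - D)/4\<close>; their difference is \<open>(AC + BD)/2\<close>.\<close>
definition dh_term :: "nat \<Rightarrow> complex \<Rightarrow> complex \<Rightarrow> complex \<Rightarrow> complex \<Rightarrow> complex" where
  "dh_term g A B C D = (if g = 1 then - ((A - B) * (C - D)) / 4 else (A + B) * (C + D) / 4)"

lemma dh_term_diff: "dh_term 0 A B C D - dh_term 1 A B C D = (A * C + B * D) / 2"
  by (simp add: dh_term_def field_simps)

text \<open>The four signs of \<sigma>_z \<otimes> \<sigma>_z factor into one difference per party.
  In each difference the direct terms cancel and the interference terms double, which reduces the
  1/16 from the halves to 1/4. For g = 1 each factor is -i times A - B or C - D, and the two factors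
  -i multiply to the minus sign.\<close>

lemma dh_term_expand:
  assumes "\<omega> = phase g"
  shows "(vs + \<omega> * vt) / 2 * ((ws + \<omega> * wt) / 2) * \<rho> * cnj ((vs' + \<omega> * vt') / 2 * ((ws' + \<omega> * wt') / 2))
    - (vs + \<omega> * vt) / 2 * ((ws - \<omega> * wt) / 2) * \<rho> * cnj ((vs' + \<omega> * vt') / 2 * ((ws' - \<omega> * wt') / 2))
    - (vs - \<omega> * vt) / 2 * ((ws + \<omega> * wt) / 2) * \<rho> * cnj ((vs' - \<omega> * vt') / 2 * ((ws' + \<omega> * wt') / 2))
    + (vs - \<omega> * vt) / 2 * ((ws - \<omega> * wt) / 2) * \<rho> * cnj ((vs' - \<omega> * vt') / 2 * ((ws' - \<omega> * wt') / 2))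
    = \<rho> * dh_term g (vs * cnj vt') (vt * cnj vs') (ws * cnj wt') (wt * cnj ws')"
proof -
  have "(vs + \<omega> * vt) / 2 * ((ws + \<omega> * wt) / 2) * \<rho> * cnj ((vs' + \<omega> * vt') / 2 * ((ws' + \<omega> * wt') / 2))
    - (vs + \<omega> * vt) / 2 * ((ws - \<omega> * wt) / 2) * \<rho> * cnj ((vs' + \<omega> * vt') / 2 * ((ws' - \<omega> * wt') / 2))
    - (vs - \<omega> * vt) / 2 * ((ws + \<omega> * wt) / 2) * \<rho> * cnj ((vs' - \<omega> * vt') / 2 * ((ws' + \<omega> * wt') / 2))
    + (vs - \<omega> * vt) / 2 * ((ws - \<omega> * wt) / 2) * \<rho> * cnj ((vs' - \<omega> * vt') / 2 * ((ws' - \<omega> * wt') / 2))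
    = \<rho> / 16 * (((vs + \<omega> * vt) * (cnj vs' + cnj \<omega> * cnj vt') - (vs - \<omega> * vt) * (cnj vs' - cnj \<omega>
        * cnj vt')) *
        ((ws + \<omega> * wt) * (cnj ws' + cnj \<omega> * cnj wt') - (ws - \<omega> * wt) * (cnj ws' - cnj \<omega> * cnj wt')))"
    by (simp add: field_simps)
  also have "\<dots> = \<rho> / 16 * ((2 * (cnj \<omega> * (vs * cnj vt') + \<omega> * (vt * cnj vs'))) * (2 * (cnj \<omega> * (ws
      * cnj wt') + \<omega> * (wt * cnj ws'))))"
  proof -
    have "(x + \<omega> * y) * (x' + z * y') - (x - \<omega> * y) * (x' - z * y') = 2 * (z * (x * y') + \<omega> * (y
        * x'))" for x y x' y' z
      by (simp add: algebra_simps)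
    then show ?thesis by (simp only:)
  qed
  also have "\<dots> = \<rho> * dh_term g (vs * cnj vt') (vt * cnj vs') (ws * cnj wt') (wt * cnj ws')"
  proof (cases "g = 1")
    case True
    have factor: "cnj \<i> * A + \<i> * B = - (\<i> * (A - B))" for A B by (simp add: algebra_simps)
    have "2 * - (\<i> * x) * (2 * - (\<i> * y)) = 4 * ((\<i> * \<i>) * (x * y))" for x y
      by (simp only: mult_minus_left mult_minus_right minus_minus) (simp only: mult_ac, simp)
    then have "(2 * (cnj \<i> * A + \<i> * B)) * (2 * (cnj \<i> * C + \<i> * D)) = 4 * - ((A - B) * (C - D))"
        for A B C D
      unfolding factor by simp
    then show ?thesis using True assms by (simp only: phase_def dh_term_def if_True) simp
  next
    case False
    have "2 * x * (2 * y) = 4 * (x * y)" for x y :: complex by simp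
    then show ?thesis using False assms by (simp only: phase_def dh_term_def if_False
        complex_cnj_one mult_1) simp
  qed
  finally show ?thesis .
qed

lemma hadamard_iso_carrier:
  assumes "X \<in> carrier_mat d d" "Y \<in> carrier_mat d d"
  shows "hadamard_iso d X Y g \<in> carrier_mat (d * 2) d"
  using assms by (intro carrier_matI) (simp_all add: hadamard_iso_def hadamard_def ket0_def)

lemma dh_channel_obs_trace:
  assumes V: "V s \<in> carrier_mat a a" "V t \<in> carrier_mat a a" and W: "W s \<in> carrier_mat b b" "W t \<in>
      carrier_mat b b"
    and \<rho>: "\<rho> \<in> carrier_mat (a * b) (a * b)" and ij: "i < a * b" "j < a * b"
  shows "obs_trace a b sigma_z sigma_z (dh_channel a b V W s t g \<rho>) $$ (i, j) = (\<Sum>p<a * b. \<Sum>q<a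
      * b. \<rho> $$ (p, q) *
    dh_term g (V s $$ (i div b, p div b) * cnj (V t $$ (j div b, q div b))) (V t $$ (i div b, p div
        b) * cnj (V s $$ (j div b, q div b)))
      (W s $$ (i mod b, p mod b) * cnj (W t $$ (j mod b, q mod b))) (W t $$ (i mod b, p mod b)
          * cnj (W s $$ (j mod b, q mod b))))"
proof -
  let ?K = "hadamard_iso a (V s) (V t) g" and ?L = "hadamard_iso b (W s) (W t) g"
  let ?F = "\<lambda>k k' l l' p q. (?K $$ (i div b * 2 + k', p div b) * ?L $$ (i mod b * 2 + l', p mod b))
      * \<rho> $$ (p, q) *
        cnj (?K $$ (j div b * 2 + k, q div b) * ?L $$ (j mod b * 2 + l, q mod b))"
  note K = hadamard_iso_carrier[OF V] and L = hadamard_iso_carrier[OF W]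
  have ops: "product_ops (a, b) (a * 2, b * 2) [(?K, ?L)]"
    using K L by (simp add: product_ops_def)
  have "dh_channel a b V W s t g \<rho> = kraus_apply ((a * 2) * (b
      * 2)) (map (case_prod kron) [(?K, ?L)]) \<rho>"
    unfolding dh_channel_def Let_def
    by (rule eq_matI) (simp_all add: kraus_apply_def carrier_matD[OF K] carrier_matD[OF L] del:
        index_mult_mat(1))
  then have "obs_trace a b sigma_z sigma_z (dh_channel a b V W s t g \<rho>) $$ (i, j) =
      tensor_form 2 2 (\<lambda>k k'. sigma_z $$ (k, k')) (\<lambda>l l'. sigma_z $$ (l, l')) (\<lambda>k k' l l'. \<Sum>p<a
          * b. \<Sum>q<a * b. ?F k k' l l' p q)"
    using obs_trace_kraus_index[OF gate_carrier(5) gate_carrier(5) ops \<rho> ij] by simp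
  also have "\<dots> = (\<Sum>p<a * b. \<Sum>q<a * b. ?F 0 0 0 0 p q - ?F 0 0 1 1 p q - ?F 1 1 0 0 p q
      + ?F 1 1 1 1 p q)"
    unfolding tensor_form_sigma_z by (simp only: sum.distrib sum_subtractf)
  also have "\<dots> = (\<Sum>p<a * b. \<Sum>q<a * b. \<rho> $$ (p, q) *
    dh_term g (V s $$ (i div b, p div b) * cnj (V t $$ (j div b, q div b))) (V t $$ (i div b, p div
        b) * cnj (V s $$ (j div b, q div b)))
      (W s $$ (i mod b, p mod b) * cnj (W t $$ (j mod b, q mod b))) (W t $$ (i mod b, p mod b)
          * cnj (W s $$ (j mod b, q mod b))))"
  proof (intro sum.cong refl)
    fix p q assume "p \<in> {..<a * b}" "q \<in> {..<a * b}"
    then have pq: "p < a * b" "q < a * b" by auto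
    note l = div_mod_less[OF ij(1)] div_mod_less[OF ij(2)] div_mod_less[OF pq(1)] div_mod_less[OF pq(2)]
    have K0: "?K $$ (x * 2 + 0, y) = (V s $$ (x, y) + phase g * V t $$ (x, y)) / 2"
      and K1: "?K $$ (x * 2 + 1, y) = (V s $$ (x, y) - phase g * V t $$ (x, y)) / 2"
          if "x < a" "y < a" for x y
      using that hadamard_iso_index[OF V that(1) _ that(2), of 0 g] hadamard_iso_index[OF V that(1)
          _ that(2), of 1 g] by simp_all
    have L0: "?L $$ (x * 2 + 0, y) = (W s $$ (x, y) + phase g * W t $$ (x, y)) / 2"
      and L1: "?L $$ (x * 2 + 1, y) = (W s $$ (x, y) - phase g * W t $$ (x, y)) / 2"
          if "x < b" "y < b" for x y
      using that hadamard_iso_index[OF W that(1) _ that(2), of 0 g] hadamard_iso_index[OF W that(1)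
          _ that(2), of 1 g] by simp_all
    show "?F 0 0 0 0 p q - ?F 0 0 1 1 p q - ?F 1 1 0 0 p q + ?F 1 1 1 1 p q = \<rho> $$ (p, q) *
    dh_term g (V s $$ (i div b, p div b) * cnj (V t $$ (j div b, q div b))) (V t $$ (i div b, p div
        b) * cnj (V s $$ (j div b, q div b)))
      (W s $$ (i mod b, p mod b) * cnj (W t $$ (j mod b, q mod b))) (W t $$ (i mod b, p mod b)
          * cnj (W s $$ (j mod b, q mod b)))"
      unfolding K0[OF l(1) l(5)] K0[OF l(3) l(7)] K1[OF l(1) l(5)] K1[OF l(3) l(7)]
        L0[OF l(2) l(6)] L0[OF l(4) l(8)] L1[OF l(2) l(6)] L1[OF l(4) l(8)]
      by (rule dh_term_expand[OF refl])
  qed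
  finally show ?thesis .
qed

section \<open>Coefficients and action of the cut\<close>

lemma sum_list_double_hadamard_cut:
  fixes F :: "real \<times> (complex mat \<Rightarrow> complex mat) \<times> complex mat \<times> complex mat \<Rightarrow> 'a::comm_monoid_add"
  shows "(\<Sum>x\<leftarrow>double_hadamard_cut a b m c V W. F x) =
    (\<Sum>s<m. \<Sum>t<m. F (c s * c t, dh_channel a b V W s t 0, sigma_z, sigma_z)) +
    (\<Sum>s<m. \<Sum>t<m. if s \<noteq> t then F (- (c s * c t), dh_channel a b V W s t 1, sigma_z, sigma_z) else 0)"
proof -
  let ?P = "List.product [0..<m] [0..<m]"
  let ?F0 = "\<lambda>x. F (c (fst x) * c (snd x), dh_channel a b V W (fst x) (snd x) 0, sigma_z, sigma_z)"
  let ?F1 = "\<lambda>x. if fst x \<noteq> snd x then F (- (c (fst x) * c (snd x)), dh_channel a b V W (fst x) (snd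
      x) 1, sigma_z, sigma_z) else 0"
  have "(\<Sum>x\<leftarrow>double_hadamard_cut a b m c V W. F x) = (\<Sum>x\<leftarrow>?P. ?F0 x) + (\<Sum>x\<leftarrow>?P. ?F1 x)"
    unfolding double_hadamard_cut_def map_append sum_list_append map_concat sum_list_concat
    by (intro arg_cong2[where f = "(+)"] arg_cong[where f = sum_list]) (auto simp: split_def o_def)
  then show ?thesis by (simp only: sum_list_product fst_conv snd_conv)
qed

lemma double_hadamard_cut_elem:
  assumes "(x, E, OA, OB) \<in> set (double_hadamard_cut a b m c V W)"
  obtains s t g where "s < m" "t < m" "E = dh_channel a b V W s t g" "OA = sigma_z" "OB = sigma_z"
  using assms by (auto simp: double_hadamard_cut_def split: if_splits)

text \<open>The g = 0 terms contribute the square of the 1-norm of c. The g = 1 terms contribute the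
  same without the diagonal, that is, less the squared 2-norm.\<close>

lemma cut_norm_double_hadamard_cut:
  "cut_norm (double_hadamard_cut a b m c V W) = 2 * (\<Sum>j<m. \<bar>c j\<bar>)\<^sup>2 - (\<Sum>j<m. (c j)\<^sup>2)"
proof -
  have "cut_norm (double_hadamard_cut a b m c V W) = (\<Sum>s<m. \<Sum>t<m. \<bar>c s\<bar> * \<bar>c t\<bar>) + (\<Sum>s<m. \<Sum>t<m.
      if s \<noteq> t then \<bar>c s\<bar> * \<bar>c t\<bar> else 0)"
    unfolding cut_norm_def sum_lessThan_nth[of "\<lambda>x. \<bar>fst x\<bar>"] sum_list_double_hadamard_cut
        by (simp only: fst_conv abs_mult abs_minus_cancel)
  also have "(\<Sum>s<m. \<Sum>t<m. if s \<noteq> t then \<bar>c s\<bar> * \<bar>c t\<bar> else 0) = (\<Sum>s<m. \<Sum>t<m. \<bar>c s\<bar> * \<bar>c t\<bar> - (if t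
      = s then (c s)\<^sup>2 else 0))"
    by (intro sum.cong refl) (auto simp: power2_eq_square)
  also have "\<dots> = (\<Sum>s<m. \<Sum>t<m. \<bar>c s\<bar> * \<bar>c t\<bar>) - (\<Sum>s<m. (c s)\<^sup>2)"
    by (simp add: sum_subtractf)
  also have "(\<Sum>s<m. \<Sum>t<m. \<bar>c s\<bar> * \<bar>c t\<bar>) = (\<Sum>j<m. \<bar>c j\<bar>)\<^sup>2"
    by (simp add: power2_eq_square sum_product)
  finally show ?thesis by simp
qed

lemma cut_apply_index:
  assumes "i < a * b" "j < a * b"
  shows "cut_apply a b C \<rho> $$ (i, j) = (\<Sum>(x, E, OA, OB)\<leftarrow>C. of_real x
      * obs_trace a b OA OB (E \<rho>) $$ (i, j))"
proof -
  have "cut_apply a b C \<rho> $$ (i, j) = (\<Sum>t<length C. case C ! t of (x, E, OA, OB) \<Rightarrow> of_real x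
      * obs_trace a b OA OB (E \<rho>) $$ (i, j))"
    unfolding cut_apply_def using assms by (auto simp: obs_trace_def Let_def split: prod.splits
        intro!: sum.cong)
  then show ?thesis by (simp only: sum_lessThan_nth)
qed

lemma double_hadamard_cut_apply:
  assumes VW: "\<And>j. j < m \<Longrightarrow> V j \<in> carrier_mat a a \<and> W j \<in> carrier_mat b b"
    and U: "U = msum (a * b) m (\<lambda>j. complex_of_real (c j) \<cdot>\<^sub>m kron (V j) (W j))"
    and \<rho>: "\<rho> \<in> carrier_mat (a * b) (a * b)"
  shows "cut_apply a b (double_hadamard_cut a b m c V W) \<rho> = U * \<rho> * adj U"
proof (rule eq_matI)
  have U_carrier: "U \<in> carrier_mat (a * b) (a * b)" unfolding U by simp
  fix i j assume "i < dim_row (U * \<rho> * adj U)" "j < dim_col (U * \<rho> * adj U)"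
  then have ij: "i < a * b" "j < a * b" using U_carrier by auto
  define f where "f s i p = V s $$ (i div b, p div b) * W s $$ (i mod b, p mod b)" for s i p
  define A where "A s t p q = V s $$ (i div b, p div b) * cnj (V t $$ (j div b, q div b))" for s t p q
  define C where "C s t p q = W s $$ (i mod b, p mod b) * cnj (W t $$ (j mod b, q mod b))" for s t p q
  define h where "h g s t = (\<Sum>p<a * b. \<Sum>q<a * b. \<rho> $$ (p, q)
      * dh_term g (A s t p q) (A t s p q) (C s t p q) (C t s p q))" for g s t
  define F where "F s t = (\<Sum>p<a * b. \<Sum>q<a * b. f s i p * \<rho> $$ (p, q) * cnj (f t j q))" for s t
  have obs: "obs_trace a b sigma_z sigma_z (dh_channel a b V W s t g \<rho>) $$ (i, j) = h g s t"
      if "s < m" "t < m" for s t g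
    unfolding h_def A_def C_def using VW that \<rho> ij by (intro dh_channel_obs_trace) auto
  have diff: "h 0 s t - h 1 s t = (F s t + F t s) / 2" for s t
  proof -
    have "h 0 s t - h 1 s t = (\<Sum>p<a * b. \<Sum>q<a * b. \<rho> $$ (p, q) * ((A s t p q * C s t p q + A t s p q
        * C t s p q) / 2))"
      by (simp only: h_def sum_subtractf[symmetric] right_diff_distrib[symmetric] dh_term_diff)
    also have "\<dots> = (\<Sum>p<a * b. \<Sum>q<a * b. (f s i p * \<rho> $$ (p, q) * cnj (f t j q) + f t i p
        * \<rho> $$ (p, q) * cnj (f s j q)) / 2)"
      by (intro sum.cong refl) (simp add: A_def C_def f_def field_simps)
    also have "\<dots> = (F s t + F t s) / 2"
      by (simp only: F_def sum_divide_distrib[symmetric] sum.distrib)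
    finally show ?thesis .
  qed
  \<comment> \<open>With equal indices the g = 1 test has A = B and vanishes. This is why its
    diagonal terms can be left out of the cut, which lowers the 1-norm, and why they may be restored
    for the computation below.\<close>
  have diag: "h 1 s s = 0" for s by (simp add: h_def dh_term_def)
  have "cut_apply a b (double_hadamard_cut a b m c V W) \<rho> $$ (i, j) =
      (\<Sum>s<m. \<Sum>t<m. of_real (c s * c t) * obs_trace a b sigma_z sigma_z (dh_channel a b V W s t 0 \<rho>)
          $$ (i, j)) +
      (\<Sum>s<m. \<Sum>t<m. if s \<noteq> t then of_real (- (c s * c t)) * obs_trace a b sigma_z sigma_z (dh_channel
          a b V W s t 1 \<rho>) $$ (i, j) else 0)"
    unfolding cut_apply_index[OF ij] sum_list_double_hadamard_cut by (simp cong: if_cong)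
  also have "\<dots> = (\<Sum>s<m. \<Sum>t<m. of_real (c s * c t) * h 0 s t) + (\<Sum>s<m. \<Sum>t<m. of_real (- (c s * c t))
      * h 1 s t)"
    by (intro arg_cong2[where f = "(+)"] sum.cong refl) (auto simp: obs diag[unfolded One_nat_def])
  also have "\<dots> = (\<Sum>s<m. \<Sum>t<m. of_real (c s * c t) * (h 0 s t - h 1 s t))"
    by (simp add: sum.distrib[symmetric] right_diff_distrib)
  also have "\<dots> = ((\<Sum>s<m. \<Sum>t<m. of_real (c s * c t) * F s t) + (\<Sum>s<m. \<Sum>t<m. of_real (c s * c t)
      * F t s)) / 2"
    by (simp only: diff times_divide_eq_right distrib_left sum.distrib sum_divide_distrib[symmetric])
  \<comment> \<open>The coefficient c_s c_t is symmetric, so the symmetrised cross terms sum to the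
    unsymmetrised ones.\<close>
  also have "(\<Sum>s<m. \<Sum>t<m. of_real (c s * c t) * F t s) = (\<Sum>s<m. \<Sum>t<m. of_real (c s * c t) * F s t)"
    by (subst sum.swap) (simp add: mult.commute)
  also have "((\<Sum>s<m. \<Sum>t<m. of_real (c s * c t) * F s t) + (\<Sum>s<m. \<Sum>t<m. of_real (c s * c t)
      * F s t)) / 2 = (\<Sum>s<m. \<Sum>t<m. of_real (c s * c t) * F s t)"
    by simp
  also have "\<dots> = (\<Sum>(s, t, p, q)\<in>{..<m} \<times> {..<m} \<times> {..<a * b} \<times> {..<a * b}. (of_real (c s) * f s i p)
      * \<rho> $$ (p, q) * cnj (of_real (c t) * f t j q))"
    by (simp add: F_def sum_distrib_left mult_ac sum.cartesian_product[symmetric])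
  also have "\<dots> = (\<Sum>(p, q, s, t)\<in>{..<a * b} \<times> {..<a * b} \<times> {..<m} \<times> {..<m}. (of_real (c s) * f s i p)
      * \<rho> $$ (p, q) * cnj (of_real (c t) * f t j q))"
    by (rule sum.reindex_bij_witness[where i = "\<lambda>(p, q, s, t). (s, t, p, q)" and j
        = "\<lambda>(s, t, p, q). (p, q, s, t)"]) auto
  also have "\<dots> = (\<Sum>p<a * b. \<Sum>q<a * b. (\<Sum>s<m. of_real (c s) * f s i p) * \<rho> $$ (p, q)
      * cnj (\<Sum>t<m. of_real (c t) * f t j q))"
    by (simp add: sum_distrib_left sum_distrib_right mult_ac sum.cartesian_product[symmetric])
  also have "\<dots> = (\<Sum>p<a * b. \<Sum>q<a * b. U $$ (i, p) * \<rho> $$ (p, q) * cnj (U $$ (j, q)))"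
  proof -
    have "U $$ (k, p) = (\<Sum>s<m. of_real (c s) * f s k p)" if "k < a * b" "p < a * b" for k p
    proof -
      have "U $$ (k, p) = (\<Sum>s<m. (complex_of_real (c s) \<cdot>\<^sub>m kron (V s) (W s)) $$ (k, p))"
        unfolding U using that by simp
      also have "\<dots> = (\<Sum>s<m. of_real (c s) * f s k p)"
      proof (intro sum.cong refl)
        fix s assume "s \<in> {..<m}"
        then have "V s \<in> carrier_mat a a" "W s \<in> carrier_mat b b" using VW by auto
        then show "(complex_of_real (c s) \<cdot>\<^sub>m kron (V s) (W s)) $$ (k, p) = of_real (c s) * f s k p"
          using that by (simp add: f_def)
      qed
      finally show ?thesis .
    qed
    then show ?thesis using ij by (intro sum.cong refl) simp
  qed
  also have "\<dots> = (U * \<rho> * adj U) $$ (i, j)"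
    by (rule sandwich_index[OF U_carrier \<rho> ij, symmetric])
  finally show "cut_apply a b (double_hadamard_cut a b m c V W) \<rho> $$ (i, j) = (U * \<rho>
      * adj U) $$ (i, j)" .
qed (simp_all only: cut_apply_def msum_simps index_mult_mat adj_simps U)

lemma double_hadamard_cut_local:
  assumes VW: "\<forall>j<m. unitary_mat a (V j) \<and> unitary_mat b (W j)"
    and U: "U = msum (a * b) m (\<lambda>j. complex_of_real (c j) \<cdot>\<^sub>m kron (V j) (W j))"
  shows "local_space_like_cut a b (\<lambda>\<rho>. U * \<rho> * adj U) 2 2 (double_hadamard_cut a b m c V W)"
proof -
  let ?C = "double_hadamard_cut a b m c V W"
  have iso: "\<exists>KV KW. isometry_mat (a * 2) a KV \<and> isometry_mat (b * 2) b KW \<and>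
      (\<forall>\<rho>\<in>carrier_mat (a * b) (a * b). E \<rho> = kron KV KW * \<rho> * adj (kron KV KW))"
    if elem: "(x, E, OA, OB) \<in> set ?C" for x E OA OB
  proof -
    obtain s t g where st: "s < m" "t < m" "E = dh_channel a b V W s t g"
      using elem by (rule double_hadamard_cut_elem)
    show ?thesis
    proof (intro exI conjI ballI)
      show "isometry_mat (a * 2) a (hadamard_iso a (V s) (V t) g)" "isometry_mat (b
          * 2) b (hadamard_iso b (W s) (W t) g)"
        using VW st(1,2) by (auto intro: hadamard_iso_isometry)
    qed (simp only: st(3) dh_channel_def Let_def)
  qed
  have "LOCC_channel (a, b) (a * 2, b * 2) E \<and> OA \<in> carrier_mat 2 2 \<and> OB \<in> carrier_mat 2 2
      \<and> op_norm (kron OA OB) \<le> 1"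
    if elem: "(x, E, OA, OB) \<in> set ?C" for x E OA OB
  proof -
    obtain "OA = sigma_z" "OB = sigma_z" using elem by (rule double_hadamard_cut_elem)
    moreover have "LOCC_channel (a, b) (a * 2, b * 2) E"
    proof -
      obtain KV KW where "isometry_mat (a * 2) a KV" "isometry_mat (b * 2) b KW"
        "\<forall>\<rho>\<in>carrier_mat (a * b) (a * b). E \<rho> = kron KV KW * \<rho> * adj (kron KV KW)"
        using iso[OF elem] by (elim exE conjE)
      then show ?thesis by (intro LOCC_channel_local[of _ _ KV _ _ KW]) simp_all
    qed
    ultimately show ?thesis using gate_carrier(5) op_norm_sigma_z by simp
  qed
  moreover have "U * \<rho> * adj U = cut_apply a b ?C \<rho>" if "\<rho> \<in> carrier_mat (a * b) (a * b)" for \<rho>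
    using double_hadamard_cut_apply[OF _ U that] VW by (auto simp: unitary_mat_def)
  ultimately have "space_like_cut a b (\<lambda>\<rho>. U * \<rho> * adj U) 2 2 ?C"
    unfolding space_like_cut_def by auto
  with iso show ?thesis unfolding local_space_like_cut_def by auto
qed

theorem theorem1:
  fixes dA dB m :: nat and U :: "complex mat" and c :: "nat \<Rightarrow> real"
    and V W :: "nat \<Rightarrow> complex mat"
  assumes "0 < dA" and "0 < dB"
    and "unitary_mat (dA * dB) U"
    and "\<forall>j<m. unitary_mat dA (V j) \<and> unitary_mat dB (W j)"
    and "U = msum (dA * dB) m (\<lambda>j. complex_of_real (c j) \<cdot>\<^sub>m kron (V j) (W j))"
  defines "\<phi> \<equiv> 2 * (\<Sum>j<m. \<bar>c j\<bar>)\<^sup>2 - (\<Sum>j<m. (c j)\<^sup>2)"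
  shows "local_space_like_cut dA dB (\<lambda>\<rho>. U * \<rho> * adj U) 2 2 (double_hadamard_cut dA dB m c V W)
         \<and> cut_norm (double_hadamard_cut dA dB m c V W) = \<phi>
         \<and> (op_schmidt dA dB U m c V W \<longrightarrow>
              \<phi> = product_extent dA dB U \<and>
              product_extent dA dB U = gamma dA dB (\<lambda>\<rho>. U * \<rho> * adj U) \<and>
              gamma dA dB (\<lambda>\<rho>. U * \<rho> * adj U) = 2 * (\<Sum>j<m. \<bar>c j\<bar>)\<^sup>2 - 1)"
proof (intro conjI impI)
  show local: "local_space_like_cut dA dB (\<lambda>\<rho>. U * \<rho> * adj U) 2 2 (double_hadamard_cut dA dB m c V W)"
    by (rule double_hadamard_cut_local[OF assms(4,5)])
  show norm: "cut_norm (double_hadamard_cut dA dB m c V W) = \<phi>"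
    unfolding \<phi>_def by (rule cut_norm_double_hadamard_cut)
  assume sd: "op_schmidt dA dB U m c V W"
  have \<phi>: "\<phi> = 2 * (\<Sum>j<m. \<bar>c j\<bar>)\<^sup>2 - 1"
    using sd by (simp add: \<phi>_def op_schmidt_def)
  have lower: "\<phi> \<le> cut_norm C" if "space_like_cut dA dB (\<lambda>\<rho>. U * \<rho> * adj U) rA rB C" for C rA rB
    unfolding \<phi> by (rule cut_norm_ge_schmidt[OF assms(1-3) sd that])
  \<comment> \<open>The lower bound holds for cuts with ancillas of any dimension and is attained
    with two qubits, so the real infimum is a minimum.\<close>
  have gamma: "gamma dA dB (\<lambda>\<rho>. U * \<rho> * adj U) = \<phi>"
    unfolding gamma_def
  proof (rule cInf_eq_minimum)
    show "\<phi> \<in> {cut_norm C |C rA rB. space_like_cut dA dB (\<lambda>\<rho>. U * \<rho> * adj U) rA rB C}"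
      using local norm unfolding local_space_like_cut_def by blast
  qed (use lower in blast)
  have extent: "product_extent dA dB U = \<phi>"
    unfolding product_extent_def
  proof (rule cInf_eq_minimum)
    show "\<phi> \<in> {2 * (\<Sum>j<m. \<bar>c j\<bar>)\<^sup>2 - (\<Sum>j<m. (c j)\<^sup>2) |m c V W.
        (\<forall>j<m. unitary_mat dA (V j) \<and> unitary_mat dB (W j)) \<and>
        U = msum (dA * dB) m (\<lambda>j. complex_of_real (c j) \<cdot>\<^sub>m kron (V j) (W j))}"
      using assms(4,5) unfolding \<phi>_def by blast
  next
    fix x assume "x \<in> {2 * (\<Sum>j<m. \<bar>c j\<bar>)\<^sup>2 - (\<Sum>j<m. (c j)\<^sup>2) |m c V W.
        (\<forall>j<m. unitary_mat dA (V j) \<and> unitary_mat dB (W j)) \<and>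
        U = msum (dA * dB) m (\<lambda>j. complex_of_real (c j) \<cdot>\<^sub>m kron (V j) (W j))}"
    then obtain m' c' V' W' where x: "x = 2 * (\<Sum>j<m'. \<bar>c' j\<bar>)\<^sup>2 - (\<Sum>j<m'. (c' j)\<^sup>2)"
      and "\<forall>j<m'. unitary_mat dA (V' j) \<and> unitary_mat dB (W' j)"
      and "U = msum (dA * dB) m' (\<lambda>j. complex_of_real (c' j) \<cdot>\<^sub>m kron (V' j) (W' j))"
      by blast
    \<comment> \<open>The competing product decomposition has its own double Hadamard cut, with
      1-norm exactly x, and the lower bound applies to that cut.\<close>
    from double_hadamard_cut_local[OF this(2,3)]
    have "\<phi> \<le> cut_norm (double_hadamard_cut dA dB m' c' V' W')"
      using lower by (auto simp: local_space_like_cut_def)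
    then show "\<phi> \<le> x" unfolding cut_norm_double_hadamard_cut x .
  qed
  show "\<phi> = product_extent dA dB U" "product_extent dA dB U = gamma dA dB (\<lambda>\<rho>. U * \<rho> * adj U)"
    "gamma dA dB (\<lambda>\<rho>. U * \<rho> * adj U) = 2 * (\<Sum>j<m. \<bar>c j\<bar>)\<^sup>2 - 1"
    using extent gamma \<phi> by simp_all
qed

end
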